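(* The assignment $$F\mapsto \mathrm{Fr}(F),\qquad \alpha\mapsto\alpha!,$$ defines a covariant functor $\mathrm{STor}\to\mathrm{Tor}$ from the category of semi-torsors to the category of torsors, where a $G$-semi-torsor $F$ with index set $X$ is sent to the $G\wr X$-torsor $\mathrm{Fr}(F)$. Moreover, this functor is essentially constant on the subcategory $\mathrm{Tor}$, i.e. it leaves torsors unchanged up to the canonical isomorphism $\mathrm{Fr}(F)=F^X\cong F$ (where $X$ is a single point when $F$ is a torsor).
   Context: A $G$-manifold ($G$ a finite-dimensional Lie group) is a manifold with a smooth left $G$-action. A $G$-semi-torsor is a $G$-manifold $F$ whose action is free and whose orbit space $F/G$ is discrete; it is a $G$-torsor if the action is free and transitive. For a homomorphism $\xi\colon G_1\to G_2$, a map $\alpha\colon F_1\to F_2$ from a $G_1$-manifold to a $G_2$-manifold is $\xi$-equivariant if $\alpha(gf)=\xi(g)\alpha(f)$; such a map descends to a unique map on orbits $\alpha/\colon F_1/G_1\to F_2/G_2$. $\mathrm{STor}$ is the category whose objects are semi-torsors (over arbitrary Lie groups) and whose morphisms are the smooth maps $\alpha$ that are $\xi$-equivariant for some homomorphism $\xi$ and for which $\alpha/$ is a bijection. $\mathrm{Tor}$ is the category of torsors with equivariant maps; it is a full subcategory of $\mathrm{STor}$. Let $X$ be an index set bijective to $F/G$ (index sets of equal cardinality are identified, so that semi-torsors with bijective orbit spaces use the same $X$). A basis (frame) of $F$ is a function $\tilde f\colon X\to F$ such that $\phi_{\tilde f}\colon G\times X\to F$, $(g,x)\mapsto g\tilde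 f(x)$, is an isomorphism of $G$-sets (with $g(h,x)=(gh,x)$ on $G\times X$); $\mathrm{Fr}(F)\subset F^X$ is the set of bases, $F^X$ having the product topology. $G\wr X=G^X\rtimes\mathrm{Sym}(X)$ with $(\tilde g,\sigma)(\tilde g',\sigma')=(\tilde g(\tilde g'\circ\sigma^{-1}),\sigma\sigma')$, regarded as a topological/Lie group via this semi-direct product realization, acts on $\mathrm{Fr}(F)$ by $(\tilde g,\sigma)\tilde f=\tilde g(\tilde f\circ\sigma^{-1})$ (pointwise product). For a morphism $\alpha\colon F_1\to F_2$ of $\mathrm{STor}$, $\alpha!\colon\mathrm{Fr}(F_1)\to\mathrm{Fr}(F_2)$ is $\tilde f\mapsto\alpha\circ\tilde f$, equivariant with respect to $\xi!=(\xi^X,\mathrm{id}_{\mathrm{Sym}(X)})\colon G_1\wr X\to G_2\wr X$.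
   Formalization: For infinite X, Fr(F) in F^X with the product topology is never a manifold, so the functor into Tor (Lie groups, smooth maps) is stated for semi-torsors with finitely many orbits; on all of STor the functor is stated into topological torsors with continuous equivariant maps. *)

theory Defs
  imports "HOL-Analysis.Analysis" "HOL-Algebra.Group_Action"
begin

section \<open>Categories and functors\<close>

text \<open>
  Categories are presented by hom-sets, which need not be disjoint. \<open>Comp C a b c g f\<close> is the
  composite of \<open>f \<in> Hom C a b\<close> and \<open>g \<in> Hom C b c\<close>.
\<close>

record ('o, 'm) cat =
  Obj :: "'o set"
  Hom :: "'o \<Rightarrow> 'o \<Rightarrow> 'm set"
  Idn :: "'o \<Rightarrow> 'm"
  Comp :: "'o \<Rightarrow> 'o \<Rightarrow> 'o \<Rightarrow> 'm \<Rightarrow> 'm \<Rightarrow> 'm"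

definition is_category :: "('o, 'm) cat \<Rightarrow> bool" where
  "is_category C \<longleftrightarrow>
     (\<forall>a\<in>Obj C. Idn C a \<in> Hom C a a) \<and>
     (\<forall>a\<in>Obj C. \<forall>b\<in>Obj C. \<forall>c\<in>Obj C. \<forall>f\<in>Hom C a b. \<forall>g\<in>Hom C b c.
        Comp C a b c g f \<in> Hom C a c) \<and>
     (\<forall>a\<in>Obj C. \<forall>b\<in>Obj C. \<forall>f\<in>Hom C a b.
        Comp C a a b f (Idn C a) = f \<and> Comp C a b b (Idn C b) f = f) \<and>
     (\<forall>a\<in>Obj C. \<forall>b\<in>Obj C. \<forall>c\<in>Obj C. \<forall>d\<in>Obj C.
        \<forall>f\<in>Hom C a b. \<forall>g\<in>Hom C b c. \<forall>h\<in>Hom C c d.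
        Comp C a c d h (Comp C a b c g f) = Comp C a b d (Comp C b c d h g) f)"

definition is_functor ::
  "('o, 'm) cat \<Rightarrow> ('p, 'n) cat \<Rightarrow> ('o \<Rightarrow> 'p) \<Rightarrow> ('o \<Rightarrow> 'o \<Rightarrow> 'm \<Rightarrow> 'n) \<Rightarrow> bool" where
  "is_functor C D Fo Fm \<longleftrightarrow>
     is_category C \<and> is_category D \<and>
     (\<forall>a\<in>Obj C. Fo a \<in> Obj D) \<and>
     (\<forall>a\<in>Obj C. \<forall>b\<in>Obj C. \<forall>f\<in>Hom C a b. Fm a b f \<in> Hom D (Fo a) (Fo b)) \<and>
     (\<forall>a\<in>Obj C. Fm a a (Idn C a) = Idn D (Fo a)) \<and>
     (\<forall>a\<in>Obj C. \<forall>b\<in>Obj C. \<forall>c\<in>Obj C. \<forall>f\<in>Hom C a b. \<forall>g\<in>Hom C b c.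
        Fm a c (Comp C a b c g f) = Comp D (Fo a) (Fo b) (Fo c) (Fm b c g) (Fm a b f))"

section \<open>Smooth manifolds\<close>

text \<open>
  For a finite set \<open>I\<close> of coordinates, the model space is the product \<open>\<real>\<^sup>I\<close>. Indexing coordinates
  by a set rather than by a type lets manifolds of different dimensions live in one type.
\<close>

abbreviation Rn :: "'i set \<Rightarrow> ('i \<Rightarrow> real) topology" where
  "Rn I \<equiv> product_topology (\<lambda>_. euclideanreal) I"

text \<open>
  \<open>Ck_on k I A f\<close>: the real function \<open>f\<close> is of class \<open>C\<^sup>k\<close> on the open set \<open>A \<subseteq> \<real>\<^sup>I\<close>, that is, its
  iterated partial derivatives of order at most \<open>k\<close> exist and are continuous on \<open>A\<close>.
\<close>

primrec Ck_on :: "nat \<Rightarrow> 'i set \<Rightarrow> ('i \<Rightarrow> real) set \<Rightarrow> (('i \<Rightarrow> real) \<Rightarrow> real) \<Rightarrow> bool" where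
  "Ck_on 0 I A f \<longleftrightarrow> continuous_map (subtopology (Rn I) A) euclideanreal f"
| "Ck_on (Suc k) I A f \<longleftrightarrow>
     continuous_map (subtopology (Rn I) A) euclideanreal f \<and>
     (\<forall>i\<in>I. \<exists>f'. (\<forall>y\<in>A. ((\<lambda>t. f (y(i := t))) has_real_derivative f' y) (at (y i))) \<and>
                 Ck_on k I A f')"

definition smooth_on ::
  "'i set \<Rightarrow> ('i \<Rightarrow> real) set \<Rightarrow> 'j set \<Rightarrow> (('i \<Rightarrow> real) \<Rightarrow> ('j \<Rightarrow> real)) \<Rightarrow> bool" where
  "smooth_on I A J h \<longleftrightarrow> (\<forall>j\<in>J. \<forall>k. Ck_on k I A (\<lambda>y. h y j))"

text \<open>
  A chart is a pair of its domain and its coordinate map. The atlas need not be maximal.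
\<close>

record ('p, 'i) mfd =
  mtop :: "'p topology"
  midx :: "'i set"
  atlas :: "('p set \<times> ('p \<Rightarrow> 'i \<Rightarrow> real)) set"

definition smooth_manifold :: "('p, 'i) mfd \<Rightarrow> bool" where
  "smooth_manifold M \<longleftrightarrow>
     Hausdorff_space (mtop M) \<and> second_countable (mtop M) \<and> finite (midx M) \<and>
     (\<forall>(U, \<phi>)\<in>atlas M.
        openin (mtop M) U \<and> openin (Rn (midx M)) (\<phi> ` U) \<and>
        homeomorphic_map (subtopology (mtop M) U) (subtopology (Rn (midx M)) (\<phi> ` U)) \<phi>) \<and>
     (\<Union>(U, \<phi>)\<in>atlas M. U) = topspace (mtop M) \<and>
     (\<forall>(U, \<phi>)\<in>atlas M. \<forall>(V, \<psi>)\<in>atlas M.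
        smooth_on (midx M) (\<phi> ` (U \<inter> V)) (midx M) (\<lambda>y. \<psi> (inv_into U \<phi> y)))"

definition smooth_map :: "('p, 'i) mfd \<Rightarrow> ('q, 'j) mfd \<Rightarrow> ('p \<Rightarrow> 'q) \<Rightarrow> bool" where
  "smooth_map M N f \<longleftrightarrow>
     continuous_map (mtop M) (mtop N) f \<and>
     (\<forall>(U, \<phi>)\<in>atlas M. \<forall>(V, \<psi>)\<in>atlas N.
        smooth_on (midx M) (\<phi> ` (U \<inter> f -` V)) (midx N) (\<lambda>y. \<psi> (f (inv_into U \<phi> y))))"

definition prod_mfd :: "('p, 'i) mfd \<Rightarrow> ('q, 'j) mfd \<Rightarrow> ('p \<times> 'q, 'i + 'j) mfd" where
  "prod_mfd M N =
     \<lparr>mtop = prod_topology (mtop M) (mtop N),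
      midx = midx M <+> midx N,
      atlas = {(U \<times> V, \<lambda>(p, q). \<lambda>k\<in>midx M <+> midx N. case k of Inl i \<Rightarrow> \<phi> p i | Inr j \<Rightarrow> \<psi> q j)
               | U \<phi> V \<psi>. (U, \<phi>) \<in> atlas M \<and> (V, \<psi>) \<in> atlas N}\<rparr>"

text \<open>
  The power \<open>M\<^sup>X\<close>, with one chart for each family \<open>c\<close> of charts of \<open>M\<close>. Its topology is the product
  topology for every \<open>X\<close>; it is a finite-dimensional manifold when \<open>X\<close> is finite.
\<close>

definition power_mfd :: "'x set \<Rightarrow> ('p, 'i) mfd \<Rightarrow> ('x \<Rightarrow> 'p, 'x \<times> 'i) mfd" where
  "power_mfd X M =
     \<lparr>mtop = product_topology (\<lambda>_. mtop M) X,
      midx = X \<times> midx M,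
      atlas = {(\<Pi>\<^sub>E x\<in>X. fst (c x), \<lambda>p. \<lambda>(x, i)\<in>X \<times> midx M. snd (c x) (p x) i)
               | c. c \<in> X \<rightarrow> atlas M}\<rparr>"

definition restrict_mfd :: "('p, 'i) mfd \<Rightarrow> 'p set \<Rightarrow> ('p, 'i) mfd" where
  "restrict_mfd M W =
     \<lparr>mtop = subtopology (mtop M) W,
      midx = midx M,
      atlas = {(U \<inter> W, \<phi>) | U \<phi>. (U, \<phi>) \<in> atlas M}\<rparr>"

text \<open>
  A space with all its points as charts; it is a \<open>0\<close>-dimensional manifold when the space is
  countable and discrete. The only point of \<open>\<real>\<^sup>\<emptyset>\<close> is the function that is undefined everywhere.
\<close>

definition points_mfd :: "'p topology \<Rightarrow> ('p, unit) mfd" where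
  "points_mfd T = \<lparr>mtop = T, midx = {}, atlas = {({p}, \<lambda>_ _. undefined) | p. p \<in> topspace T}\<rparr>"

section \<open>Lie groups and topological groups\<close>

definition lie_group :: "'g monoid \<Rightarrow> ('g, 'i) mfd \<Rightarrow> bool" where
  "lie_group G M \<longleftrightarrow>
     group G \<and> smooth_manifold M \<and> topspace (mtop M) = carrier G \<and>
     smooth_map (prod_mfd M M) M (\<lambda>(g, h). g \<otimes>\<^bsub>G\<^esub> h) \<and>
     smooth_map M M (\<lambda>g. inv\<^bsub>G\<^esub> g)"

definition topological_group :: "'g monoid \<Rightarrow> 'g topology \<Rightarrow> bool" where
  "topological_group G T \<longleftrightarrow>
     group G \<and> topspace T = carrier G \<and>
     continuous_map (prod_topology T T) T (\<lambda>(g, h). g \<otimes>\<^bsub>G\<^esub> h) \<and>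
     continuous_map T T (\<lambda>g. inv\<^bsub>G\<^esub> g)"

section \<open>Spaces with a group action\<close>

record ('g, 'f, 'i, 'j) gspace =
  grp :: "'g monoid"
  gmfd :: "('g, 'i) mfd"
  fmfd :: "('f, 'j) mfd"
  act :: "'g \<Rightarrow> 'f \<Rightarrow> 'f"

abbreviation pts :: "('g, 'f, 'i, 'j) gspace \<Rightarrow> 'f set" where
  "pts S \<equiv> topspace (mtop (fmfd S))"

abbreviation orb :: "('g, 'f, 'i, 'j) gspace \<Rightarrow> 'f \<Rightarrow> 'f set" where
  "orb S f \<equiv> orbit (grp S) (act S) f"

abbreviation orbs :: "('g, 'f, 'i, 'j) gspace \<Rightarrow> 'f set set" where
  "orbs S \<equiv> orbits (grp S) (pts S) (act S)"

definition G_manifold :: "('g, 'f, 'i, 'j) gspace \<Rightarrow> bool" where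
  "G_manifold S \<longleftrightarrow>
     lie_group (grp S) (gmfd S) \<and> smooth_manifold (fmfd S) \<and>
     group_action (grp S) (pts S) (act S) \<and>
     smooth_map (prod_mfd (gmfd S) (fmfd S)) (fmfd S) (\<lambda>(g, f). act S g f)"

text \<open>The topological counterpart of a \<open>G\<close>-manifold; it ignores the charts.\<close>

definition topological_G_space :: "('g, 'f, 'i, 'j) gspace \<Rightarrow> bool" where
  "topological_G_space S \<longleftrightarrow>
     topological_group (grp S) (mtop (gmfd S)) \<and>
     group_action (grp S) (pts S) (act S) \<and>
     continuous_map (prod_topology (mtop (gmfd S)) (mtop (fmfd S))) (mtop (fmfd S))
       (\<lambda>(g, f). act S g f)"

definition free_act :: "('g, 'f, 'i, 'j) gspace \<Rightarrow> bool" where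
  "free_act S \<longleftrightarrow> (\<forall>f\<in>pts S. \<forall>g\<in>carrier (grp S). act S g f = f \<longrightarrow> g = \<one>\<^bsub>grp S\<^esub>)"

text \<open>A transitive action has exactly one orbit, so the empty space is excluded.\<close>

definition transitive_act :: "('g, 'f, 'i, 'j) gspace \<Rightarrow> bool" where
  "transitive_act S \<longleftrightarrow> pts S \<noteq> {} \<and> transitive_action (grp S) (pts S) (act S)"

text \<open>The orbit space is discrete: the quotient topology on the set of orbits is the discrete one.\<close>

definition discrete_orbit_space :: "('g, 'f, 'i, 'j) gspace \<Rightarrow> bool" where
  "discrete_orbit_space S \<longleftrightarrow> quotient_map (mtop (fmfd S)) (discrete_topology (orbs S)) (orb S)"

definition semi_torsor :: "('g, 'f, 'i, 'j) gspace \<Rightarrow> bool" where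
  "semi_torsor S \<longleftrightarrow> G_manifold S \<and> free_act S \<and> discrete_orbit_space S"

definition torsor :: "('g, 'f, 'i, 'j) gspace \<Rightarrow> bool" where
  "torsor S \<longleftrightarrow> G_manifold S \<and> free_act S \<and> transitive_act S"

definition topological_torsor :: "('g, 'f, 'i, 'j) gspace \<Rightarrow> bool" where
  "topological_torsor S \<longleftrightarrow> topological_G_space S \<and> free_act S \<and> transitive_act S"

section \<open>Morphisms and the categories of semi-torsors and torsors\<close>

definition equivariant ::
  "('g, 'f, 'i, 'j) gspace \<Rightarrow> ('h, 'e, 'k, 'l) gspace \<Rightarrow> ('g \<Rightarrow> 'h) \<Rightarrow> ('f \<Rightarrow> 'e) \<Rightarrow> bool" where
  "equivariant S S' \<xi> \<alpha> \<longleftrightarrow>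
     (\<forall>g\<in>carrier (grp S). \<forall>f\<in>pts S. \<alpha> (act S g f) = act S' (\<xi> g) (\<alpha> f))"

text \<open>
  The map on orbits induced by an equivariant map. For each orbit the image below is the singleton
  containing the orbit of \<open>\<alpha> f\<close>, for any \<open>f\<close> in the given orbit.
\<close>

definition orbit_map ::
  "('g, 'f, 'i, 'j) gspace \<Rightarrow> ('h, 'e, 'k, 'l) gspace \<Rightarrow> ('f \<Rightarrow> 'e) \<Rightarrow> 'f set \<Rightarrow> 'e set" where
  "orbit_map S S' \<alpha> = (\<lambda>\<Omega>\<in>orbs S. the_elem ((\<lambda>f. orb S' (\<alpha> f)) ` \<Omega>))"

text \<open>Morphisms are extensional, so that equality of morphisms is equality on the points.\<close>

definition tor_hom ::
  "('g, 'f, 'i, 'j) gspace \<Rightarrow> ('h, 'e, 'k, 'l) gspace \<Rightarrow> ('f \<Rightarrow> 'e) set" where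
  "tor_hom S S' = {\<alpha> \<in> extensional (pts S). smooth_map (fmfd S) (fmfd S') \<alpha> \<and>
     (\<exists>\<xi>\<in>hom (grp S) (grp S'). smooth_map (gmfd S) (gmfd S') \<xi> \<and> equivariant S S' \<xi> \<alpha>)}"

definition stor_hom ::
  "('g, 'f, 'i, 'j) gspace \<Rightarrow> ('h, 'e, 'k, 'l) gspace \<Rightarrow> ('f \<Rightarrow> 'e) set" where
  "stor_hom S S' = {\<alpha> \<in> extensional (pts S). smooth_map (fmfd S) (fmfd S') \<alpha> \<and>
     (\<exists>\<xi>\<in>hom (grp S) (grp S'). smooth_map (gmfd S) (gmfd S') \<xi> \<and> equivariant S S' \<xi> \<alpha>) \<and>
     bij_betw (orbit_map S S' \<alpha>) (orbs S) (orbs S')}"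

definition toptor_hom ::
  "('g, 'f, 'i, 'j) gspace \<Rightarrow> ('h, 'e, 'k, 'l) gspace \<Rightarrow> ('f \<Rightarrow> 'e) set" where
  "toptor_hom S S' = {\<alpha> \<in> extensional (pts S). continuous_map (mtop (fmfd S)) (mtop (fmfd S')) \<alpha> \<and>
     (\<exists>\<xi>\<in>hom (grp S) (grp S'). continuous_map (mtop (gmfd S)) (mtop (gmfd S')) \<xi> \<and>
        equivariant S S' \<xi> \<alpha>)}"

definition tor_iso ::
  "('g, 'f, 'i, 'j) gspace \<Rightarrow> ('h, 'e, 'k, 'l) gspace \<Rightarrow> ('f \<Rightarrow> 'e) \<Rightarrow> bool" where
  "tor_iso S S' \<alpha> \<longleftrightarrow> \<alpha> \<in> tor_hom S S' \<and>
     (\<exists>\<beta>\<in>tor_hom S' S. compose (pts S) \<beta> \<alpha> = (\<lambda>f\<in>pts S. f) \<and>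
        compose (pts S') \<alpha> \<beta> = (\<lambda>f\<in>pts S'. f))"

definition STor :: "(('g, 'f, 'i, 'j) gspace, 'f \<Rightarrow> 'f) cat" where
  "STor = \<lparr>Obj = {S. semi_torsor S}, Hom = stor_hom, Idn = (\<lambda>S. \<lambda>f\<in>pts S. f),
           Comp = (\<lambda>S _ _ \<beta> \<alpha>. compose (pts S) \<beta> \<alpha>)\<rparr>"

text \<open>The full subcategory of semi-torsors with finitely many orbits.\<close>

definition FinSTor :: "(('g, 'f, 'i, 'j) gspace, 'f \<Rightarrow> 'f) cat" where
  "FinSTor = STor\<lparr>Obj := {S. semi_torsor S \<and> finite (orbs S)}\<rparr>"

definition Tor :: "(('g, 'f, 'i, 'j) gspace, 'f \<Rightarrow> 'f) cat" where
  "Tor = \<lparr>Obj = {S. torsor S}, Hom = tor_hom, Idn = (\<lambda>S. \<lambda>f\<in>pts S. f),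
          Comp = (\<lambda>S _ _ \<beta> \<alpha>. compose (pts S) \<beta> \<alpha>)\<rparr>"

definition TopTor :: "(('g, 'f, 'i, 'j) gspace, 'f \<Rightarrow> 'f) cat" where
  "TopTor = \<lparr>Obj = {S. topological_torsor S}, Hom = toptor_hom, Idn = (\<lambda>S. \<lambda>f\<in>pts S. f),
             Comp = (\<lambda>S _ _ \<beta> \<alpha>. compose (pts S) \<beta> \<alpha>)\<rparr>"

section \<open>Frames\<close>

text \<open>
  A choice of index sets: \<open>X S\<close> is equipotent to the orbit space of \<open>S\<close>, and semi-torsors with
  equipotent orbit spaces have the same index set.
\<close>

definition index_choice :: "(('g, 'f, 'i, 'j) gspace \<Rightarrow> 'x set) \<Rightarrow> bool" where
  "index_choice X \<longleftrightarrow>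
     (\<forall>S. semi_torsor S \<longrightarrow> X S \<approx> orbs S) \<and>
     (\<forall>S S'. semi_torsor S \<longrightarrow> semi_torsor S' \<longrightarrow> orbs S \<approx> orbs S' \<longrightarrow> X S = X S')"

lemma index_choice_exists:
  "index_choice (\<lambda>S :: ('g, 'f, 'i, 'j) gspace. SOME A :: 'f set set. A \<approx> orbs S)"
proof -
  have 1: "(SOME A :: 'f set set. A \<approx> orbs S) \<approx> orbs S" for S :: "('g, 'f, 'i, 'j) gspace"
    by (rule someI[where x = "orbs S"]) simp
  have 2: "(\<lambda>A :: 'f set set. A \<approx> orbs S) = (\<lambda>A. A \<approx> orbs S')" if "orbs S \<approx> orbs S'"
    for S S' :: "('g, 'f, 'i, 'j) gspace"
    using that by (meson eqpoll_sym eqpoll_trans)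
  show ?thesis
    unfolding index_choice_def using 1 2 by metis
qed

definition gset_iso ::
  "'g monoid \<Rightarrow> 'a set \<Rightarrow> ('g \<Rightarrow> 'a \<Rightarrow> 'a) \<Rightarrow> 'b set \<Rightarrow> ('g \<Rightarrow> 'b \<Rightarrow> 'b) \<Rightarrow> ('a \<Rightarrow> 'b) \<Rightarrow> bool" where
  "gset_iso G A a B b \<phi> \<longleftrightarrow>
     bij_betw \<phi> A B \<and> (\<forall>g\<in>carrier G. \<forall>p\<in>A. \<phi> (a g p) = b g (\<phi> p))"

definition frames :: "'x set \<Rightarrow> ('g, 'f, 'i, 'j) gspace \<Rightarrow> ('x \<Rightarrow> 'f) set" where
  "frames X S = {f \<in> X \<rightarrow>\<^sub>E pts S.
     gset_iso (grp S) (carrier (grp S) \<times> X) (\<lambda>g (h, x). (g \<otimes>\<^bsub>grp S\<^esub> h, x)) (pts S) (act S)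
       (\<lambda>(g, x). act S g (f x))}"

text \<open>
  The group \<open>G \<wr> X\<close>. Permutations of \<open>X\<close> are extensional functions, as in \<^const>\<open>BijGroup\<close>.
\<close>

definition wreath :: "'g monoid \<Rightarrow> 'x set \<Rightarrow> (('x \<Rightarrow> 'g) \<times> ('x \<Rightarrow> 'x)) monoid" where
  "wreath G X =
     \<lparr>carrier = (X \<rightarrow>\<^sub>E carrier G) \<times> Bij X,
      mult = (\<lambda>(g, \<sigma>) (g', \<sigma>'). (\<lambda>x\<in>X. g x \<otimes>\<^bsub>G\<^esub> g' (inv_into X \<sigma> x), compose X \<sigma> \<sigma>')),
      one = (\<lambda>x\<in>X. \<one>\<^bsub>G\<^esub>, \<lambda>x\<in>X. x)\<rparr>"

text \<open>
  \<open>Sym(X)\<close> carries the topology of pointwise convergence, as a subspace of \<open>X\<^sup>X\<close> with \<open>X\<close> discrete.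
  It is discrete when \<open>X\<close> is finite.
\<close>

definition sym_topology :: "'x set \<Rightarrow> ('x \<Rightarrow> 'x) topology" where
  "sym_topology X = subtopology (product_topology (\<lambda>_. discrete_topology X) X) (Bij X)"

definition wreath_mfd ::
  "('g, 'i) mfd \<Rightarrow> 'x set \<Rightarrow> (('x \<Rightarrow> 'g) \<times> ('x \<Rightarrow> 'x), ('x \<times> 'i) + unit) mfd" where
  "wreath_mfd M X = prod_mfd (power_mfd X M) (points_mfd (sym_topology X))"

text \<open>
  \<open>Fr(F)\<close> as a space with an action of \<open>G \<wr> X\<close>. The topologies are the intended ones for all \<open>X\<close>;
  the charts are meaningful when \<open>X\<close> is finite, \<open>Fr(F)\<close> being then open in \<open>F\<^sup>X\<close>. As required by
  \<^const>\<open>group_action\<close>, each group element acts by an extensional function.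
\<close>

definition Fr ::
  "('g, 'f, 'i, 'j) gspace \<Rightarrow> 'x set \<Rightarrow>
   (('x \<Rightarrow> 'g) \<times> ('x \<Rightarrow> 'x), 'x \<Rightarrow> 'f, ('x \<times> 'i) + unit, 'x \<times> 'j) gspace" where
  "Fr S X =
     \<lparr>grp = wreath (grp S) X,
      gmfd = wreath_mfd (gmfd S) X,
      fmfd = restrict_mfd (power_mfd X (fmfd S)) (frames X S),
      act = (\<lambda>(g, \<sigma>). \<lambda>f\<in>frames X S. \<lambda>x\<in>X. act S (g x) (f (inv_into X \<sigma> x)))\<rparr>"

text \<open>The map \<open>\<alpha>!\<close> on the frames of \<open>S\<close> with index set \<open>X\<close>.\<close>

definition Fr_map ::
  "('g, 'f, 'i, 'j) gspace \<Rightarrow> 'x set \<Rightarrow> ('f \<Rightarrow> 'e) \<Rightarrow> ('x \<Rightarrow> 'f) \<Rightarrow> ('x \<Rightarrow> 'e)" where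
  "Fr_map S X \<alpha> = (\<lambda>f\<in>frames X S. compose X \<alpha> f)"

text \<open>For a one-point set \<open>X\<close>, the evaluation \<open>Fr(F) = F\<^sup>X \<rightarrow> F\<close>.\<close>

definition Fr_eval :: "('g, 'f, 'i, 'j) gspace \<Rightarrow> 'x set \<Rightarrow> ('x \<Rightarrow> 'f) \<Rightarrow> 'f" where
  "Fr_eval S X = (\<lambda>f\<in>frames X S. f (the_elem X))"

end

theory Submission
  imports Defs
begin

text \<open>
  A point of a semi-torsor \<open>F\<close> is reached from any chosen representative of its orbit by exactly one
  group element. Hence \<open>f \<in> F\<^sup>X\<close> is a frame if and only if \<open>x \<mapsto> G f(x)\<close> is a bijection from \<open>X\<close> to
  \<open>F/G\<close> (\<open>frames_iff\<close>), and nearly everything about frames follows from this description. A map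
  \<open>\<alpha>\<close> that is bijective on orbits carries frames to frames (\<open>compose_frame\<close>). Two frames \<open>f\<close> and
  \<open>f'\<close> number the same set of orbits, which yields a unique permutation \<open>\<sigma>\<close> and then, orbit by
  orbit, unique elements \<open>g(x)\<close> with \<open>f' = (g, \<sigma>) f\<close>; so \<open>G \<wr> X\<close> acts freely and transitively
  (\<open>free_Fr\<close>, \<open>transitive_Fr\<close>). As orbits are open, the frames are open in \<open>F\<^sup>X\<close> for finite \<open>X\<close>
  (\<open>frames_open\<close>), and \<open>Fr(F)\<close> is then a manifold. For a torsor there is one orbit, every element of
  \<open>F\<^sup>X\<close> is a frame, and evaluation at the only point of \<open>X\<close> is an isomorphism with the constant
  frames as its inverse.

  The multiplication of \<open>G \<wr> X\<close> and its action on frames involve the argument \<open>\<sigma>\<^sup>-\<^sup>1 x\<close>, which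
  depends on the point of the space. In the topology of pointwise convergence it is locally constant
  (\<open>inv_permutation_locally_constant\<close>). So each coordinate of these maps agrees locally with a map
  built from coordinate projections, the operations of \<open>G\<close> and the action on \<open>F\<close>. This argument uses
  only that the maps in question compose, pair, can be tested on coordinates and can be tested
  locally. Continuous maps have these properties for all \<open>X\<close>, and smooth maps for finite \<open>X\<close>. The
  predicate \<open>regular_map s\<close> stands for smoothness or continuity according to \<open>s\<close>, and
  \<open>Fr_functor\<close> gives the functors into \<open>TopTor\<close> and \<open>Tor\<close> from one proof.

  For smooth maps these properties rest on the chain rule for functions whose iterated partial
  derivatives are continuous (\<open>Ck_on_compose\<close>). It makes smoothness independent of the charts used
  to test it, and so smooth maps compose (\<open>smooth_map_compose\<close>).
\<close>

section \<open>Functions with continuous partial derivatives\<close>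

lemma continuous_map_coordinate_line:
  assumes "y \<in> topspace (Rn I)" "i \<in> I"
  shows "continuous_map euclideanreal (Rn I) (\<lambda>t. y(i := t))"
  using assms by (auto simp: continuous_map_componentwise extensional_def PiE_def)

lemma open_coordinate_slice:
  assumes "openin (Rn I) A" "y \<in> A" "i \<in> I"
  shows "open {t. y(i := t) \<in> A}"
proof -
  have "y \<in> topspace (Rn I)"
    using assms openin_subset by blast
  from openin_continuous_map_preimage[OF continuous_map_coordinate_line[OF this assms(3)] assms(1)]
  show ?thesis by simp
qed

lemma Ck_on_imp_continuous:
  "Ck_on k I A f \<Longrightarrow> continuous_map (subtopology (Rn I) A) euclideanreal f"
  by (cases k) auto

lemma Ck_on_partial:
  assumes "Ck_on (Suc k) I A f" "i \<in> I"
  shows "\<exists>f'. (\<forall>y\<in>A. ((\<lambda>t. f (y(i := t))) has_real_derivative f' y) (at (y i))) \<and> Ck_on k I A f'"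
  using assms by simp

lemma Ck_on_SucD: "Ck_on (Suc k) I A f \<Longrightarrow> Ck_on k I A f"
proof (induction k arbitrary: f)
  case (Suc k)
  show ?case
    unfolding Ck_on.simps(2)[of k]
  proof (intro conjI ballI)
    fix i assume "i \<in> I"
    then obtain f' where "\<forall>y\<in>A. ((\<lambda>t. f (y(i := t))) has_real_derivative f' y) (at (y i))"
      and "Ck_on (Suc k) I A f'"
      using Suc.prems unfolding Ck_on.simps(2)[of "Suc k"] by blast
    then show "\<exists>f'. (\<forall>y\<in>A. ((\<lambda>t. f (y(i := t))) has_real_derivative f' y) (at (y i))) \<and> Ck_on k I A f'"
      using Suc.IH by blast
  qed (use Suc.prems in simp)
qed simp

lemma Ck_on_mono: "Ck_on k I A f \<Longrightarrow> B \<subseteq> A \<Longrightarrow> Ck_on k I B f"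
proof (induction k arbitrary: f)
  case (Suc k)
  show ?case
    unfolding Ck_on.simps(2)
  proof (intro conjI ballI)
    show "continuous_map (subtopology (Rn I) B) euclideanreal f"
      using Suc.prems continuous_map_from_subtopology_mono unfolding Ck_on.simps(2) by blast
    fix i assume "i \<in> I"
    then obtain f' where "\<forall>y\<in>A. ((\<lambda>t. f (y(i := t))) has_real_derivative f' y) (at (y i))"
      and "Ck_on k I A f'"
      using Suc.prems unfolding Ck_on.simps(2) by blast
    then show "\<exists>f'. (\<forall>y\<in>B. ((\<lambda>t. f (y(i := t))) has_real_derivative f' y) (at (y i))) \<and> Ck_on k I B f'"
      using Suc.IH Suc.prems(2) by blast
  qed
next
  case 0
  then show ?case
    using continuous_map_from_subtopology_mono unfolding Ck_on.simps(1) by blast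
qed

lemma coordinate_derivative_cong:
  assumes A: "openin (Rn I) A" and y: "y \<in> A" "i \<in> I" and eq: "\<And>y. y \<in> A \<Longrightarrow> f y = g y"
    and d: "((\<lambda>t. f (y(i := t))) has_real_derivative D) (at (y i))"
  shows "((\<lambda>t. g (y(i := t))) has_real_derivative D) (at (y i))"
  by (rule has_field_derivative_transform_within_open[OF d open_coordinate_slice[OF A y]])
     (use y eq in auto)

lemma Ck_on_cong:
  assumes A: "openin (Rn I) A" and eq: "\<And>y. y \<in> A \<Longrightarrow> f y = g y" and f: "Ck_on k I A f"
  shows "Ck_on k I A g"
proof -
  have c: "continuous_map (subtopology (Rn I) A) euclideanreal g"
    using Ck_on_imp_continuous[OF f] by (rule continuous_map_eq) (simp add: eq)
  show ?thesis
  proof (cases k)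
    case (Suc m)
    have "\<exists>f'. (\<forall>y\<in>A. ((\<lambda>t. g (y(i := t))) has_real_derivative f' y) (at (y i))) \<and> Ck_on m I A f'"
      if i: "i \<in> I" for i
    proof -
      obtain f' where "\<forall>y\<in>A. ((\<lambda>t. f (y(i := t))) has_real_derivative f' y) (at (y i))"
        and "Ck_on m I A f'"
        using f i unfolding Suc Ck_on.simps(2) by blast
      then show ?thesis
        using coordinate_derivative_cong[OF A _ i, of _ f g] eq by blast
    qed
    then show ?thesis
      using c unfolding Suc Ck_on.simps(2) by blast
  qed (use c in simp)
qed

lemma continuous_map_local:
  assumes "\<And>p. p \<in> topspace T \<Longrightarrow>
    \<exists>W g. openin T W \<and> p \<in> W \<and> continuous_map (subtopology T W) T' g \<and> (\<forall>q\<in>W. f q = g q)"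
  shows "continuous_map T T' f"
proof -
  obtain W g where Wg: "\<And>p. p \<in> topspace T \<Longrightarrow> openin T (W p) \<and> p \<in> W p \<and>
      continuous_map (subtopology T (W p)) T' (g p) \<and> (\<forall>q\<in>W p. f q = g p q)"
    using assms by metis
  show ?thesis
  proof (rule pasting_lemma[where I = "topspace T" and T = W and f = g])
    show "g i x = g j x" if "i \<in> topspace T" "j \<in> topspace T" "x \<in> topspace T \<inter> W i \<inter> W j" for i j x
      using Wg[OF that(1)] Wg[OF that(2)] that(3) by (metis IntD1 IntD2)
  qed (use Wg in blast)+
qed

text \<open>
  Being of class \<open>C\<^sup>k\<close> is a local property: derivatives are unique, so the partial derivatives that
  are found on the members of an open cover are the restrictions of a single function.
\<close>

lemma Ck_on_local:
  assumes "\<And>y. y \<in> A \<Longrightarrow> \<exists>B. openin (Rn I) B \<and> y \<in> B \<and> B \<subseteq> A \<and> Ck_on k I B f"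
  shows "Ck_on k I A f"
  using assms
proof (induction k arbitrary: f)
  case 0
  show ?case
    unfolding Ck_on.simps
  proof (rule continuous_map_local)
    fix p assume "p \<in> topspace (subtopology (Rn I) A)"
    then obtain B where B: "openin (Rn I) B" "p \<in> B" "B \<subseteq> A" "Ck_on 0 I B f"
      using 0[of p] by auto
    moreover have "subtopology (subtopology (Rn I) A) B = subtopology (Rn I) B"
      using B by (simp add: subtopology_subtopology Int_absorb1)
    moreover have "openin (subtopology (Rn I) A) B"
      unfolding openin_subtopology using B by (intro exI[of _ B]) auto
    ultimately show "\<exists>W g. openin (subtopology (Rn I) A) W \<and> p \<in> W \<and>
        continuous_map (subtopology (subtopology (Rn I) A) W) euclideanreal g \<and> (\<forall>q\<in>W. f q = g q)"
      using B(2,4) by (intro exI[of _ B] exI[of _ f]) simp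
  qed
next
  case (Suc k)
  have "continuous_map (subtopology (Rn I) A) euclideanreal f"
  proof (rule Suc.IH[THEN Ck_on_imp_continuous])
    fix y assume "y \<in> A"
    from Suc.prems[OF this] show "\<exists>B. openin (Rn I) B \<and> y \<in> B \<and> B \<subseteq> A \<and> Ck_on k I B f"
      using Ck_on_SucD by blast
  qed
  moreover have "\<exists>f'. (\<forall>y\<in>A. ((\<lambda>t. f (y(i := t))) has_real_derivative f' y) (at (y i))) \<and> Ck_on k I A f'"
    if i: "i \<in> I" for i
  proof (intro exI conjI ballI)
    let ?d = "\<lambda>y. deriv (\<lambda>t. f (y(i := t))) (y i)"
    have *: "\<exists>B. openin (Rn I) B \<and> y \<in> B \<and> B \<subseteq> A \<and> Ck_on k I B ?d \<and>
        ((\<lambda>t. f (y(i := t))) has_real_derivative ?d y) (at (y i))" if y: "y \<in> A" for y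
    proof -
      obtain B f' where B: "openin (Rn I) B" "y \<in> B" "B \<subseteq> A" and f': "Ck_on k I B f'"
        and d: "\<And>z. z \<in> B \<Longrightarrow> ((\<lambda>t. f (z(i := t))) has_real_derivative f' z) (at (z i))"
        using Suc.prems[OF y] i by auto
      have eq: "f' z = ?d z" if "z \<in> B" for z
        using DERIV_imp_deriv[OF d[OF that]] by simp
      have "Ck_on k I B ?d"
        by (rule Ck_on_cong[OF B(1) eq f'])
      moreover have "((\<lambda>t. f (y(i := t))) has_real_derivative ?d y) (at (y i))"
        using d[OF B(2)] by (subst eq[OF B(2), symmetric])
      ultimately show ?thesis
        using B by (intro exI[of _ B] conjI)
    qed
    show "((\<lambda>t. f (y(i := t))) has_real_derivative ?d y) (at (y i))" if "y \<in> A" for y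
      using *[OF that] by blast
    show "Ck_on k I A ?d"
      by (rule Suc.IH) (use * in blast)
  qed
  ultimately show ?case by simp
qed

lemma Ck_on_const: "Ck_on k I A (\<lambda>y. c)"
proof (induction k arbitrary: c)
  case (Suc k)
  have "\<exists>f'. (\<forall>y\<in>A. ((\<lambda>t. c) has_real_derivative f' y) (at (y i))) \<and> Ck_on k I A f'" for i
    by (rule exI[of _ "\<lambda>y. 0"]) (simp add: Suc)
  then show ?case by simp
qed simp

lemma Ck_on_coordinate:
  assumes "j \<in> I" shows "Ck_on k I A (\<lambda>y. y j)"
proof (cases k)
  case 0
  then show ?thesis
    using assms continuous_map_from_subtopology[OF continuous_map_product_coordinates] by simp
next
  case (Suc m)
  have "((\<lambda>t. (y(i := t)) j) has_real_derivative (if i = j then 1 else 0)) (at (y i))" for y i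
    by auto
  then have *: "\<exists>f'. (\<forall>y\<in>A. ((\<lambda>t. (y(i := t)) j) has_real_derivative f' y) (at (y i))) \<and> Ck_on m I A f'" for i
    by (intro exI[of _ "\<lambda>_. if i = j then 1 else 0"] conjI Ck_on_const) (simp del: fun_upd_apply)
  show ?thesis
    unfolding Suc Ck_on.simps(2)
    by (intro conjI ballI * continuous_map_from_subtopology continuous_map_product_coordinates assms)
qed

lemma Ck_on_add:
  assumes "Ck_on k I A f" "Ck_on k I A g"
  shows "Ck_on k I A (\<lambda>y. f y + g y)"
  using assms
proof (induction k arbitrary: f g)
  case (Suc k)
  have "\<exists>h'. (\<forall>y\<in>A. ((\<lambda>t. f (y(i := t)) + g (y(i := t))) has_real_derivative h' y) (at (y i))) \<and>
      Ck_on k I A h'" if i: "i \<in> I" for i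
  proof -
    obtain f' where f': "\<forall>y\<in>A. ((\<lambda>t. f (y(i := t))) has_real_derivative f' y) (at (y i))" "Ck_on k I A f'"
      using Ck_on_partial[OF Suc.prems(1) i] by blast
    obtain g' where g': "\<forall>y\<in>A. ((\<lambda>t. g (y(i := t))) has_real_derivative g' y) (at (y i))" "Ck_on k I A g'"
      using Ck_on_partial[OF Suc.prems(2) i] by blast
    show ?thesis
    proof (intro exI conjI ballI)
      show "((\<lambda>t. f (y(i := t)) + g (y(i := t))) has_real_derivative f' y + g' y) (at (y i))" if "y \<in> A" for y
        using f'(1) g'(1) that by (intro DERIV_add) blast+
      show "Ck_on k I A (\<lambda>y. f' y + g' y)"
        using f'(2) g'(2) by (rule Suc.IH)
    qed
  qed
  then show ?case using Suc.prems by (simp only: Ck_on.simps continuous_map_add) blast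
qed (simp add: continuous_map_add)

lemma Ck_on_mult:
  assumes "Ck_on k I A f" "Ck_on k I A g"
  shows "Ck_on k I A (\<lambda>y. f y * g y)"
  using assms
proof (induction k arbitrary: f g)
  case (Suc k)
  have "\<exists>h'. (\<forall>y\<in>A. ((\<lambda>t. f (y(i := t)) * g (y(i := t))) has_real_derivative h' y) (at (y i))) \<and>
      Ck_on k I A h'" if i: "i \<in> I" for i
  proof -
    obtain f' where f': "\<forall>y\<in>A. ((\<lambda>t. f (y(i := t))) has_real_derivative f' y) (at (y i))" "Ck_on k I A f'"
      using Ck_on_partial[OF Suc.prems(1) i] by blast
    obtain g' where g': "\<forall>y\<in>A. ((\<lambda>t. g (y(i := t))) has_real_derivative g' y) (at (y i))" "Ck_on k I A g'"
      using Ck_on_partial[OF Suc.prems(2) i] by blast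
    have "((\<lambda>t. f (y(i := t)) * g (y(i := t))) has_real_derivative f' y * g y + g' y * f y) (at (y i))"
      if "y \<in> A" for y
      using DERIV_mult[of "\<lambda>t. f (y(i := t))" "f' y" "y i" UNIV "\<lambda>t. g (y(i := t))" "g' y"] f' g' that
      by simp
    moreover have "Ck_on k I A (\<lambda>y. f' y * g y + g' y * f y)"
      by (rule Ck_on_add[OF Suc.IH[OF f'(2) Ck_on_SucD[OF Suc.prems(2)]]
            Suc.IH[OF g'(2) Ck_on_SucD[OF Suc.prems(1)]]])
    ultimately show ?thesis
      by (intro exI[of _ "\<lambda>y. f' y * g y + g' y * f y"] conjI ballI)
  qed
  then show ?case using Suc.prems by (simp only: Ck_on.simps continuous_map_real_mult) blast
qed (simp add: continuous_map_real_mult)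

lemma Ck_on_sum:
  assumes "\<And>j. j \<in> J \<Longrightarrow> Ck_on k I A (f j)"
  shows "Ck_on k I A (\<lambda>y. \<Sum>j\<in>J. f j y)"
  using assms
proof (induction J rule: infinite_finite_induct)
  case (insert j J)
  then show ?case by (simp add: Ck_on_add)
qed (simp_all add: Ck_on_const)

lemma open_Rn_contains_box:
  assumes "finite J" "openin (Rn J) B" "p \<in> B"
  obtains \<delta> where "\<delta> > 0" "\<And>q. q \<in> extensional J \<Longrightarrow> (\<And>j. j \<in> J \<Longrightarrow> \<bar>q j - p j\<bar> < \<delta>) \<Longrightarrow> q \<in> B"
proof -
  obtain U where U: "\<forall>j\<in>J. open (U j)" "p \<in> Pi\<^sub>E J U" "Pi\<^sub>E J U \<subseteq> B"
    using assms(2,3) unfolding openin_product_topology_alt by (metis open_openin)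
  have "\<forall>j\<in>J. \<exists>d>0. \<forall>t. \<bar>t - p j\<bar> < d \<longrightarrow> t \<in> U j"
  proof
    fix j assume "j \<in> J"
    with U have "open (U j)" "p j \<in> U j" by auto
    then show "\<exists>d>0. \<forall>t. \<bar>t - p j\<bar> < d \<longrightarrow> t \<in> U j"
      by (simp add: open_dist dist_real_def)
  qed
  then obtain d where d: "\<And>j. j \<in> J \<Longrightarrow> d j > 0 \<and> (\<forall>t. \<bar>t - p j\<bar> < d j \<longrightarrow> t \<in> U j)"
    by (auto dest!: bchoice)
  define \<delta> where "\<delta> = Min (insert 1 (d ` J))"
  have \<delta>: "\<delta> > 0" "\<And>j. j \<in> J \<Longrightarrow> \<delta> \<le> d j"
    using assms(1) d by (auto simp: \<delta>_def)
  show ?thesis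
  proof (rule that[OF \<delta>(1)])
    fix q assume q: "q \<in> extensional J" "\<And>j. j \<in> J \<Longrightarrow> \<bar>q j - p j\<bar> < \<delta>"
    have "q j \<in> U j" if "j \<in> J" for j
      using d[OF that] q(2)[OF that] \<delta>(2)[OF that] by force
    then show "q \<in> B"
      using U(3) q(1) by (auto simp: PiE_def)
  qed
qed

text \<open>
  One increment in the telescoping sum for the chain rule: by the mean value theorem it is the value
  of \<open>\<partial>\<^sub>j g\<close> at a point that tends to \<open>u t0\<close>, times the increment of \<open>c\<close>.
\<close>

lemma partial_increment_derivative:
  fixes g g' :: "('j \<Rightarrow> real) \<Rightarrow> real" and c :: "real \<Rightarrow> real" and u :: "real \<Rightarrow> 'j \<Rightarrow> real"
  assumes J: "finite J" "j \<in> J" and B: "openin (Rn J) B"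
    and g: "\<And>y. y \<in> B \<Longrightarrow> ((\<lambda>t. g (y(j := t))) has_real_derivative g' y) (at (y j))"
    and g': "continuous_map (subtopology (Rn J) B) euclideanreal g'"
    and u: "\<And>t. u t \<in> extensional J" "u t0 \<in> B" "\<And>i. i \<in> J \<Longrightarrow> isCont (\<lambda>t. u t i) t0"
      "\<And>t. u t j = u t0 j"
    and c: "(c has_real_derivative d) (at t0)" "c t0 = u t0 j"
  shows "((\<lambda>t. g ((u t)(j := c t)) - g (u t)) has_real_derivative g' (u t0) * d) (at t0)"
proof -
  let ?p = "u t0"
  let ?D = "\<lambda>t. g ((u t)(j := c t)) - g (u t)"
  (* Where c t = u t0 j the increment vanishes and h could have any value;
     the value g' (u t0) keeps h close to the derivative for all t near t0. *)
  define h where "h t = (if c t = ?p j then g' ?p else ?D t / (c t - ?p j))" for t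
  have D: "?D t = h t * (c t - ?p j)" for t
    by (cases "c t = ?p j") (simp_all add: h_def fun_upd_idem[of "u t" j, OF u(4)])
  have "(h \<longlongrightarrow> g' ?p) (at t0)"
  proof (rule tendstoI)
    fix \<epsilon> :: real assume "\<epsilon> > 0"
    let ?C = "{y \<in> B. dist (g' y) (g' ?p) < \<epsilon>}"
    have "openin (Rn J) ?C"
    proof -
      have "{y \<in> topspace (subtopology (Rn J) B). g' y \<in> ball (g' ?p) \<epsilon>} = ?C"
        using openin_subset[OF B] by (auto simp: dist_commute)
      then have "openin (subtopology (Rn J) B) ?C"
        using openin_continuous_map_preimage[OF g', of "ball (g' ?p) \<epsilon>"] by simp
      then show ?thesis
        using B by (simp add: openin_open_subtopology)
    qed
    moreover have "?p \<in> ?C"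
      using u(2) \<open>\<epsilon> > 0\<close> by simp
    ultimately obtain \<delta> where "\<delta> > 0"
      and \<delta>: "\<And>q. q \<in> extensional J \<Longrightarrow> (\<And>i. i \<in> J \<Longrightarrow> \<bar>q i - ?p i\<bar> < \<delta>) \<Longrightarrow> q \<in> ?C"
      using open_Rn_contains_box[OF J(1)] by blast
    have "eventually (\<lambda>t. dist (u t i) (?p i) < \<delta>) (at t0)" if "i \<in> J" for i
      using u(3)[OF that] \<open>\<delta> > 0\<close> unfolding isCont_def by (rule tendstoD)
    moreover have "eventually (\<lambda>t. dist (c t) (c t0) < \<delta>) (at t0)"
      using DERIV_isCont[OF c(1)] \<open>\<delta> > 0\<close> unfolding isCont_def by (rule tendstoD)
    ultimately have "eventually (\<lambda>t. (\<forall>i\<in>J. dist (u t i) (?p i) < \<delta>) \<and> dist (c t) (?p j) < \<delta>) (at t0)"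
      using J(1) c(2) by (simp add: eventually_conj eventually_ball_finite)
    then show "eventually (\<lambda>t. dist (h t) (g' ?p) < \<epsilon>) (at t0)"
    proof eventually_elim
      case (elim t)
      have close: "(u t)(j := s) \<in> ?C" if s: "\<bar>s - ?p j\<bar> \<le> \<bar>c t - ?p j\<bar>" for s
      proof (rule \<delta>)
        show "(u t)(j := s) \<in> extensional J"
          using u(1) J(2) by (auto simp: extensional_def)
        show "\<bar>((u t)(j := s)) i - ?p i\<bar> < \<delta>" if "i \<in> J" for i
          using elim s that by (auto simp: dist_real_def)
      qed
      have deriv: "((\<lambda>s. g ((u t)(j := s))) has_real_derivative g' ((u t)(j := s))) (at s)"
        if "\<bar>s - ?p j\<bar> \<le> \<bar>c t - ?p j\<bar>" for s
        using g[of "(u t)(j := s)"] close[OF that] by simp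
      have eq: "g (u t) = g ((u t)(j := ?p j))"
        by (simp only: fun_upd_idem[of "u t" j, OF u(4)])
      consider "c t = ?p j" | "c t > ?p j" | "c t < ?p j" by linarith
      then show ?case
      proof cases
        case 1
        then show ?thesis using \<open>\<epsilon> > 0\<close> by (simp add: h_def)
      next
        case 2
        obtain s where s: "?p j < s" "s < c t"
          "g ((u t)(j := c t)) - g ((u t)(j := ?p j)) = (c t - ?p j) * g' ((u t)(j := s))"
          using MVT2[of "?p j" "c t" "\<lambda>s. g ((u t)(j := s))" "\<lambda>s. g' ((u t)(j := s))"] 2 deriv by auto
        then have "h t = g' ((u t)(j := s))"
          using 2 eq by (simp add: h_def)
        then show ?thesis using close[of s] s by simp
      next
        case 3
        obtain s where s: "c t < s" "s < ?p j"
          "g ((u t)(j := ?p j)) - g ((u t)(j := c t)) = (?p j - c t) * g' ((u t)(j := s))"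
          using MVT2[of "c t" "?p j" "\<lambda>s. g ((u t)(j := s))" "\<lambda>s. g' ((u t)(j := s))"] 3 deriv by auto
        then have "h t * (c t - ?p j) = g' ((u t)(j := s)) * (c t - ?p j)"
          using D[of t] eq by (simp add: algebra_simps)
        then have "h t = g' ((u t)(j := s))"
          using 3 by simp
        then show ?thesis using close[of s] s by simp
      qed
    qed
  qed
  moreover have "((\<lambda>t. (c t - c t0) / (t - t0)) \<longlongrightarrow> d) (at t0)"
    using c(1) by (simp add: has_field_derivative_iff)
  ultimately have "((\<lambda>t. h t * ((c t - c t0) / (t - t0))) \<longlongrightarrow> g' ?p * d) (at t0)"
    by (rule tendsto_mult)
  then show ?thesis
    unfolding has_field_derivative_iff D using c(2) by simp
qed

text \<open>
  The chain rule along a curve. The coordinates of the argument of \<open>g\<close> are moved from \<open>c t0\<close> to \<open>c t\<close>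
  one at a time, by induction on the set \<open>K\<close> of the coordinates moved so far.
\<close>

lemma chain_rule_partials:
  fixes g :: "('j \<Rightarrow> real) \<Rightarrow> real" and c :: "real \<Rightarrow> 'j \<Rightarrow> real"
  assumes J: "finite J" and B: "openin (Rn J) B"
    and g: "\<And>j y. j \<in> J \<Longrightarrow> y \<in> B \<Longrightarrow> ((\<lambda>t. g (y(j := t))) has_real_derivative g' j y) (at (y j))"
    and g': "\<And>j. j \<in> J \<Longrightarrow> continuous_map (subtopology (Rn J) B) euclideanreal (g' j)"
    and c: "\<And>t. c t \<in> extensional J" "c t0 \<in> B"
      "\<And>j. j \<in> J \<Longrightarrow> ((\<lambda>t. c t j) has_real_derivative d j) (at t0)"
  shows "((\<lambda>t. g (c t)) has_real_derivative (\<Sum>j\<in>J. g' j (c t0) * d j)) (at t0)"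
proof -
  let ?u = "\<lambda>K t j. if j \<in> K then c t j else c t0 j"
  have "((\<lambda>t. g (?u K t)) has_real_derivative (\<Sum>j\<in>K. g' j (c t0) * d j)) (at t0)"
    if "finite K" "K \<subseteq> J" for K
    using that
  proof (induction K)
    case (insert j K)
    have u0: "?u K t0 = c t0" by auto
    have "((\<lambda>t. g ((?u K t)(j := c t j)) - g (?u K t)) has_real_derivative g' j (?u K t0) * d j) (at t0)"
    proof (rule partial_increment_derivative[OF J _ B g g'])
      show "?u K t \<in> extensional J" for t
        using c(1) by (auto simp: extensional_def)
      show "isCont (\<lambda>t. ?u K t i) t0" if "i \<in> J" for i
        using DERIV_isCont[OF c(3)[OF that]] by (cases "i \<in> K") simp_all
    qed (use insert c u0 in auto)
    moreover have "(?u K t)(j := c t j) = ?u (insert j K) t" for t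
      by auto
    ultimately have "((\<lambda>t. g (?u (insert j K) t) - g (?u K t)) has_real_derivative g' j (c t0) * d j) (at t0)"
      using u0 by simp
    from DERIV_add[OF this insert.IH] show ?case
      using insert by simp
  qed simp
  from this[of J] have "((\<lambda>t. g (?u J t)) has_real_derivative (\<Sum>j\<in>J. g' j (c t0) * d j)) (at t0)"
    using J by simp
  moreover have "?u J t = c t" for t
    using c(1)[of t] c(1)[of t0] by (auto simp: extensional_def)
  ultimately show ?thesis by simp
qed

text \<open>
  The partial derivatives of \<open>g \<circ> f\<close> are sums of products of \<open>\<partial>\<^sub>j g \<circ> f\<close> and \<open>\<partial>\<^sub>i f\<^sub>j\<close>. Both factors
  have one derivative less than \<open>g\<close> and \<open>f\<close>, which drives the induction on \<open>k\<close>.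
\<close>

lemma Ck_on_compose:
  assumes J: "finite J" and A: "openin (Rn I) A" and B: "openin (Rn J) B"
    and f: "\<And>j. j \<in> J \<Longrightarrow> Ck_on k I A (\<lambda>y. f y j)" and im: "f ` A \<subseteq> B"
    and g: "Ck_on k J B g"
  shows "Ck_on k I A (\<lambda>y. g (f y))"
  using f g
proof (induction k arbitrary: g)
  case (0 g)
  have "f y \<in> extensional J" if "y \<in> A" for y
    using that im openin_subset[OF B] by (auto simp: PiE_def)
  then have "continuous_map (subtopology (Rn I) A) (subtopology (Rn J) B) f"
    using 0 im by (auto simp: continuous_map_in_subtopology continuous_map_componentwise)
  with 0 show ?case
    using continuous_map_compose[of _ _ f _ g] by (simp add: o_def)
next
  case (Suc k)
  have fk: "Ck_on k I A (\<lambda>y. f y j)" if "j \<in> J" for j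
    using Suc.prems(1)[OF that] by (rule Ck_on_SucD)
  have cont: "continuous_map (subtopology (Rn I) A) euclideanreal (\<lambda>y. g (f y))"
    by (rule Ck_on_imp_continuous[OF Suc.IH[OF fk Ck_on_SucD[OF Suc.prems(2)]]])
  have "\<exists>g'. (\<forall>y\<in>B. ((\<lambda>t. g (y(j := t))) has_real_derivative g' y) (at (y j))) \<and> Ck_on k J B g'"
    if "j \<in> J" for j
    using Suc.prems(2) that unfolding Ck_on.simps(2) by blast
  then obtain g' where g': "\<And>j y. j \<in> J \<Longrightarrow> y \<in> B \<Longrightarrow>
      ((\<lambda>t. g (y(j := t))) has_real_derivative g' j y) (at (y j))" "\<And>j. j \<in> J \<Longrightarrow> Ck_on k J B (g' j)"
    by metis
  have "\<exists>h. (\<forall>y\<in>A. ((\<lambda>t. g (f (y(i := t)))) has_real_derivative h y) (at (y i))) \<and> Ck_on k I A h"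
    if i: "i \<in> I" for i
  proof -
    have "\<exists>f'. (\<forall>y\<in>A. ((\<lambda>t. f (y(i := t)) j) has_real_derivative f' y) (at (y i))) \<and> Ck_on k I A f'"
      if "j \<in> J" for j
      using Suc.prems(1)[OF that] i unfolding Ck_on.simps(2) by blast
    then obtain f' where f': "\<And>j y. j \<in> J \<Longrightarrow> y \<in> A \<Longrightarrow>
        ((\<lambda>t. f (y(i := t)) j) has_real_derivative f' j y) (at (y i))" "\<And>j. j \<in> J \<Longrightarrow> Ck_on k I A (f' j)"
      by metis
    let ?h = "\<lambda>y. \<Sum>j\<in>J. g' j (f y) * f' j y"
    have "((\<lambda>t. g (f (y(i := t)))) has_real_derivative ?h y) (at (y i))" if y: "y \<in> A" for y
    proof -
      (* Outside A the map f need not take values in extensional functions, so it is cut down to J. *)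
      let ?c = "\<lambda>t. restrict (f (y(i := t))) J"
      have r: "restrict (f z) J = f z" if "z \<in> A" for z
        using that im openin_subset[OF B] by (intro extensional_restrict) (auto simp: PiE_def)
      have "((\<lambda>t. g (?c t)) has_real_derivative (\<Sum>j\<in>J. g' j (?c (y i)) * f' j y)) (at (y i))"
      proof (rule chain_rule_partials[OF J B g'(1)])
        show "?c (y i) \<in> B" using r[OF y] y im by auto
        show "((\<lambda>t. ?c t j) has_real_derivative f' j y) (at (y i))" if "j \<in> J" for j
          using f'(1)[OF that y] that by simp
        show "continuous_map (subtopology (Rn J) B) euclideanreal (g' j)" if "j \<in> J" for j
          by (rule Ck_on_imp_continuous[OF g'(2)[OF that]])
      qed (assumption | rule restrict_extensional)+
      then have "((\<lambda>t. g (?c t)) has_real_derivative ?h y) (at (y i))"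
        using r[OF y] by simp
      then show ?thesis
        by (rule has_field_derivative_transform_within_open[OF _ open_coordinate_slice[OF A y i]])
           (use y r in auto)
    qed
    moreover have "Ck_on k I A ?h"
      by (rule Ck_on_sum, rule Ck_on_mult[OF Suc.IH[OF fk g'(2)] f'(2)])
    ultimately show ?thesis by (intro exI[of _ ?h] conjI ballI)
  qed
  then show ?case
    using cont unfolding Ck_on.simps(2) by blast
qed

section \<open>Smooth maps\<close>

text \<open>
  The conditions on a manifold that concern the charts one at a time.
\<close>

definition has_charts :: "('p, 'i) mfd \<Rightarrow> bool" where
  "has_charts M \<longleftrightarrow> finite (midx M) \<and>
     (\<forall>(U, \<phi>)\<in>atlas M.
        openin (mtop M) U \<and> openin (Rn (midx M)) (\<phi> ` U) \<and>
        homeomorphic_map (subtopology (mtop M) U) (subtopology (Rn (midx M)) (\<phi> ` U)) \<phi>) \<and>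
     (\<Union>(U, \<phi>)\<in>atlas M. U) = topspace (mtop M)"

text \<open>The compatibility of the charts says that the identity is smooth.\<close>

lemma smooth_manifold_iff:
  "smooth_manifold M \<longleftrightarrow>
     Hausdorff_space (mtop M) \<and> second_countable (mtop M) \<and> has_charts M \<and> smooth_map M M (\<lambda>p. p)"
proof -
  have "(\<lambda>p. p) -` V = V" for V :: "'a set" by auto
  then show ?thesis
    unfolding smooth_manifold_def has_charts_def smooth_map_def by auto
qed

lemma smooth_manifold_has_charts: "smooth_manifold M \<Longrightarrow> has_charts M"
  by (simp add: smooth_manifold_iff)

lemma smooth_map_continuous: "smooth_map M N f \<Longrightarrow> continuous_map (mtop M) (mtop N) f"
  by (simp add: smooth_map_def)

context
  fixes M :: "('p, 'i) mfd" and U :: "'p set" and \<phi> :: "'p \<Rightarrow> 'i \<Rightarrow> real"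
  assumes M: "has_charts M" and chart: "(U, \<phi>) \<in> atlas M"
begin

lemma chart_domain_open: "openin (mtop M) U"
  and chart_image_open: "openin (Rn (midx M)) (\<phi> ` U)"
  and chart_homeomorphic:
    "homeomorphic_map (subtopology (mtop M) U) (subtopology (Rn (midx M)) (\<phi> ` U)) \<phi>"
  using M chart by (auto simp: has_charts_def)

lemma chart_domain_subset: "U \<subseteq> topspace (mtop M)"
  using chart_domain_open by (rule openin_subset)

lemma chart_inj: "inj_on \<phi> U"
  using homeomorphic_imp_injective_map[OF chart_homeomorphic] chart_domain_subset
  by (simp add: Int_absorb1)

lemma chart_inverse [simp]: "p \<in> U \<Longrightarrow> inv_into U \<phi> (\<phi> p) = p"
  using chart_inj by simp

lemma chart_extensional: "p \<in> U \<Longrightarrow> \<phi> p \<in> extensional (midx M)"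
  using openin_subset[OF chart_image_open] by (auto simp: PiE_def)

lemma chart_continuous: "continuous_map (subtopology (mtop M) U) (Rn (midx M)) \<phi>"
  using homeomorphic_imp_continuous_map[OF chart_homeomorphic] continuous_map_into_fulltopology by blast

lemma chart_inverse_continuous:
  "continuous_map (subtopology (Rn (midx M)) (\<phi> ` U)) (mtop M) (inv_into U \<phi>)"
proof -
  obtain \<psi> where \<psi>: "homeomorphic_maps (subtopology (mtop M) U) (subtopology (Rn (midx M)) (\<phi> ` U)) \<phi> \<psi>"
    using chart_homeomorphic homeomorphic_map_maps by blast
  have "continuous_map (subtopology (Rn (midx M)) (\<phi> ` U)) (mtop M) \<psi>"
    using \<psi> continuous_map_into_fulltopology unfolding homeomorphic_maps_def by blast
  then show ?thesis
  proof (rule continuous_map_eq)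
    fix y assume "y \<in> topspace (subtopology (Rn (midx M)) (\<phi> ` U))"
    then obtain p where "p \<in> U" "y = \<phi> p" by auto
    then show "\<psi> y = inv_into U \<phi> y"
      using \<psi> chart_domain_subset by (auto simp: homeomorphic_maps_def)
  qed
qed

lemma chart_image_of_open:
  assumes "openin (mtop M) W"
  shows "openin (Rn (midx M)) (\<phi> ` (U \<inter> W))"
proof -
  have "openin (subtopology (mtop M) U) (U \<inter> W)"
    using assms by (simp add: openin_subtopology_Int2)
  then have "openin (subtopology (Rn (midx M)) (\<phi> ` U)) (\<phi> ` (U \<inter> W))"
    using homeomorphic_imp_open_map[OF chart_homeomorphic] unfolding open_map_def by blast
  then show ?thesis
    using chart_image_open by (simp add: openin_open_subtopology)
qed

end

lemma obtain_chart:
  assumes "has_charts M" "p \<in> topspace (mtop M)"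
  obtains U \<phi> where "(U, \<phi>) \<in> atlas M" "p \<in> U"
  using assms unfolding has_charts_def by blast

lemma smooth_on_mono: "smooth_on I A J h \<Longrightarrow> B \<subseteq> A \<Longrightarrow> smooth_on I B J h"
  by (auto simp: smooth_on_def intro: Ck_on_mono)

lemma smooth_on_cong:
  assumes "openin (Rn I) A" "\<And>y. y \<in> A \<Longrightarrow> f y = g y" "smooth_on I A J f"
  shows "smooth_on I A J g"
  unfolding smooth_on_def
proof (intro ballI allI)
  fix j k assume "j \<in> J"
  then have "Ck_on k I A (\<lambda>y. f y j)"
    using assms(3) by (simp add: smooth_on_def)
  then show "Ck_on k I A (\<lambda>y. g y j)"
    by (rule Ck_on_cong[OF assms(1), rotated]) (simp add: assms(2))
qed

lemma smooth_on_local: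
  assumes "\<And>y. y \<in> A \<Longrightarrow> \<exists>B. openin (Rn I) B \<and> y \<in> B \<and> B \<subseteq> A \<and> smooth_on I B J h"
  shows "smooth_on I A J h"
  unfolding smooth_on_def
proof (intro ballI allI)
  fix j k assume "j \<in> J"
  show "Ck_on k I A (\<lambda>y. h y j)"
  proof (rule Ck_on_local)
    fix y assume "y \<in> A"
    from assms[OF this] obtain B where B: "openin (Rn I) B" "y \<in> B" "B \<subseteq> A" "smooth_on I B J h"
      by blast
    then have "Ck_on k I B (\<lambda>y. h y j)"
      using \<open>j \<in> J\<close> by (simp add: smooth_on_def)
    with B show "\<exists>B. openin (Rn I) B \<and> y \<in> B \<and> B \<subseteq> A \<and> Ck_on k I B (\<lambda>y. h y j)"
      by (intro exI[of _ B] conjI)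
  qed
qed

lemma smooth_on_compose:
  assumes "finite J" "openin (Rn I) A" "openin (Rn J) B" "f ` A \<subseteq> B"
    and "smooth_on I A J f" "smooth_on J B K g"
  shows "smooth_on I A K (\<lambda>y. g (f y))"
  unfolding smooth_on_def
proof (intro ballI allI)
  fix l k assume "l \<in> K"
  show "Ck_on k I A (\<lambda>y. g (f y) l)"
  proof (rule Ck_on_compose[where g = "\<lambda>z. g z l" and f = f, OF assms(1-3) _ assms(4)])
    show "Ck_on k I A (\<lambda>y. f y j)" if "j \<in> J" for j
      using assms(5) that by (simp add: smooth_on_def)
    show "Ck_on k J B (\<lambda>z. g z l)"
      using assms(6) \<open>l \<in> K\<close> by (simp add: smooth_on_def)
  qed
qed

lemma smooth_map_in_charts:
  assumes "smooth_map M N f" "(U, \<phi>) \<in> atlas M" "(V, \<psi>) \<in> atlas N"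
  shows "smooth_on (midx M) (\<phi> ` (U \<inter> f -` V)) (midx N) (\<lambda>y. \<psi> (f (inv_into U \<phi> y)))"
  using assms by (auto simp: smooth_map_def)

text \<open>
  The images of the sets \<open>W\<close> below cover the part of a chart where smoothness is required, and
  being of class \<open>C\<^sup>k\<close> is local.
\<close>

lemma smooth_map_if_near:
  assumes M: "has_charts M" and cont: "continuous_map (mtop M) (mtop N) f"
    and near: "\<And>U \<phi> V \<psi> p. (U, \<phi>) \<in> atlas M \<Longrightarrow> (V, \<psi>) \<in> atlas N \<Longrightarrow> p \<in> U \<Longrightarrow> f p \<in> V \<Longrightarrow>
      \<exists>W. openin (mtop M) W \<and> p \<in> W \<and> W \<subseteq> f -` V \<and>
        smooth_on (midx M) (\<phi> ` (U \<inter> W)) (midx N) (\<lambda>y. \<psi> (f (inv_into U \<phi> y)))"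
  shows "smooth_map M N f"
  unfolding smooth_map_def
proof (intro conjI cont ballI, clarify)
  fix U \<phi> V \<psi> assume charts: "(U, \<phi>) \<in> atlas M" "(V, \<psi>) \<in> atlas N"
  show "smooth_on (midx M) (\<phi> ` (U \<inter> f -` V)) (midx N) (\<lambda>y. \<psi> (f (inv_into U \<phi> y)))"
  proof (rule smooth_on_local)
    fix y assume "y \<in> \<phi> ` (U \<inter> f -` V)"
    then obtain p where p: "p \<in> U" "f p \<in> V" "y = \<phi> p" by blast
    from near[OF charts p(1,2)] obtain W where W: "openin (mtop M) W" "p \<in> W" "W \<subseteq> f -` V"
      "smooth_on (midx M) (\<phi> ` (U \<inter> W)) (midx N) (\<lambda>y. \<psi> (f (inv_into U \<phi> y)))"
      by blast
    then show "\<exists>B. openin (Rn (midx M)) B \<and> y \<in> B \<and> B \<subseteq> \<phi> ` (U \<inter> f -` V) \<and>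
        smooth_on (midx M) B (midx N) (\<lambda>y. \<psi> (f (inv_into U \<phi> y)))"
      using chart_image_of_open[OF M charts(1) W(1)] p by (intro exI[of _ "\<phi> ` (U \<inter> W)"]) auto
  qed
qed

text \<open>
  Near a point \<open>p\<close>, the composite is read off through a chart around \<open>f p\<close>, and the chain rule
  applies.
\<close>

lemma smooth_map_compose:
  assumes M: "has_charts M" and N: "has_charts N" and P: "has_charts P"
    and f: "smooth_map M N f" and g: "smooth_map N P g"
  shows "smooth_map M P (\<lambda>p. g (f p))"
proof (rule smooth_map_if_near[OF M])
  note fc = smooth_map_continuous[OF f] and gc = smooth_map_continuous[OF g]
  show gfc: "continuous_map (mtop M) (mtop P) (\<lambda>p. g (f p))"
    using continuous_map_compose[OF fc gc] by (simp add: o_def)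
  fix U \<phi> V \<psi> p
  assume charts: "(U, \<phi>) \<in> atlas M" "(V, \<psi>) \<in> atlas P" and p: "p \<in> U" "g (f p) \<in> V"
  have pM: "p \<in> topspace (mtop M)"
    using chart_domain_subset[OF M charts(1)] p by blast
  then have "f p \<in> topspace (mtop N)"
    using continuous_map_funspace[OF fc] by blast
  then obtain U' \<phi>' where U': "(U', \<phi>') \<in> atlas N" "f p \<in> U'"
    using obtain_chart[OF N] by blast
  let ?V' = "{q \<in> topspace (mtop N). g q \<in> V}"
  let ?W = "{p \<in> topspace (mtop M). f p \<in> U' \<inter> ?V'}"
  have V'_open: "openin (mtop N) ?V'"
    by (rule openin_continuous_map_preimage[OF gc chart_domain_open[OF P charts(2)]])
  have W_open: "openin (mtop M) ?W"
    by (rule openin_continuous_map_preimage[OF fc openin_Int[OF chart_domain_open[OF N U'(1)] V'_open]])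
  have inverse: "inv_into U \<phi> (\<phi> q) = q" if "q \<in> U" for q
    by (rule chart_inverse[OF M charts(1) that])
  have inverse': "inv_into U' \<phi>' (\<phi>' q) = q" if "q \<in> U'" for q
    by (rule chart_inverse[OF N U'(1) that])
  have "smooth_on (midx M) (\<phi> ` (U \<inter> ?W)) (midx P)
      (\<lambda>y. \<psi> (g (inv_into U' \<phi>' (\<phi>' (f (inv_into U \<phi> y))))))"
  proof (rule smooth_on_compose[where f = "\<lambda>y. \<phi>' (f (inv_into U \<phi> y))"
        and g = "\<lambda>z. \<psi> (g (inv_into U' \<phi>' z))" and B = "\<phi>' ` (U' \<inter> ?V')"])
    show "finite (midx N)" using N by (simp add: has_charts_def)
    show "openin (Rn (midx M)) (\<phi> ` (U \<inter> ?W))"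
      by (rule chart_image_of_open[OF M charts(1) W_open])
    show "openin (Rn (midx N)) (\<phi>' ` (U' \<inter> ?V'))"
      by (rule chart_image_of_open[OF N U'(1) V'_open])
    show "(\<lambda>y. \<phi>' (f (inv_into U \<phi> y))) ` \<phi> ` (U \<inter> ?W) \<subseteq> \<phi>' ` (U' \<inter> ?V')"
      using inverse by auto
    show "smooth_on (midx M) (\<phi> ` (U \<inter> ?W)) (midx N) (\<lambda>y. \<phi>' (f (inv_into U \<phi> y)))"
      by (rule smooth_on_mono[OF smooth_map_in_charts[OF f charts(1) U'(1)]]) auto
    show "smooth_on (midx N) (\<phi>' ` (U' \<inter> ?V')) (midx P) (\<lambda>z. \<psi> (g (inv_into U' \<phi>' z)))"
      by (rule smooth_on_mono[OF smooth_map_in_charts[OF g U'(1) charts(2)]]) auto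
  qed
  then have "smooth_on (midx M) (\<phi> ` (U \<inter> ?W)) (midx P) (\<lambda>y. \<psi> (g (f (inv_into U \<phi> y))))"
    by (rule smooth_on_cong[OF chart_image_of_open[OF M charts(1) W_open], rotated])
       (auto simp: inverse inverse')
  then show "\<exists>W. openin (mtop M) W \<and> p \<in> W \<and> W \<subseteq> (\<lambda>p. g (f p)) -` V \<and>
      smooth_on (midx M) (\<phi> ` (U \<inter> W)) (midx P) (\<lambda>y. \<psi> (g (f (inv_into U \<phi> y))))"
    using W_open p pM U'(2) \<open>f p \<in> topspace (mtop N)\<close> by (intro exI[of _ ?W]) auto
qed

text \<open>
  This is what allows maps with locally constant ingredients, such as the permutation in an element
  of a wreath product, to be treated as if these were constant.
\<close>

lemma smooth_map_local:
  assumes M: "has_charts M" and N: "has_charts N"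
    and loc: "\<And>p. p \<in> topspace (mtop M) \<Longrightarrow>
      \<exists>W g. openin (mtop M) W \<and> p \<in> W \<and> smooth_map M N g \<and> (\<forall>q\<in>W. f q = g q)"
  shows "smooth_map M N f"
proof (rule smooth_map_if_near[OF M])
  show fc: "continuous_map (mtop M) (mtop N) f"
  proof (rule continuous_map_local)
    fix p assume "p \<in> topspace (mtop M)"
    from loc[OF this] obtain W g where W: "openin (mtop M) W" "p \<in> W" "smooth_map M N g" "\<forall>q\<in>W. f q = g q"
      by blast
    then show "\<exists>W g. openin (mtop M) W \<and> p \<in> W \<and>
        continuous_map (subtopology (mtop M) W) (mtop N) g \<and> (\<forall>q\<in>W. f q = g q)"
      using continuous_map_from_subtopology[OF smooth_map_continuous[OF W(3)]]
      by (intro exI[of _ W] exI[of _ g] conjI)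
  qed
  fix U \<phi> V \<psi> p
  assume charts: "(U, \<phi>) \<in> atlas M" "(V, \<psi>) \<in> atlas N" and p: "p \<in> U" "f p \<in> V"
  then have pM: "p \<in> topspace (mtop M)"
    using chart_domain_subset[OF M charts(1)] by blast
  from loc[OF this] obtain W g where W: "openin (mtop M) W" "p \<in> W" "smooth_map M N g" "\<And>q. q \<in> W \<Longrightarrow> f q = g q"
    by blast
  let ?W = "W \<inter> {q \<in> topspace (mtop M). f q \<in> V}"
  have W_open: "openin (mtop M) ?W"
    by (intro openin_Int W(1) openin_continuous_map_preimage[OF fc] chart_domain_open[OF N charts(2)])
  have "smooth_on (midx M) (\<phi> ` (U \<inter> ?W)) (midx N) (\<lambda>y. \<psi> (g (inv_into U \<phi> y)))"
    by (rule smooth_on_mono[OF smooth_map_in_charts[OF W(3) charts]]) (use W(4) in auto)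
  then have "smooth_on (midx M) (\<phi> ` (U \<inter> ?W)) (midx N) (\<lambda>y. \<psi> (f (inv_into U \<phi> y)))"
    by (rule smooth_on_cong[OF chart_image_of_open[OF M charts(1) W_open], rotated])
       (use W(4) chart_inverse[OF M charts(1)] in auto)
  then show "\<exists>W. openin (mtop M) W \<and> p \<in> W \<and> W \<subseteq> f -` V \<and>
      smooth_on (midx M) (\<phi> ` (U \<inter> W)) (midx N) (\<lambda>y. \<psi> (f (inv_into U \<phi> y)))"
    using W_open W(2) p pM by (intro exI[of _ ?W]) auto
qed

text \<open>
  In suitable charts \<open>f\<close> only forgets and renames coordinates, and a transition map of \<open>N\<close> leads from
  these charts to any others. The projections of products and powers and the inclusion of an open
  subset all have this form.
\<close>

lemma smooth_map_coordinate_projection: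
  assumes M: "has_charts M" and N: "smooth_manifold N"
    and cont: "continuous_map (mtop M) (mtop N) f" and \<iota>: "\<iota> ` midx N \<subseteq> midx M"
    and proj: "\<And>U \<phi>. (U, \<phi>) \<in> atlas M \<Longrightarrow>
      \<exists>V \<psi>. (V, \<psi>) \<in> atlas N \<and> f ` U \<subseteq> V \<and> (\<forall>p\<in>U. \<forall>i\<in>midx N. \<psi> (f p) i = \<phi> p (\<iota> i))"
  shows "smooth_map M N f"
  unfolding smooth_map_def
proof (intro conjI cont ballI, clarify)
  note Nc = smooth_manifold_has_charts[OF N]
  fix U \<phi> V' \<psi>' assume charts: "(U, \<phi>) \<in> atlas M" "(V', \<psi>') \<in> atlas N"
  obtain V \<psi> where V: "(V, \<psi>) \<in> atlas N" "f ` U \<subseteq> V" and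
    proj: "\<And>p i. p \<in> U \<Longrightarrow> i \<in> midx N \<Longrightarrow> \<psi> (f p) i = \<phi> p (\<iota> i)"
    using proj[OF charts(1)] by metis
  let ?\<pi> = "\<lambda>y. \<lambda>i\<in>midx N. y (\<iota> i)"
  have \<pi>: "?\<pi> (\<phi> p) = \<psi> (f p)" if "p \<in> U" for p
    using proj[OF that] V(2) that chart_extensional[OF Nc V(1), of "f p"]
    by (intro extensionalityI[of _ "midx N"]) auto
  have eq: "U \<inter> f -` V' = U \<inter> {p \<in> topspace (mtop M). f p \<in> V'}"
    using chart_domain_subset[OF M charts(1)] by auto
  have opn: "openin (Rn (midx M)) (\<phi> ` (U \<inter> f -` V'))"
    unfolding eq
    by (rule chart_image_of_open[OF M charts(1) openin_continuous_map_preimage[OF cont chart_domain_open[OF Nc charts(2)]]])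
  have "smooth_on (midx M) (\<phi> ` (U \<inter> f -` V')) (midx N) (\<lambda>y. \<psi>' (inv_into V \<psi> (?\<pi> y)))"
  proof (rule smooth_on_compose[where f = ?\<pi> and B = "\<psi> ` (V \<inter> V')"])
    show "finite (midx N)" using Nc by (simp add: has_charts_def)
    show "openin (Rn (midx N)) (\<psi> ` (V \<inter> V'))"
      by (rule chart_image_of_open[OF Nc V(1) chart_domain_open[OF Nc charts(2)]])
    show "?\<pi> ` \<phi> ` (U \<inter> f -` V') \<subseteq> \<psi> ` (V \<inter> V')"
      using \<pi> V(2) by auto
    show "smooth_on (midx M) (\<phi> ` (U \<inter> f -` V')) (midx N) ?\<pi>"
      using \<iota> by (auto simp: smooth_on_def intro!: Ck_on_coordinate)
    have "smooth_map N N (\<lambda>p. p)"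
      using N by (simp add: smooth_manifold_iff)
    from smooth_map_in_charts[OF this V(1) charts(2)]
    show "smooth_on (midx N) (\<psi> ` (V \<inter> V')) (midx N) (\<lambda>z. \<psi>' (inv_into V \<psi> z))"
      by (simp add: vimage_def)
  qed (rule opn)
  then show "smooth_on (midx M) (\<phi> ` (U \<inter> f -` V')) (midx N) (\<lambda>y. \<psi>' (f (inv_into U \<phi> y)))"
  proof (rule smooth_on_cong[OF opn, rotated])
    fix y assume "y \<in> \<phi> ` (U \<inter> f -` V')"
    then obtain p where p: "p \<in> U" "y = \<phi> p" by auto
    have "inv_into V \<psi> (\<psi> (f p)) = f p"
      by (rule chart_inverse[OF Nc V(1)]) (use V(2) p in auto)
    then show "\<psi>' (inv_into V \<psi> (?\<pi> y)) = \<psi>' (f (inv_into U \<phi> y))"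
      using p chart_inverse[OF M charts(1) p(1)] \<pi>[OF p(1)] by simp
  qed
qed

section \<open>Products, powers, open subsets and discrete spaces\<close>

lemma second_countable_prod_topology:
  assumes "second_countable S" "second_countable T"
  shows "second_countable (prod_topology S T)"
proof -
  obtain \<B> where \<B>: "countable \<B>" "\<And>V. V \<in> \<B> \<Longrightarrow> openin S V"
    "\<And>U x. openin S U \<Longrightarrow> x \<in> U \<Longrightarrow> \<exists>V\<in>\<B>. x \<in> V \<and> V \<subseteq> U"
    using assms(1) unfolding second_countable_def by metis
  obtain \<C> where \<C>: "countable \<C>" "\<And>V. V \<in> \<C> \<Longrightarrow> openin T V"
    "\<And>U x. openin T U \<Longrightarrow> x \<in> U \<Longrightarrow> \<exists>V\<in>\<C>. x \<in> V \<and> V \<subseteq> U"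
    using assms(2) unfolding second_countable_def by metis
  show ?thesis
    unfolding second_countable_def
  proof (intro exI[of _ "(\<lambda>(V, W). V \<times> W) ` (\<B> \<times> \<C>)"] conjI allI impI)
    show "countable ((\<lambda>(V, W). V \<times> W) ` (\<B> \<times> \<C>))"
      using \<B>(1) \<C>(1) by blast
    show "\<forall>V\<in>(\<lambda>(V, W). V \<times> W) ` (\<B> \<times> \<C>). openin (prod_topology S T) V"
      using \<B>(2) \<C>(2) by (auto simp: openin_prod_Times_iff)
    fix U x assume U: "openin (prod_topology S T) U \<and> x \<in> U"
    obtain a b where x: "x = (a, b)" by (cases x)
    obtain V W where VW: "openin S V" "openin T W" "a \<in> V" "b \<in> W" "V \<times> W \<subseteq> U"
      using U unfolding openin_prod_topology_alt x by blast
    obtain V' W' where "V' \<in> \<B>" "a \<in> V'" "V' \<subseteq> V" "W' \<in> \<C>" "b \<in> W'" "W' \<subseteq> W"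
      using \<B>(3)[OF VW(1,3)] \<C>(3)[OF VW(2,4)] by blast
    with VW(5) show "\<exists>V\<in>(\<lambda>(V, W). V \<times> W) ` (\<B> \<times> \<C>). x \<in> V \<and> V \<subseteq> U"
      unfolding x by (intro bexI[of _ "V' \<times> W'"]) auto
  qed
qed

lemma second_countable_power_topology:
  assumes I: "finite I" and "second_countable T"
  shows "second_countable (product_topology (\<lambda>_. T) I)"
proof -
  obtain \<B> where \<B>: "countable \<B>" "\<And>V. V \<in> \<B> \<Longrightarrow> openin T V"
    "\<And>U x. openin T U \<Longrightarrow> x \<in> U \<Longrightarrow> \<exists>V\<in>\<B>. x \<in> V \<and> V \<subseteq> U"
    using assms(2) unfolding second_countable_def by metis
  let ?\<C> = "Pi\<^sub>E I ` (I \<rightarrow>\<^sub>E \<B>)"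
  show ?thesis
    unfolding second_countable_def
  proof (intro exI[of _ ?\<C>] conjI allI impI)
    show "countable ?\<C>"
      using \<B>(1) I by (intro countable_image countable_PiE) auto
    show "\<forall>V\<in>?\<C>. openin (product_topology (\<lambda>_. T) I) V"
      using \<B>(2) I by (auto simp: openin_PiE)
    fix U x assume U: "openin (product_topology (\<lambda>_. T) I) U \<and> x \<in> U"
    then obtain V where V: "\<forall>i\<in>I. openin T (V i)" "x \<in> Pi\<^sub>E I V" "Pi\<^sub>E I V \<subseteq> U"
      unfolding openin_product_topology_alt by metis
    have "\<forall>i\<in>I. \<exists>W. W \<in> \<B> \<and> x i \<in> W \<and> W \<subseteq> V i"
    proof
      fix i assume "i \<in> I"
      then have "openin T (V i)" "x i \<in> V i" using V(1,2) by auto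
      from \<B>(3)[OF this] show "\<exists>W. W \<in> \<B> \<and> x i \<in> W \<and> W \<subseteq> V i" by blast
    qed
    from bchoice[OF this] obtain W where W: "\<forall>i\<in>I. W i \<in> \<B> \<and> x i \<in> W i \<and> W i \<subseteq> V i" ..
    let ?W = "restrict W I"
    show "\<exists>V\<in>?\<C>. x \<in> V \<and> V \<subseteq> U"
    proof (intro bexI conjI)
      show "x \<in> Pi\<^sub>E I ?W"
        using W V(2) by (simp add: PiE_iff)
      have "Pi\<^sub>E I ?W \<subseteq> Pi\<^sub>E I V"
        using W by (intro PiE_mono) simp
      with V(3) show "Pi\<^sub>E I ?W \<subseteq> U"
        by (rule order_trans[rotated])
      show "Pi\<^sub>E I ?W \<in> ?\<C>"
        using W by (intro imageI restrict_PiE_iff[THEN iffD2]) simp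
    qed
  qed
qed

text \<open>
  For the charts constructed below the inverse is explicit, so that both directions can be checked
  by composing continuous maps.
\<close>

lemma chart_criterion:
  assumes U: "openin T U" and A: "openin R A"
    and \<phi>: "continuous_map (subtopology T U) R \<phi>" and \<psi>: "continuous_map (subtopology R A) T \<psi>"
    and "\<And>p. p \<in> U \<Longrightarrow> \<phi> p \<in> A \<and> \<psi> (\<phi> p) = p" and "\<And>y. y \<in> A \<Longrightarrow> \<psi> y \<in> U \<and> \<phi> (\<psi> y) = y"
  shows "openin T U \<and> openin R (\<phi> ` U) \<and> homeomorphic_map (subtopology T U) (subtopology R (\<phi> ` U)) \<phi>"
proof -
  have im: "\<phi> ` U = A"
    using assms(5,6) by force
  have "homeomorphic_maps (subtopology T U) (subtopology R A) \<phi> \<psi>"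
    unfolding homeomorphic_maps_def
    using assms by (auto simp: continuous_map_in_subtopology)
  then show ?thesis
    using im U A homeomorphic_map_maps by metis
qed

lemma continuous_map_tuple:
  assumes "\<And>i. i \<in> I \<Longrightarrow> continuous_map T T' (f i)"
  shows "continuous_map T (product_topology (\<lambda>_. T') I) (\<lambda>p. \<lambda>i\<in>I. f i p)"
  unfolding continuous_map_componentwise
proof (intro conjI ballI)
  fix i assume "i \<in> I"
  then show "continuous_map T T' (\<lambda>p. (\<lambda>i\<in>I. f i p) i)"
    using assms by simp
qed auto

lemma continuous_map_reindex:
  assumes "\<iota> ` I \<subseteq> K"
  shows "continuous_map (Rn K) (Rn I) (\<lambda>y. \<lambda>i\<in>I. y (\<iota> i))"
  using assms by (intro continuous_map_tuple continuous_map_product_coordinates) auto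

lemma prod_mfd_simps [simp]:
  "mtop (prod_mfd M N) = prod_topology (mtop M) (mtop N)"
  "midx (prod_mfd M N) = midx M <+> midx N"
  by (simp_all add: prod_mfd_def)

lemma prod_mfd_atlasE:
  assumes "c \<in> atlas (prod_mfd M N)"
  obtains U \<phi> V \<psi> where "(U, \<phi>) \<in> atlas M" "(V, \<psi>) \<in> atlas N"
    "c = (U \<times> V, \<lambda>(p, q). \<lambda>k\<in>midx M <+> midx N. case k of Inl i \<Rightarrow> \<phi> p i | Inr j \<Rightarrow> \<psi> q j)"
  using assms by (auto simp: prod_mfd_def)

lemma power_mfd_simps [simp]:
  "mtop (power_mfd X M) = product_topology (\<lambda>_. mtop M) X"
  "midx (power_mfd X M) = X \<times> midx M"
  by (simp_all add: power_mfd_def)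

lemma power_mfd_atlasE:
  assumes "d \<in> atlas (power_mfd X M)"
  obtains c where "c \<in> X \<rightarrow> atlas M"
    "d = (\<Pi>\<^sub>E x\<in>X. fst (c x), \<lambda>p. \<lambda>(x, i)\<in>X \<times> midx M. snd (c x) (p x) i)"
  using assms by (auto simp: power_mfd_def)

lemma restrict_mfd_simps [simp]:
  "mtop (restrict_mfd M W) = subtopology (mtop M) W"
  "midx (restrict_mfd M W) = midx M"
  "atlas (restrict_mfd M W) = {(U \<inter> W, \<phi>) | U \<phi>. (U, \<phi>) \<in> atlas M}"
  by (simp_all add: restrict_mfd_def)

lemma points_mfd_simps [simp]:
  "mtop (points_mfd T) = T"
  "midx (points_mfd T) = {}"
  "atlas (points_mfd T) = {({p}, \<lambda>_ _. undefined) | p. p \<in> topspace T}"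
  by (simp_all add: points_mfd_def)

lemma has_charts_prod_mfd:
  assumes M: "has_charts M" and N: "has_charts N"
  shows "has_charts (prod_mfd M N)"
  unfolding has_charts_def
proof (intro conjI ballI)
  show "finite (midx (prod_mfd M N))"
    using M N by (simp add: has_charts_def)
  show "(\<Union>(W, \<theta>)\<in>atlas (prod_mfd M N). W) = topspace (mtop (prod_mfd M N))"
  proof (intro equalityI subsetI)
    fix p assume "p \<in> topspace (mtop (prod_mfd M N))"
    then have "fst p \<in> topspace (mtop M)" "snd p \<in> topspace (mtop N)" by auto
    then obtain U \<phi> V \<psi> where "(U, \<phi>) \<in> atlas M" "fst p \<in> U" "(V, \<psi>) \<in> atlas N" "snd p \<in> V"
      using obtain_chart[OF M] obtain_chart[OF N] by metis
    then have "p \<in> U \<times> V" "(U \<times> V, \<lambda>(p, q). \<lambda>k\<in>midx M <+> midx N.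
        case k of Inl i \<Rightarrow> \<phi> p i | Inr j \<Rightarrow> \<psi> q j) \<in> atlas (prod_mfd M N)"
      by (auto simp: prod_mfd_def mem_Times_iff)
    then show "p \<in> (\<Union>(W, \<theta>)\<in>atlas (prod_mfd M N). W)" by blast
  next
    fix p assume "p \<in> (\<Union>(W, \<theta>)\<in>atlas (prod_mfd M N). W)"
    then obtain c where c: "c \<in> atlas (prod_mfd M N)" "p \<in> fst c" by auto
    from c(1) obtain U \<phi> V \<psi> where "(U, \<phi>) \<in> atlas M" "(V, \<psi>) \<in> atlas N" "fst c = U \<times> V"
      by (rule prod_mfd_atlasE) simp
    moreover from this have "U \<subseteq> topspace (mtop M)" "V \<subseteq> topspace (mtop N)"
      using chart_domain_subset[OF M] chart_domain_subset[OF N] by blast+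
    ultimately show "p \<in> topspace (mtop (prod_mfd M N))"
      using c(2) by auto
  qed
  fix c assume "c \<in> atlas (prod_mfd M N)"
  then obtain U \<phi> V \<psi> where U: "(U, \<phi>) \<in> atlas M" and V: "(V, \<psi>) \<in> atlas N" and
    c: "c = (U \<times> V, \<lambda>(p, q). \<lambda>k\<in>midx M <+> midx N. case k of Inl i \<Rightarrow> \<phi> p i | Inr j \<Rightarrow> \<psi> q j)"
    by (rule prod_mfd_atlasE)
  let ?K = "midx M <+> midx N"
  let ?\<theta> = "\<lambda>(p, q). \<lambda>k\<in>?K. case k of Inl i \<Rightarrow> \<phi> p i | Inr j \<Rightarrow> \<psi> q j"
  let ?l = "\<lambda>y. \<lambda>i\<in>midx M. y (Inl i)" and ?r = "\<lambda>y. \<lambda>j\<in>midx N. y (Inr j)"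
  have l: "continuous_map (Rn ?K) (Rn (midx M)) ?l" and r: "continuous_map (Rn ?K) (Rn (midx N)) ?r"
    by (auto intro: continuous_map_reindex)
  have l\<theta>: "?l (?\<theta> (p, q)) = \<phi> p" if "p \<in> U" for p q
    using chart_extensional[OF M U that] by (intro extensionalityI[of _ "midx M"]) auto
  have r\<theta>: "?r (?\<theta> (p, q)) = \<psi> q" if "q \<in> V" for p q
    using chart_extensional[OF N V that] by (intro extensionalityI[of _ "midx N"]) auto
  let ?A = "{y \<in> topspace (Rn ?K). ?l y \<in> \<phi> ` U} \<inter> {y \<in> topspace (Rn ?K). ?r y \<in> \<psi> ` V}"
  let ?inv = "\<lambda>y. (inv_into U \<phi> (?l y), inv_into V \<psi> (?r y))"
  have "openin (mtop (prod_mfd M N)) (U \<times> V) \<and> openin (Rn ?K) (?\<theta> ` (U \<times> V)) \<and>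
      homeomorphic_map (subtopology (mtop (prod_mfd M N)) (U \<times> V)) (subtopology (Rn ?K) (?\<theta> ` (U \<times> V))) ?\<theta>"
  proof (rule chart_criterion[where A = ?A and \<psi> = ?inv])
    show "openin (mtop (prod_mfd M N)) (U \<times> V)"
      using chart_domain_open[OF M U] chart_domain_open[OF N V] by (simp add: openin_prod_Times_iff)
    show "openin (Rn ?K) ?A"
      by (intro openin_Int openin_continuous_map_preimage[OF l] openin_continuous_map_preimage[OF r] chart_image_open[OF M U]
          chart_image_open[OF N V])
    have fst: "continuous_map (subtopology (prod_topology (mtop M) (mtop N)) (U \<times> V)) (subtopology (mtop M) U) fst"
      and snd: "continuous_map (subtopology (prod_topology (mtop M) (mtop N)) (U \<times> V)) (subtopology (mtop N) V) snd"
      by (auto simp: continuous_map_in_subtopology intro: continuous_map_from_subtopology continuous_map_fst continuous_map_snd)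
    have "continuous_map (subtopology (prod_topology (mtop M) (mtop N)) (U \<times> V)) (Rn ?K)
        (\<lambda>p. \<lambda>k\<in>?K. case k of Inl i \<Rightarrow> \<phi> (fst p) i | Inr j \<Rightarrow> \<psi> (snd p) j)"
    proof (rule continuous_map_tuple)
      fix k assume "k \<in> ?K"
      then show "continuous_map (subtopology (prod_topology (mtop M) (mtop N)) (U \<times> V)) euclideanreal
          (\<lambda>p. case k of Inl i \<Rightarrow> \<phi> (fst p) i | Inr j \<Rightarrow> \<psi> (snd p) j)"
      proof
        fix i assume i: "k = Inl i" "i \<in> midx M"
        show ?thesis
          using continuous_map_compose[OF continuous_map_compose[OF fst chart_continuous[OF M U]]
              continuous_map_product_coordinates[OF i(2)]] i(1) by (simp add: o_def)
      next
        fix j assume j: "k = Inr j" "j \<in> midx N"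
        show ?thesis
          using continuous_map_compose[OF continuous_map_compose[OF snd chart_continuous[OF N V]]
              continuous_map_product_coordinates[OF j(2)]] j(1) by (simp add: o_def)
      qed
    qed
    then show "continuous_map (subtopology (mtop (prod_mfd M N)) (U \<times> V)) (Rn ?K) ?\<theta>"
      by (simp add: case_prod_unfold)
    have "continuous_map (subtopology (Rn ?K) ?A) (subtopology (Rn (midx M)) (\<phi> ` U)) ?l"
      by (rule continuous_map_into_subtopology[OF continuous_map_from_subtopology[OF l]])
         (unfold topspace_subtopology, blast)
    from continuous_map_compose[OF this chart_inverse_continuous[OF M U]]
    have 1: "continuous_map (subtopology (Rn ?K) ?A) (mtop M) (\<lambda>y. inv_into U \<phi> (?l y))"
      by (simp only: o_def)
    have "continuous_map (subtopology (Rn ?K) ?A) (subtopology (Rn (midx N)) (\<psi> ` V)) ?r"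
      by (rule continuous_map_into_subtopology[OF continuous_map_from_subtopology[OF r]])
         (unfold topspace_subtopology, blast)
    from continuous_map_compose[OF this chart_inverse_continuous[OF N V]]
    have 2: "continuous_map (subtopology (Rn ?K) ?A) (mtop N) (\<lambda>y. inv_into V \<psi> (?r y))"
      by (simp only: o_def)
    show "continuous_map (subtopology (Rn ?K) ?A) (mtop (prod_mfd M N)) ?inv"
      unfolding prod_mfd_simps by (rule continuous_map_pairedI[OF 1 2])
    fix p assume p: "p \<in> U \<times> V"
    then obtain a b where ab: "p = (a, b)" "a \<in> U" "b \<in> V" by blast
    have "?\<theta> p \<in> topspace (Rn ?K)" by (simp add: ab)
    then show "?\<theta> p \<in> ?A \<and> ?inv (?\<theta> p) = p"
      using ab(2,3) l\<theta>[OF ab(2), of b] r\<theta>[OF ab(3), of a] chart_inverse[OF M U] chart_inverse[OF N V]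
      unfolding ab(1) by simp
  next
    fix y assume y: "y \<in> ?A"
    then obtain a b where ab: "a \<in> U" "b \<in> V" "?l y = \<phi> a" "?r y = \<psi> b" by auto
    have inv: "?inv y = (a, b)"
      using ab chart_inverse[OF M U] chart_inverse[OF N V] by simp
    have "?\<theta> (a, b) = y"
    proof (rule extensionalityI[of _ ?K])
      fix k assume "k \<in> ?K"
      then show "?\<theta> (a, b) k = y k"
        using fun_cong[OF ab(3), of "projl k"] fun_cong[OF ab(4), of "projr k"] by auto
    qed (use y in \<open>auto simp: PiE_def\<close>)
    then show "?inv y \<in> U \<times> V \<and> ?\<theta> (?inv y) = y"
      using inv ab(1,2) by simp
  qed
  then show "case c of (W, \<theta>) \<Rightarrow> openin (mtop (prod_mfd M N)) W \<and>
      openin (Rn (midx (prod_mfd M N))) (\<theta> ` W) \<and>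
      homeomorphic_map (subtopology (mtop (prod_mfd M N)) W)
        (subtopology (Rn (midx (prod_mfd M N))) (\<theta> ` W)) \<theta>"
    unfolding c prod.case prod_mfd_simps .
qed

lemma has_charts_power_mfd:
  assumes X: "finite X" and M: "has_charts M"
  shows "has_charts (power_mfd X M)"
  unfolding has_charts_def
proof (intro conjI ballI)
  show "finite (midx (power_mfd X M))"
    using X M by (simp add: has_charts_def)
  show "(\<Union>(W, \<theta>)\<in>atlas (power_mfd X M). W) = topspace (mtop (power_mfd X M))"
  proof (intro equalityI subsetI)
    fix p assume p: "p \<in> topspace (mtop (power_mfd X M))"
    have "\<forall>x\<in>X. \<exists>c. c \<in> atlas M \<and> p x \<in> fst c"
      using p by (auto simp: PiE_iff intro: obtain_chart[OF M])
    from bchoice[OF this] obtain c where c: "\<forall>x\<in>X. c x \<in> atlas M \<and> p x \<in> fst (c x)" ..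
    have "(\<Pi>\<^sub>E x\<in>X. fst (c x), \<lambda>p. \<lambda>(x, i)\<in>X \<times> midx M. snd (c x) (p x) i) \<in> atlas (power_mfd X M)"
      using c by (auto simp: power_mfd_def)
    moreover have "p \<in> (\<Pi>\<^sub>E x\<in>X. fst (c x))"
      using c p by (auto simp: PiE_iff)
    ultimately show "p \<in> (\<Union>(W, \<theta>)\<in>atlas (power_mfd X M). W)"
      by blast
  next
    fix p assume "p \<in> (\<Union>(W, \<theta>)\<in>atlas (power_mfd X M). W)"
    then obtain c where c: "c \<in> X \<rightarrow> atlas M" "p \<in> (\<Pi>\<^sub>E x\<in>X. fst (c x))"
      by (auto elim!: power_mfd_atlasE)
    then have "fst (c x) \<subseteq> topspace (mtop M)" if "x \<in> X" for x
      using chart_domain_subset[OF M, of "fst (c x)" "snd (c x)"] that by auto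
    with c(2) show "p \<in> topspace (mtop (power_mfd X M))"
      by (auto simp: PiE_iff)
  qed
  fix d assume "d \<in> atlas (power_mfd X M)"
  then obtain c where c: "c \<in> X \<rightarrow> atlas M" and
    d: "d = (\<Pi>\<^sub>E x\<in>X. fst (c x), \<lambda>p. \<lambda>(x, i)\<in>X \<times> midx M. snd (c x) (p x) i)"
    by (rule power_mfd_atlasE)
  define U where "U x = fst (c x)" for x
  define \<phi> where "\<phi> x = snd (c x)" for x
  have U: "(U x, \<phi> x) \<in> atlas M" if "x \<in> X" for x
    using c that by (auto simp: U_def \<phi>_def)
  let ?K = "X \<times> midx M"
  let ?\<theta> = "\<lambda>p. \<lambda>(x, i)\<in>?K. \<phi> x (p x) i"
  let ?l = "\<lambda>x y. \<lambda>i\<in>midx M. y (x, i)"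
  have l: "continuous_map (Rn ?K) (Rn (midx M)) (?l x)" if "x \<in> X" for x
    using that by (auto intro: continuous_map_reindex)
  have l\<theta>: "?l x (?\<theta> p) = \<phi> x (p x)" if "x \<in> X" "p x \<in> U x" for x p
    using chart_extensional[OF M U that(2)] that by (intro extensionalityI[of _ "midx M"]) auto
  let ?A = "topspace (Rn ?K) \<inter> (\<Inter>x\<in>X. {y \<in> topspace (Rn ?K). ?l x y \<in> \<phi> x ` U x})"
  let ?inv = "\<lambda>y. \<lambda>x\<in>X. inv_into (U x) (\<phi> x) (?l x y)"
  have "openin (mtop (power_mfd X M)) (Pi\<^sub>E X U) \<and> openin (Rn ?K) (?\<theta> ` Pi\<^sub>E X U) \<and>
      homeomorphic_map (subtopology (mtop (power_mfd X M)) (Pi\<^sub>E X U)) (subtopology (Rn ?K) (?\<theta> ` Pi\<^sub>E X U)) ?\<theta>"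
  proof (rule chart_criterion[where A = ?A and \<psi> = ?inv])
    show "openin (mtop (power_mfd X M)) (Pi\<^sub>E X U)"
      using chart_domain_open[OF M U] X by (simp add: openin_PiE)
    show "openin (Rn ?K) ?A"
    proof (cases "X = {}")
      case False
      have "openin (Rn ?K) (\<Inter>x\<in>X. {y \<in> topspace (Rn ?K). ?l x y \<in> \<phi> x ` U x})"
        by (intro openin_INT2[OF X False] openin_continuous_map_preimage[OF l chart_image_open[OF M U]])
      then show ?thesis by (intro openin_Int openin_topspace)
    next
      case True
      have "openin (Rn ?K) (topspace (Rn ?K))" by (rule openin_topspace)
      then show ?thesis unfolding True by simp
    qed
    have coord: "continuous_map (subtopology (product_topology (\<lambda>_. mtop M) X) (Pi\<^sub>E X U)) (subtopology (mtop M) (U x)) (\<lambda>p. p x)"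
      if "x \<in> X" for x
      unfolding continuous_map_in_subtopology
      using that continuous_map_from_subtopology[OF continuous_map_product_coordinates[OF that]] by auto
    have "continuous_map (subtopology (product_topology (\<lambda>_. mtop M) X) (Pi\<^sub>E X U)) (Rn ?K) (\<lambda>p. \<lambda>k\<in>?K. \<phi> (fst k) (p (fst k)) (snd k))"
    proof (rule continuous_map_tuple)
      fix k assume "k \<in> ?K"
      then have k: "fst k \<in> X" "snd k \<in> midx M" by auto
      show "continuous_map (subtopology (product_topology (\<lambda>_. mtop M) X) (Pi\<^sub>E X U)) euclideanreal
          (\<lambda>p. \<phi> (fst k) (p (fst k)) (snd k))"
        using continuous_map_compose[OF continuous_map_compose[OF coord[OF k(1)] chart_continuous[OF M U[OF k(1)]]]
            continuous_map_product_coordinates[OF k(2)]] by (simp add: o_def)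
    qed
    then show "continuous_map (subtopology (mtop (power_mfd X M)) (Pi\<^sub>E X U)) (Rn ?K) ?\<theta>"
      by (simp add: case_prod_unfold)
    show "continuous_map (subtopology (Rn ?K) ?A) (mtop (power_mfd X M)) ?inv"
      unfolding power_mfd_simps continuous_map_componentwise
    proof (intro conjI ballI)
      fix x assume x: "x \<in> X"
      have "continuous_map (subtopology (Rn ?K) ?A) (subtopology (Rn (midx M)) (\<phi> x ` U x)) (?l x)"
        by (rule continuous_map_into_subtopology[OF continuous_map_from_subtopology[OF l[OF x]]])
           (unfold topspace_subtopology, use x in blast)
      from continuous_map_compose[OF this chart_inverse_continuous[OF M U[OF x]]]
      show "continuous_map (subtopology (Rn ?K) ?A) (mtop M) (\<lambda>y. ?inv y x)"
        using x by (simp add: o_def)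
    qed auto
    fix p assume p: "p \<in> Pi\<^sub>E X U"
    have "?inv (?\<theta> p) = p"
    proof (rule extensionalityI[of _ X])
      fix x assume x: "x \<in> X"
      then have "p x \<in> U x" using p by auto
      then show "?inv (?\<theta> p) x = p x"
        using l\<theta>[OF x] chart_inverse[OF M U[OF x]] x by simp
    qed (use p in \<open>auto simp: PiE_def\<close>)
    moreover have "?l x (?\<theta> p) \<in> \<phi> x ` U x" if "x \<in> X" for x
    proof -
      have "p x \<in> U x" using p that by auto
      then show ?thesis by (simp only: l\<theta>[OF that] imageI)
    qed
    moreover have "?\<theta> p \<in> topspace (Rn ?K)" by simp
    ultimately show "?\<theta> p \<in> ?A \<and> ?inv (?\<theta> p) = p"
      by blast
  next
    fix y assume y: "y \<in> ?A"
    have inv: "inv_into (U x) (\<phi> x) (?l x y) \<in> U x \<and> \<phi> x (inv_into (U x) (\<phi> x) (?l x y)) = ?l x y"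
      if "x \<in> X" for x
    proof -
      have "?l x y \<in> \<phi> x ` U x" using y that by blast
      then show ?thesis by (meson inv_into_into f_inv_into_f)
    qed
    have "?\<theta> (?inv y) = y"
    proof (rule extensionalityI[of _ ?K])
      fix k assume "k \<in> ?K"
      then obtain x i where k: "k = (x, i)" "x \<in> X" "i \<in> midx M" by blast
      then show "?\<theta> (?inv y) k = y k"
        using inv[OF k(2)] by simp
    qed (use y in \<open>auto simp: PiE_def\<close>)
    then show "?inv y \<in> Pi\<^sub>E X U \<and> ?\<theta> (?inv y) = y"
      using inv by auto
  qed
  then show "case d of (W, \<theta>) \<Rightarrow> openin (mtop (power_mfd X M)) W \<and>
      openin (Rn (midx (power_mfd X M))) (\<theta> ` W) \<and>
      homeomorphic_map (subtopology (mtop (power_mfd X M)) W)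
        (subtopology (Rn (midx (power_mfd X M))) (\<theta> ` W)) \<theta>"
    unfolding d prod.case power_mfd_simps U_def \<phi>_def .
qed

lemma has_charts_restrict_mfd:
  assumes M: "has_charts M" and W: "openin (mtop M) W"
  shows "has_charts (restrict_mfd M W)"
  unfolding has_charts_def
proof (intro conjI ballI)
  show "finite (midx (restrict_mfd M W))"
    using M by (simp add: has_charts_def)
  show "(\<Union>(V, \<phi>)\<in>atlas (restrict_mfd M W). V) = topspace (mtop (restrict_mfd M W))"
  proof (intro equalityI subsetI)
    fix p assume "p \<in> topspace (mtop (restrict_mfd M W))"
    then have p: "p \<in> topspace (mtop M)" "p \<in> W" by auto
    then obtain U \<phi> where "(U, \<phi>) \<in> atlas M" "p \<in> U" using obtain_chart[OF M] by metis
    then have "(U \<inter> W, \<phi>) \<in> atlas (restrict_mfd M W)" "p \<in> U \<inter> W" using p by auto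
    then show "p \<in> (\<Union>(V, \<phi>)\<in>atlas (restrict_mfd M W). V)" by blast
  qed (use chart_domain_subset[OF M] in auto)
  fix c assume "c \<in> atlas (restrict_mfd M W)"
  then obtain U \<phi> where U: "(U, \<phi>) \<in> atlas M" and c: "c = (U \<inter> W, \<phi>)" by auto
  have "openin (subtopology (mtop M) W) (U \<inter> W) \<and> openin (Rn (midx M)) (\<phi> ` (U \<inter> W)) \<and>
      homeomorphic_map (subtopology (subtopology (mtop M) W) (U \<inter> W)) (subtopology (Rn (midx M)) (\<phi> ` (U \<inter> W))) \<phi>"
  proof (rule chart_criterion[where \<psi> = "inv_into U \<phi>"])
    show "openin (subtopology (mtop M) W) (U \<inter> W)"
      using chart_domain_open[OF M U] by (rule openin_subtopology_Int)
    show "openin (Rn (midx M)) (\<phi> ` (U \<inter> W))"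
      by (rule chart_image_of_open[OF M U W])
    show "continuous_map (subtopology (subtopology (mtop M) W) (U \<inter> W)) (Rn (midx M)) \<phi>"
      using continuous_map_from_subtopology_mono[OF chart_continuous[OF M U], of "U \<inter> W"]
      by (simp add: subtopology_subtopology Int_ac)
    have "continuous_map (subtopology (Rn (midx M)) (\<phi> ` (U \<inter> W))) (mtop M) (inv_into U \<phi>)"
      by (rule continuous_map_from_subtopology_mono[OF chart_inverse_continuous[OF M U]]) auto
    then show "continuous_map (subtopology (Rn (midx M)) (\<phi> ` (U \<inter> W))) (subtopology (mtop M) W) (inv_into U \<phi>)"
      using chart_inverse[OF M U] by (auto simp: continuous_map_in_subtopology)
  qed (use chart_inverse[OF M U] in auto)
  then show "case c of (V, \<phi>) \<Rightarrow> openin (mtop (restrict_mfd M W)) V \<and>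
      openin (Rn (midx (restrict_mfd M W))) (\<phi> ` V) \<and>
      homeomorphic_map (subtopology (mtop (restrict_mfd M W)) V)
        (subtopology (Rn (midx (restrict_mfd M W))) (\<phi> ` V)) \<phi>"
    unfolding c prod.case restrict_mfd_simps .
qed

lemma smooth_map_fst:
  assumes M: "smooth_manifold M" and N: "smooth_manifold N"
  shows "smooth_map (prod_mfd M N) M fst"
proof (rule smooth_map_coordinate_projection[where \<iota> = Inl])
  show "has_charts (prod_mfd M N)"
    by (intro has_charts_prod_mfd smooth_manifold_has_charts M N)
  fix W \<theta> assume "(W, \<theta>) \<in> atlas (prod_mfd M N)"
  then obtain U \<phi> V \<psi> where "(U, \<phi>) \<in> atlas M" "(V, \<psi>) \<in> atlas N"
    "(W, \<theta>) = (U \<times> V, \<lambda>(p, q). \<lambda>k\<in>midx M <+> midx N. case k of Inl i \<Rightarrow> \<phi> p i | Inr j \<Rightarrow> \<psi> q j)"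
    by (rule prod_mfd_atlasE)
  then show "\<exists>V \<psi>. (V, \<psi>) \<in> atlas M \<and> fst ` W \<subseteq> V \<and> (\<forall>p\<in>W. \<forall>i\<in>midx M. \<psi> (fst p) i = \<theta> p (Inl i))"
    by (intro exI[of _ U] exI[of _ \<phi>]) auto
qed (use M in \<open>auto intro: continuous_map_fst\<close>)

lemma smooth_map_snd:
  assumes M: "smooth_manifold M" and N: "smooth_manifold N"
  shows "smooth_map (prod_mfd M N) N snd"
proof (rule smooth_map_coordinate_projection[where \<iota> = Inr])
  show "has_charts (prod_mfd M N)"
    by (intro has_charts_prod_mfd smooth_manifold_has_charts M N)
  fix W \<theta> assume "(W, \<theta>) \<in> atlas (prod_mfd M N)"
  then obtain U \<phi> V \<psi> where "(U, \<phi>) \<in> atlas M" "(V, \<psi>) \<in> atlas N"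
    "(W, \<theta>) = (U \<times> V, \<lambda>(p, q). \<lambda>k\<in>midx M <+> midx N. case k of Inl i \<Rightarrow> \<phi> p i | Inr j \<Rightarrow> \<psi> q j)"
    by (rule prod_mfd_atlasE)
  then show "\<exists>V \<psi>. (V, \<psi>) \<in> atlas N \<and> snd ` W \<subseteq> V \<and> (\<forall>p\<in>W. \<forall>j\<in>midx N. \<psi> (snd p) j = \<theta> p (Inr j))"
    by (intro exI[of _ V] exI[of _ \<psi>]) auto
qed (use N in \<open>auto intro: continuous_map_snd\<close>)

lemma smooth_map_power_coordinate:
  assumes "finite X" "smooth_manifold M" "x \<in> X"
  shows "smooth_map (power_mfd X M) M (\<lambda>p. p x)"
proof (rule smooth_map_coordinate_projection[where \<iota> = "Pair x"])
  show "has_charts (power_mfd X M)"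
    using assms by (intro has_charts_power_mfd smooth_manifold_has_charts)
  fix W \<theta> assume "(W, \<theta>) \<in> atlas (power_mfd X M)"
  then obtain c where c: "c \<in> X \<rightarrow> atlas M"
    "(W, \<theta>) = (\<Pi>\<^sub>E x\<in>X. fst (c x), \<lambda>p. \<lambda>(x, i)\<in>X \<times> midx M. snd (c x) (p x) i)"
    by (rule power_mfd_atlasE)
  then show "\<exists>V \<psi>. (V, \<psi>) \<in> atlas M \<and> (\<lambda>p. p x) ` W \<subseteq> V \<and> (\<forall>p\<in>W. \<forall>i\<in>midx M. \<psi> (p x) i = \<theta> p (x, i))"
    using assms(3) by (intro exI[of _ "fst (c x)"] exI[of _ "snd (c x)"]) auto
next
  show "continuous_map (mtop (power_mfd X M)) (mtop M) (\<lambda>p. p x)"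
    using continuous_map_product_coordinates[OF assms(3), of "\<lambda>_. mtop M"] by simp
qed (use assms in auto)

lemma smooth_mapI:
  assumes "continuous_map (mtop M) (mtop N) f"
    and "\<And>U \<phi> V \<psi>. (U, \<phi>) \<in> atlas M \<Longrightarrow> (V, \<psi>) \<in> atlas N \<Longrightarrow>
      smooth_on (midx M) (\<phi> ` (U \<inter> f -` V)) (midx N) (\<lambda>y. \<psi> (f (inv_into U \<phi> y)))"
  shows "smooth_map M N f"
  using assms unfolding smooth_map_def by blast

lemma smooth_map_pair:
  assumes f: "smooth_map P M f" and g: "smooth_map P N g"
  shows "smooth_map P (prod_mfd M N) (\<lambda>p. (f p, g p))"
proof (rule smooth_mapI)
  show "continuous_map (mtop P) (mtop (prod_mfd M N)) (\<lambda>p. (f p, g p))"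
    using smooth_map_continuous[OF f] smooth_map_continuous[OF g] by (simp add: continuous_map_pairedI)
  fix W \<theta> D \<eta> assume W: "(W, \<theta>) \<in> atlas P" and "(D, \<eta>) \<in> atlas (prod_mfd M N)"
  from this(2) obtain U \<phi> V \<psi> where U: "(U, \<phi>) \<in> atlas M" and V: "(V, \<psi>) \<in> atlas N" and
    c: "(D, \<eta>) = (U \<times> V, \<lambda>(p, q). \<lambda>k\<in>midx M <+> midx N. case k of Inl i \<Rightarrow> \<phi> p i | Inr j \<Rightarrow> \<psi> q j)"
    by (rule prod_mfd_atlasE)
  let ?A = "\<theta> ` (W \<inter> (\<lambda>p. (f p, g p)) -` (U \<times> V))"
  have 1: "smooth_on (midx P) ?A (midx M) (\<lambda>y. \<phi> (f (inv_into W \<theta> y)))"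
    using smooth_map_in_charts[OF f W U] by (rule smooth_on_mono) auto
  have 2: "smooth_on (midx P) ?A (midx N) (\<lambda>y. \<psi> (g (inv_into W \<theta> y)))"
    using smooth_map_in_charts[OF g W V] by (rule smooth_on_mono) auto
  show "smooth_on (midx P) (\<theta> ` (W \<inter> (\<lambda>p. (f p, g p)) -` D)) (midx (prod_mfd M N))
      (\<lambda>y. \<eta> (f (inv_into W \<theta> y), g (inv_into W \<theta> y)))"
    using 1 2 c by (auto simp: smooth_on_def)
qed

lemma smooth_map_tuple:
  assumes f: "\<And>x. x \<in> X \<Longrightarrow> smooth_map P M (f x)"
  shows "smooth_map P (power_mfd X M) (\<lambda>p. \<lambda>x\<in>X. f x p)"
proof (rule smooth_mapI)
  show "continuous_map (mtop P) (mtop (power_mfd X M)) (\<lambda>p. \<lambda>x\<in>X. f x p)"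
    using smooth_map_continuous[OF f] by (simp add: continuous_map_tuple)
  fix W \<theta> D \<eta> assume W: "(W, \<theta>) \<in> atlas P" and "(D, \<eta>) \<in> atlas (power_mfd X M)"
  from this(2) obtain c where c: "c \<in> X \<rightarrow> atlas M"
    and e: "(D, \<eta>) = (\<Pi>\<^sub>E x\<in>X. fst (c x), \<lambda>p. \<lambda>(x, i)\<in>X \<times> midx M. snd (c x) (p x) i)"
    by (rule power_mfd_atlasE)
  let ?A = "\<theta> ` (W \<inter> (\<lambda>p. \<lambda>x\<in>X. f x p) -` (\<Pi>\<^sub>E x\<in>X. fst (c x)))"
  have "smooth_on (midx P) ?A (midx M) (\<lambda>y. snd (c x) (f x (inv_into W \<theta> y)))" if x: "x \<in> X" for x
  proof -
    have "(fst (c x), snd (c x)) \<in> atlas M" using c x by auto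
    from smooth_map_in_charts[OF f[OF x] W this] show ?thesis
      by (rule smooth_on_mono) (intro image_mono, use x in auto)
  qed
  then show "smooth_on (midx P) (\<theta> ` (W \<inter> (\<lambda>p. \<lambda>x\<in>X. f x p) -` D)) (midx (power_mfd X M))
      (\<lambda>y. \<eta> (\<lambda>x\<in>X. f x (inv_into W \<theta> y)))"
    using e by (auto simp: smooth_on_def)
qed

lemma smooth_map_into_restrict:
  assumes f: "smooth_map P M f" and W: "f ` topspace (mtop P) \<subseteq> W"
  shows "smooth_map P (restrict_mfd M W) f"
proof (rule smooth_mapI)
  show "continuous_map (mtop P) (mtop (restrict_mfd M W)) f"
    using smooth_map_continuous[OF f] W by (auto simp: continuous_map_in_subtopology)
  fix U \<phi> D \<psi> assume U: "(U, \<phi>) \<in> atlas P" and "(D, \<psi>) \<in> atlas (restrict_mfd M W)"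
  then obtain V where D: "D = V \<inter> W" "(V, \<psi>) \<in> atlas M" by auto
  show "smooth_on (midx P) (\<phi> ` (U \<inter> f -` D)) (midx (restrict_mfd M W)) (\<lambda>y. \<psi> (f (inv_into U \<phi> y)))"
    unfolding restrict_mfd_simps D(1)
    by (rule smooth_on_mono[OF smooth_map_in_charts[OF f U D(2)]]) auto
qed

lemma smooth_map_restrict_inclusion:
  assumes "smooth_manifold M" "openin (mtop M) W"
  shows "smooth_map (restrict_mfd M W) M (\<lambda>p. p)"
proof (rule smooth_map_coordinate_projection[where \<iota> = "\<lambda>i. i"])
  show "has_charts (restrict_mfd M W)"
    using assms by (intro has_charts_restrict_mfd smooth_manifold_has_charts)
  show "continuous_map (mtop (restrict_mfd M W)) (mtop M) (\<lambda>p. p)"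
    using continuous_map_from_subtopology[OF continuous_map_id[of "mtop M"]] by (simp add: id_def)
  show "\<exists>V \<psi>. (V, \<psi>) \<in> atlas M \<and> (\<lambda>p. p) ` U \<subseteq> V \<and> (\<forall>p\<in>U. \<forall>i\<in>midx M. \<psi> p i = \<phi> p i)"
    if "(U, \<phi>) \<in> atlas (restrict_mfd M W)" for U \<phi>
    using that by auto
qed (use assms in auto)

lemma smooth_map_into_points: "continuous_map (mtop P) T f \<Longrightarrow> smooth_map P (points_mfd T) f"
  by (auto simp: smooth_map_def smooth_on_def)

text \<open>
  Compatibility of the charts amounts to smoothness of the identity, and the identity of a product
  is the pairing of the projections. The same idea serves for powers and open subsets.
\<close>

lemma smooth_manifold_prod_mfd:
  assumes M: "smooth_manifold M" and N: "smooth_manifold N"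
  shows "smooth_manifold (prod_mfd M N)"
  unfolding smooth_manifold_iff
proof (intro conjI)
  show "has_charts (prod_mfd M N)"
    by (intro has_charts_prod_mfd smooth_manifold_has_charts M N)
  show "smooth_map (prod_mfd M N) (prod_mfd M N) (\<lambda>p. p)"
    using smooth_map_pair[OF smooth_map_fst[OF M N] smooth_map_snd[OF M N]] by simp
qed (use M N in \<open>auto simp: smooth_manifold_iff Hausdorff_space_prod_topology second_countable_prod_topology\<close>)

lemma smooth_manifold_power_mfd:
  assumes X: "finite X" and M: "smooth_manifold M"
  shows "smooth_manifold (power_mfd X M)"
  unfolding smooth_manifold_iff
proof (intro conjI)
  show Pc: "has_charts (power_mfd X M)"
    by (intro has_charts_power_mfd smooth_manifold_has_charts X M)
  show "smooth_map (power_mfd X M) (power_mfd X M) (\<lambda>p. p)"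
  proof (rule smooth_map_local[OF Pc Pc])
    fix p assume "p \<in> topspace (mtop (power_mfd X M))"
    moreover have "smooth_map (power_mfd X M) (power_mfd X M) (\<lambda>p. \<lambda>x\<in>X. p x)"
      by (intro smooth_map_tuple smooth_map_power_coordinate X M)
    moreover have "\<forall>q\<in>topspace (mtop (power_mfd X M)). q = (\<lambda>x\<in>X. q x)"
      by (auto simp: PiE_def extensional_restrict)
    ultimately show "\<exists>W g. openin (mtop (power_mfd X M)) W \<and> p \<in> W \<and>
        smooth_map (power_mfd X M) (power_mfd X M) g \<and> (\<forall>q\<in>W. q = g q)"
      using openin_topspace[of "mtop (power_mfd X M)"]
      by (intro exI[of _ "topspace (mtop (power_mfd X M))"] exI[of _ "\<lambda>p. \<lambda>x\<in>X. p x"] conjI)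
  qed
qed (use X M in \<open>auto simp: smooth_manifold_iff Hausdorff_space_product_topology second_countable_power_topology\<close>)

lemma smooth_manifold_restrict_mfd:
  assumes M: "smooth_manifold M" and W: "openin (mtop M) W"
  shows "smooth_manifold (restrict_mfd M W)"
  unfolding smooth_manifold_iff
proof (intro conjI)
  show "has_charts (restrict_mfd M W)"
    by (intro has_charts_restrict_mfd smooth_manifold_has_charts M W)
  show "smooth_map (restrict_mfd M W) (restrict_mfd M W) (\<lambda>p. p)"
    by (rule smooth_map_into_restrict[OF smooth_map_restrict_inclusion[OF M W]]) simp
qed (use M in \<open>auto simp: smooth_manifold_iff Hausdorff_space_subtopology second_countable_subtopology\<close>)

lemma smooth_manifold_points_mfd:
  assumes "countable A"
  shows "smooth_manifold (points_mfd (discrete_topology A))"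
  unfolding smooth_manifold_iff
proof (intro conjI)
  let ?P = "points_mfd (discrete_topology A)"
  show "smooth_map ?P ?P (\<lambda>p. p)"
    using continuous_map_id[of "discrete_topology A"] by (intro smooth_map_into_points) (simp add: id_def)
  show "has_charts ?P"
    unfolding has_charts_def
  proof (intro conjI ballI)
    fix c assume "c \<in> atlas ?P"
    then obtain p where p: "p \<in> A" and c: "c = ({p}, \<lambda>_ _. undefined)" by auto
    have "openin (discrete_topology A) {p} \<and> openin (Rn ({} :: unit set)) ((\<lambda>_ _. undefined) ` {p}) \<and>
        homeomorphic_map (subtopology (discrete_topology A) {p})
          (subtopology (Rn ({} :: unit set)) ((\<lambda>_ _. undefined) ` {p})) (\<lambda>_ _. undefined)"
      by (rule chart_criterion[where A = "{\<lambda>_. undefined}" and \<psi> = "\<lambda>_. p"])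
         (use p in \<open>auto simp: openin_product_topology_empty\<close>)
    then show "case c of (W, \<theta>) \<Rightarrow> openin (mtop ?P) W \<and> openin (Rn (midx ?P)) (\<theta> ` W) \<and>
      homeomorphic_map (subtopology (mtop ?P) W) (subtopology (Rn (midx ?P)) (\<theta> ` W)) \<theta>"
      unfolding c prod.case points_mfd_simps .
  qed auto
qed (use assms in \<open>auto simp: second_countable_discrete_topology\<close>)

section \<open>Smooth and continuous maps in parallel\<close>

text \<open>
  The flag \<open>s\<close> chooses between smooth maps of manifolds and continuous maps of spaces. A power of a
  manifold with an infinite exponent is only a space, so the second alternative refers to nothing
  but the topologies.
\<close>

definition regular_map :: "bool \<Rightarrow> ('p, 'i) mfd \<Rightarrow> ('q, 'j) mfd \<Rightarrow> ('p \<Rightarrow> 'q) \<Rightarrow> bool" where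
  "regular_map s M N f \<longleftrightarrow> (if s then smooth_map M N f else continuous_map (mtop M) (mtop N) f)"

definition regular_space :: "bool \<Rightarrow> ('p, 'i) mfd \<Rightarrow> bool" where
  "regular_space s M \<longleftrightarrow> (s \<longrightarrow> smooth_manifold M)"

lemma regular_map_continuous: "regular_map s M N f \<Longrightarrow> continuous_map (mtop M) (mtop N) f"
  by (auto simp: regular_map_def smooth_map_continuous split: if_splits)

lemma smooth_map_regular: "smooth_map M N f \<Longrightarrow> regular_map s M N f"
  by (simp add: regular_map_def smooth_map_continuous)

lemma regular_map_funcset: "regular_map s M N f \<Longrightarrow> f \<in> topspace (mtop M) \<rightarrow> topspace (mtop N)"
  using regular_map_continuous continuous_map_funspace by blast

lemma regular_map_compose:
  assumes "regular_space s M" "regular_space s N" "regular_space s P"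
    and "regular_map s M N f" "regular_map s N P g"
  shows "regular_map s M P (\<lambda>p. g (f p))"
proof (cases s)
  case True
  then show ?thesis
    using assms smooth_map_compose[of M N P f g]
    by (simp add: regular_map_def regular_space_def smooth_manifold_has_charts)
next
  case False
  then show ?thesis
    using assms continuous_map_compose[of _ _ f _ g] by (simp add: regular_map_def o_def)
qed

lemma regular_map_local:
  assumes "regular_space s M" "regular_space s N"
    and loc: "\<And>p. p \<in> topspace (mtop M) \<Longrightarrow>
      \<exists>W g. openin (mtop M) W \<and> p \<in> W \<and> regular_map s M N g \<and> (\<forall>q\<in>W. f q = g q)"
  shows "regular_map s M N f"
proof (cases s)
  case True
  have "smooth_map M N f"
    by (rule smooth_map_local)
       (use assms True in \<open>simp_all add: regular_map_def regular_space_def smooth_manifold_has_charts\<close>)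
  then show ?thesis
    using True by (simp add: regular_map_def)
next
  case False
  have "continuous_map (mtop M) (mtop N) f"
  proof (rule continuous_map_local)
    fix p assume "p \<in> topspace (mtop M)"
    from loc[OF this] obtain W g where "openin (mtop M) W" "p \<in> W" "regular_map s M N g" "\<forall>q\<in>W. f q = g q"
      by blast
    then show "\<exists>W g. openin (mtop M) W \<and> p \<in> W \<and>
        continuous_map (subtopology (mtop M) W) (mtop N) g \<and> (\<forall>q\<in>W. f q = g q)"
      by (intro exI[of _ W] exI[of _ g] conjI continuous_map_from_subtopology regular_map_continuous)
  qed
  then show ?thesis
    using False by (simp add: regular_map_def)
qed

lemma regular_map_cong:
  assumes "regular_space s M" "regular_space s N" "regular_map s M N g"
    and "\<And>p. p \<in> topspace (mtop M) \<Longrightarrow> f p = g p"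
  shows "regular_map s M N f"
proof (rule regular_map_local[OF assms(1,2)])
  fix p assume "p \<in> topspace (mtop M)"
  then show "\<exists>W g. openin (mtop M) W \<and> p \<in> W \<and> regular_map s M N g \<and> (\<forall>q\<in>W. f q = g q)"
    using assms(3,4) openin_topspace[of "mtop M"]
    by (intro exI[of _ "topspace (mtop M)"] exI[of _ g] conjI ballI)
qed

lemma regular_map_id: "regular_space s M \<Longrightarrow> regular_map s M M (\<lambda>p. p)"
  using continuous_map_id[of "mtop M"]
  by (simp add: regular_map_def regular_space_def smooth_manifold_iff id_def)

lemma regular_map_fst: "regular_space s M \<Longrightarrow> regular_space s N \<Longrightarrow> regular_map s (prod_mfd M N) M fst"
  by (simp add: regular_map_def regular_space_def smooth_map_fst continuous_map_fst)

lemma regular_map_snd: "regular_space s M \<Longrightarrow> regular_space s N \<Longrightarrow> regular_map s (prod_mfd M N) N snd"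
  by (simp add: regular_map_def regular_space_def smooth_map_snd continuous_map_snd)

lemma regular_map_pair:
  "regular_map s P M f \<Longrightarrow> regular_map s P N g \<Longrightarrow> regular_map s P (prod_mfd M N) (\<lambda>p. (f p, g p))"
  by (simp add: regular_map_def smooth_map_pair continuous_map_pairedI split: if_splits)

lemma regular_map_power_coordinate:
  assumes "s \<Longrightarrow> finite X" "regular_space s M" "x \<in> X"
  shows "regular_map s (power_mfd X M) M (\<lambda>p. p x)"
  using assms continuous_map_product_coordinates[OF assms(3), of "\<lambda>_. mtop M"]
  by (simp add: regular_map_def regular_space_def smooth_map_power_coordinate)

lemma regular_map_tuple:
  assumes "\<And>x. x \<in> X \<Longrightarrow> regular_map s P M (f x)"
  shows "regular_map s P (power_mfd X M) (\<lambda>p. \<lambda>x\<in>X. f x p)"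
  using assms smooth_map_tuple[of X P M f] continuous_map_tuple[of X "mtop P" "mtop M" f]
  by (simp add: regular_map_def split: if_splits)

lemma regular_map_into_restrict:
  assumes "regular_map s P M f" "f \<in> topspace (mtop P) \<rightarrow> W"
  shows "regular_map s P (restrict_mfd M W) f"
  using assms smooth_map_into_restrict[of P M f W]
  by (auto simp: regular_map_def continuous_map_in_subtopology split: if_splits)

lemma regular_map_restrict_inclusion:
  assumes "regular_space s M" "s \<Longrightarrow> openin (mtop M) W"
  shows "regular_map s (restrict_mfd M W) M (\<lambda>p. p)"
  using assms smooth_map_restrict_inclusion[of M W]
    continuous_map_from_subtopology[OF continuous_map_id[of "mtop M"], of W]
  by (simp add: regular_map_def regular_space_def id_def)

lemma regular_map_into_points: "continuous_map (mtop P) T f \<Longrightarrow> regular_map s P (points_mfd T) f"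
  by (simp add: regular_map_def smooth_map_into_points)

lemma regular_space_prod: "regular_space s M \<Longrightarrow> regular_space s N \<Longrightarrow> regular_space s (prod_mfd M N)"
  by (simp add: regular_space_def smooth_manifold_prod_mfd)

lemma regular_space_power: "(s \<Longrightarrow> finite X) \<Longrightarrow> regular_space s M \<Longrightarrow> regular_space s (power_mfd X M)"
  by (simp add: regular_space_def smooth_manifold_power_mfd)

lemma regular_space_restrict:
  "regular_space s M \<Longrightarrow> (s \<Longrightarrow> openin (mtop M) W) \<Longrightarrow> regular_space s (restrict_mfd M W)"
  by (simp add: regular_space_def smooth_manifold_restrict_mfd)

definition regular_group :: "bool \<Rightarrow> 'g monoid \<Rightarrow> ('g, 'i) mfd \<Rightarrow> bool" where
  "regular_group s G M \<longleftrightarrow>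
     group G \<and> regular_space s M \<and> topspace (mtop M) = carrier G \<and>
     regular_map s (prod_mfd M M) M (\<lambda>(g, h). g \<otimes>\<^bsub>G\<^esub> h) \<and> regular_map s M M (\<lambda>g. inv\<^bsub>G\<^esub> g)"

definition regular_action :: "bool \<Rightarrow> ('g, 'f, 'i, 'j) gspace \<Rightarrow> bool" where
  "regular_action s S \<longleftrightarrow>
     regular_group s (grp S) (gmfd S) \<and> regular_space s (fmfd S) \<and>
     group_action (grp S) (pts S) (act S) \<and>
     regular_map s (prod_mfd (gmfd S) (fmfd S)) (fmfd S) (\<lambda>(g, f). act S g f)"

definition regular_torsor :: "bool \<Rightarrow> ('g, 'f, 'i, 'j) gspace \<Rightarrow> bool" where
  "regular_torsor s S \<longleftrightarrow> regular_action s S \<and> free_act S \<and> transitive_act S"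

definition regular_hom ::
  "bool \<Rightarrow> ('g, 'f, 'i, 'j) gspace \<Rightarrow> ('h, 'e, 'k, 'l) gspace \<Rightarrow> ('f \<Rightarrow> 'e) set" where
  "regular_hom s S S' = {\<alpha> \<in> extensional (pts S). regular_map s (fmfd S) (fmfd S') \<alpha> \<and>
     (\<exists>\<xi>\<in>hom (grp S) (grp S'). regular_map s (gmfd S) (gmfd S') \<xi> \<and> equivariant S S' \<xi> \<alpha>)}"

text \<open>This is \<open>Tor\<close> if \<open>s\<close> holds and \<open>TopTor\<close> otherwise.\<close>

definition Regular_Tor :: "bool \<Rightarrow> (('g, 'f, 'i, 'j) gspace, 'f \<Rightarrow> 'f) cat" where
  "Regular_Tor s = \<lparr>Obj = {S. regular_torsor s S}, Hom = regular_hom s, Idn = (\<lambda>S. \<lambda>f\<in>pts S. f),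
     Comp = (\<lambda>S _ _ \<beta> \<alpha>. compose (pts S) \<beta> \<alpha>)\<rparr>"

lemma regular_action_smooth: "regular_action True S \<longleftrightarrow> G_manifold S"
  by (auto simp: regular_action_def regular_group_def regular_space_def regular_map_def
      G_manifold_def lie_group_def)

lemma regular_action_continuous: "regular_action False S \<longleftrightarrow> topological_G_space S"
  by (auto simp: regular_action_def regular_group_def regular_space_def regular_map_def
      topological_G_space_def topological_group_def)

lemma regular_torsor_smooth: "regular_torsor True S \<longleftrightarrow> torsor S"
  by (simp add: regular_torsor_def torsor_def regular_action_smooth)

lemma regular_torsor_continuous: "regular_torsor False S \<longleftrightarrow> topological_torsor S"
  by (simp add: regular_torsor_def topological_torsor_def regular_action_continuous)

lemma regular_hom_smooth: "regular_hom True S S' = tor_hom S S'"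
  by (simp add: regular_hom_def tor_hom_def regular_map_def)

lemma regular_hom_continuous: "regular_hom False S S' = toptor_hom S S'"
  by (simp add: regular_hom_def toptor_hom_def regular_map_def)

lemma Regular_Tor_smooth: "Regular_Tor True = Tor"
  by (simp add: Regular_Tor_def Tor_def regular_torsor_smooth regular_hom_smooth fun_eq_iff)

lemma Regular_Tor_continuous: "Regular_Tor False = TopTor"
  by (simp add: Regular_Tor_def TopTor_def regular_torsor_continuous regular_hom_continuous fun_eq_iff)

lemma G_manifold_regular_action: "G_manifold S \<Longrightarrow> regular_action s S"
  by (auto simp: regular_action_def regular_group_def regular_space_def smooth_map_regular
      G_manifold_def lie_group_def)

lemma tor_hom_regular: "\<alpha> \<in> tor_hom S S' \<Longrightarrow> \<alpha> \<in> regular_hom s S S'"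
  by (auto simp: regular_hom_def tor_hom_def intro: smooth_map_regular)

lemma regular_hom_funcset: "\<alpha> \<in> regular_hom s S S' \<Longrightarrow> \<alpha> \<in> pts S \<rightarrow> pts S'"
  by (auto simp: regular_hom_def dest!: regular_map_funcset)

lemma regular_hom_id:
  assumes "regular_action s S"
  shows "(\<lambda>f\<in>pts S. f) \<in> regular_hom s S S"
proof -
  interpret group_action "grp S" "pts S" "act S"
    using assms by (simp add: regular_action_def)
  have sp: "regular_space s (fmfd S)" "regular_space s (gmfd S)"
    using assms by (simp_all add: regular_action_def regular_group_def)
  have "equivariant S S (\<lambda>g. g) (\<lambda>f\<in>pts S. f)"
    using element_image by (auto simp: equivariant_def)
  moreover have "(\<lambda>g. g) \<in> hom (grp S) (grp S)"
    by (auto simp: hom_def)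
  moreover have "regular_map s (fmfd S) (fmfd S) (\<lambda>f\<in>pts S. f)"
    by (rule regular_map_cong[OF sp(1) sp(1) regular_map_id[OF sp(1)]]) simp
  ultimately show ?thesis
    using regular_map_id[OF sp(2)] by (auto simp: regular_hom_def)
qed

lemma regular_hom_compose:
  assumes S: "regular_action s S" and S': "regular_action s S'" and S'': "regular_action s S''"
    and \<alpha>: "\<alpha> \<in> regular_hom s S S'" and \<beta>: "\<beta> \<in> regular_hom s S' S''"
  shows "compose (pts S) \<beta> \<alpha> \<in> regular_hom s S S''"
proof -
  interpret group_action "grp S" "pts S" "act S"
    using S by (simp add: regular_action_def)
  have sp: "regular_space s (fmfd S)" "regular_space s (gmfd S)"
    "regular_space s (fmfd S')" "regular_space s (gmfd S')"
    "regular_space s (fmfd S'')" "regular_space s (gmfd S'')"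
    using S S' S'' by (simp_all add: regular_action_def regular_group_def)
  obtain \<xi> where \<xi>: "\<xi> \<in> hom (grp S) (grp S')" "regular_map s (gmfd S) (gmfd S') \<xi>" "equivariant S S' \<xi> \<alpha>"
    using \<alpha> by (auto simp: regular_hom_def)
  obtain \<zeta> where \<zeta>: "\<zeta> \<in> hom (grp S') (grp S'')" "regular_map s (gmfd S') (gmfd S'') \<zeta>" "equivariant S' S'' \<zeta> \<beta>"
    using \<beta> by (auto simp: regular_hom_def)
  have "regular_map s (fmfd S) (fmfd S'') (\<lambda>f. \<beta> (\<alpha> f))"
    using \<alpha> \<beta> by (intro regular_map_compose[OF sp(1,3,5)]) (auto simp: regular_hom_def)
  then have "regular_map s (fmfd S) (fmfd S'') (compose (pts S) \<beta> \<alpha>)"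
    by (rule regular_map_cong[OF sp(1,5)]) (simp add: compose_eq)
  moreover have "regular_map s (gmfd S) (gmfd S'') (\<lambda>g. \<zeta> (\<xi> g))"
    by (rule regular_map_compose[OF sp(2,4,6) \<xi>(2) \<zeta>(2)])
  moreover have "(\<lambda>g. \<zeta> (\<xi> g)) \<in> hom (grp S) (grp S'')"
    using \<xi>(1) \<zeta>(1) by (auto simp: hom_def Pi_iff)
  moreover have "equivariant S S'' (\<lambda>g. \<zeta> (\<xi> g)) (compose (pts S) \<beta> \<alpha>)"
    using \<xi>(1,3) \<zeta>(3) regular_hom_funcset[OF \<alpha>] element_image
    by (auto simp: equivariant_def compose_eq hom_def Pi_iff)
  ultimately show ?thesis
    by (auto simp: regular_hom_def)
qed

lemma is_category_Regular_Tor: "is_category (Regular_Tor s)"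
  unfolding is_category_def Regular_Tor_def cat.simps
proof (intro conjI ballI)
  fix S T :: "('a, 'b, 'c, 'd) gspace" and \<alpha>
  assume "\<alpha> \<in> regular_hom s S T"
  then have "\<alpha> \<in> pts S \<rightarrow> pts T" "\<alpha> \<in> extensional (pts S)"
    by (auto dest: regular_hom_funcset) (simp add: regular_hom_def)
  then show "compose (pts S) \<alpha> (\<lambda>f\<in>pts S. f) = \<alpha>" "compose (pts S) (\<lambda>f\<in>pts T. f) \<alpha> = \<alpha>"
    by (simp_all add: compose_Id Id_compose)
next
  fix S T U V :: "('a, 'b, 'c, 'd) gspace" and \<alpha> \<beta> \<gamma>
  assume "\<alpha> \<in> regular_hom s S T"
  then show "compose (pts S) \<gamma> (compose (pts S) \<beta> \<alpha>) = compose (pts S) (compose (pts T) \<gamma> \<beta>) \<alpha>"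
    by (intro compose_assoc regular_hom_funcset)
qed (auto simp: regular_torsor_def intro: regular_hom_id regular_hom_compose)

section \<open>Free actions and their frames\<close>

locale free_gspace =
  fixes S :: "('g, 'f, 'i, 'j) gspace"
  assumes group_action: "group_action (grp S) (pts S) (act S)" and free: "free_act S"
begin

sublocale group_action "grp S" "pts S" "act S"
  by (rule group_action)

sublocale group "grp S"
  using group_hom by (rule group_hom.axioms)

lemma act_closed: "g \<in> carrier (grp S) \<Longrightarrow> f \<in> pts S \<Longrightarrow> act S g f \<in> pts S"
  using element_image by blast

lemma act_one: "f \<in> pts S \<Longrightarrow> act S \<one>\<^bsub>grp S\<^esub> f = f"
  using id_eq_one by (metis restrict_apply')

lemma orb_eq_iff:
  assumes "f \<in> pts S" "f' \<in> pts S"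
  shows "orb S f = orb S f' \<longleftrightarrow> (\<exists>g\<in>carrier (grp S). act S g f = f')"
proof
  assume "orb S f = orb S f'"
  then have "f' \<in> orb S f"
    using orbit_refl[OF assms(2)] by simp
  then show "\<exists>g\<in>carrier (grp S). act S g f = f'"
    by (auto simp: orbit_def)
next
  assume "\<exists>g\<in>carrier (grp S). act S g f = f'"
  then have "f' \<in> orb S f" by (auto simp: orbit_def)
  then have "f' \<in> orb S f \<inter> orb S f'"
    using orbit_refl[OF assms(2)] by simp
  then show "orb S f = orb S f'"
    using disjoint_union[of "orb S f" "orb S f'"] assms by (auto simp: orbits_def)
qed

lemma orb_act: "g \<in> carrier (grp S) \<Longrightarrow> f \<in> pts S \<Longrightarrow> orb S (act S g f) = orb S f"
  using orb_eq_iff[of f "act S g f"] act_closed by blast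

lemma act_cancel:
  assumes "g \<in> carrier (grp S)" "h \<in> carrier (grp S)" "f \<in> pts S" "act S g f = act S h f"
  shows "g = h"
proof -
  have "act S (inv\<^bsub>grp S\<^esub> h \<otimes>\<^bsub>grp S\<^esub> g) f = act S (inv\<^bsub>grp S\<^esub> h) (act S h f)"
    using assms by (simp add: composition_rule)
  also have "\<dots> = f"
    using assms orbit_sym_aux by blast
  finally have "inv\<^bsub>grp S\<^esub> h \<otimes>\<^bsub>grp S\<^esub> g = \<one>\<^bsub>grp S\<^esub>"
    using free assms unfolding free_act_def by blast
  then show ?thesis
    using assms by (metis inv_equality inv_inv inv_closed)
qed

text \<open>
  Injectivity of \<open>(g, x) \<mapsto> g f(x)\<close> separates into injectivity on orbits and freeness within an orbit;
  its surjectivity says that every orbit contains some \<open>f(x)\<close>.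
\<close>

lemma frames_iff:
  "f \<in> frames X S \<longleftrightarrow> f \<in> X \<rightarrow>\<^sub>E pts S \<and> bij_betw (\<lambda>x. orb S (f x)) X (orbs S)"
proof (cases "f \<in> X \<rightarrow>\<^sub>E pts S")
  case True
  let ?\<phi> = "\<lambda>(g, x). act S g (f x)"
  have f: "f x \<in> pts S" if "x \<in> X" for x
    using True that by auto
  have equiv: "?\<phi> (g \<otimes>\<^bsub>grp S\<^esub> h, x) = act S g (?\<phi> (h, x))"
    if "g \<in> carrier (grp S)" "h \<in> carrier (grp S)" "x \<in> X" for g h x
    using that f by (simp add: composition_rule)
  have "bij_betw ?\<phi> (carrier (grp S) \<times> X) (pts S) \<longleftrightarrow> bij_betw (\<lambda>x. orb S (f x)) X (orbs S)"
  proof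
    assume L: "bij_betw ?\<phi> (carrier (grp S) \<times> X) (pts S)"
    show "bij_betw (\<lambda>x. orb S (f x)) X (orbs S)"
    proof (rule bij_betw_imageI)
      show "inj_on (\<lambda>x. orb S (f x)) X"
      proof (rule inj_onI)
        fix x y assume xy: "x \<in> X" "y \<in> X" "orb S (f x) = orb S (f y)"
        then obtain g where g: "g \<in> carrier (grp S)" "act S g (f x) = f y"
          using orb_eq_iff f by blast
        then have "?\<phi> (g, x) = ?\<phi> (\<one>\<^bsub>grp S\<^esub>, y)"
          using act_one f xy by simp
        then have "(g, x) = (\<one>\<^bsub>grp S\<^esub>, y)"
          using inj_onD[OF bij_betw_imp_inj_on[OF L]] g xy by blast
        then show "x = y" by simp
      qed
      show "(\<lambda>x. orb S (f x)) ` X = orbs S"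
      proof (intro equalityI subsetI)
        fix \<Omega> assume "\<Omega> \<in> orbs S"
        then obtain p where p: "\<Omega> = orb S p" "p \<in> pts S" by (auto simp: orbits_def)
        then have "p \<in> ?\<phi> ` (carrier (grp S) \<times> X)"
          using bij_betw_imp_surj_on[OF L] by simp
        then obtain g x where "g \<in> carrier (grp S)" "x \<in> X" "p = act S g (f x)"
          by auto
        then show "\<Omega> \<in> (\<lambda>x. orb S (f x)) ` X"
          using p orb_act f by auto
      qed (use f in \<open>auto simp: orbits_def\<close>)
    qed
  next
    assume R: "bij_betw (\<lambda>x. orb S (f x)) X (orbs S)"
    show "bij_betw ?\<phi> (carrier (grp S) \<times> X) (pts S)"
    proof (rule bij_betw_imageI)
      show "inj_on ?\<phi> (carrier (grp S) \<times> X)"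
      proof (rule inj_onI, clarify)
        fix g h x y
        assume gh: "g \<in> carrier (grp S)" "h \<in> carrier (grp S)" and xy: "x \<in> X" "y \<in> X"
          and eq: "act S g (f x) = act S h (f y)"
        have "orb S (f x) = orb S (f y)"
          using orb_act[OF gh(1) f[OF xy(1)]] orb_act[OF gh(2) f[OF xy(2)]] eq by simp
        then have "x = y"
          using inj_onD[OF bij_betw_imp_inj_on[OF R]] xy by blast
        then show "g = h \<and> x = y"
          using act_cancel[OF gh f[OF xy(1)]] eq by simp
      qed
      show "?\<phi> ` (carrier (grp S) \<times> X) = pts S"
      proof (intro equalityI subsetI)
        fix p assume p: "p \<in> pts S"
        then have "orb S p \<in> (\<lambda>x. orb S (f x)) ` X"
          using bij_betw_imp_surj_on[OF R] by (auto simp: orbits_def)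
        then obtain x where x: "x \<in> X" "orb S (f x) = orb S p" by auto
        then obtain g where "g \<in> carrier (grp S)" "act S g (f x) = p"
          using orb_eq_iff[OF f[OF x(1)] p] by blast
        then show "p \<in> ?\<phi> ` (carrier (grp S) \<times> X)"
          using x(1) by (intro image_eqI[of _ _ "(g, x)"]) auto
      qed (use act_closed f in auto)
    qed
  qed
  then show ?thesis
    using True equiv by (auto simp: frames_def gset_iso_def)
qed (simp add: frames_def)

lemma frames_nonempty:
  assumes "X \<approx> orbs S"
  shows "frames X S \<noteq> {}"
proof -
  obtain b where b: "bij_betw b X (orbs S)"
    using assms by (auto simp: eqpoll_def)
  have "\<forall>x\<in>X. \<exists>p. p \<in> pts S \<and> orb S p = b x"
    using bij_betwE[OF b] by (fastforce simp: orbits_def)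
  from bchoice[OF this] obtain f where f: "\<forall>x\<in>X. f x \<in> pts S \<and> orb S (f x) = b x" ..
  have "bij_betw (\<lambda>x. orb S (restrict f X x)) X (orbs S)"
    using f by (subst bij_betw_cong[of _ _ b]) (auto simp: b)
  then have "restrict f X \<in> frames X S"
    using f by (simp add: frames_iff)
  then show ?thesis by blast
qed

text \<open>
  Moving each \<open>f(x)\<close> within its orbit turns a frame into a frame, and orbits are open.
\<close>

lemma frames_open:
  assumes orbits: "discrete_orbit_space S" and X: "finite X"
  shows "openin (product_topology (\<lambda>_. mtop (fmfd S)) X) (frames X S)"
proof (subst openin_subopen, intro ballI)
  fix f assume f: "f \<in> frames X S"
  then have fX: "f x \<in> pts S" if "x \<in> X" for x
    using that by (auto simp: frames_iff)
  let ?U = "\<Pi>\<^sub>E x\<in>X. orb S (f x)"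
  have orb_open: "openin (mtop (fmfd S)) (orb S p)" if p: "p \<in> pts S" for p
  proof -
    have "orb S p = {q \<in> pts S. orb S q \<in> {orb S p}}"
    proof (intro equalityI subsetI)
      fix q assume "q \<in> orb S p"
      then obtain g where "g \<in> carrier (grp S)" "q = act S g p" by (auto simp: orbit_def)
      then show "q \<in> {q \<in> pts S. orb S q \<in> {orb S p}}"
        using p by (simp add: act_closed orb_act)
    qed (use orbit_refl in auto)
    moreover have "openin (mtop (fmfd S)) {q \<in> pts S. orb S q \<in> {orb S p}}"
      using orbits p unfolding discrete_orbit_space_def
      by (intro openin_continuous_map_preimage[OF quotient_imp_continuous_map]) (auto simp: orbits_def)
    ultimately show ?thesis by (simp only:)
  qed
  have "openin (product_topology (\<lambda>_. mtop (fmfd S)) X) ?U"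
    using X orb_open fX by (simp add: openin_PiE)
  moreover have "f \<in> ?U"
    using f orbit_refl fX by (auto simp: frames_iff PiE_iff)
  moreover have "?U \<subseteq> frames X S"
  proof
    fix f' assume f': "f' \<in> ?U"
    have *: "f' x \<in> pts S \<and> orb S (f' x) = orb S (f x)" if "x \<in> X" for x
    proof -
      have "f' x \<in> orb S (f x)" using f' that by auto
      then obtain g where "g \<in> carrier (grp S)" "f' x = act S g (f x)"
        by (auto simp: orbit_def)
      then show ?thesis using orb_act act_closed fX[OF that] by simp
    qed
    have "bij_betw (\<lambda>x. orb S (f' x)) X (orbs S)"
      using f * by (subst bij_betw_cong[of _ _ "\<lambda>x. orb S (f x)"]) (auto simp: frames_iff)
    then show "f' \<in> frames X S"
      using f' * by (auto simp: frames_iff PiE_iff)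
  qed
  ultimately show "\<exists>T. openin (product_topology (\<lambda>_. mtop (fmfd S)) X) T \<and> f \<in> T \<and> T \<subseteq> frames X S"
    by blast
qed

end

section \<open>The wreath product\<close>

lemma Bij_permutation:
  assumes "\<sigma> \<in> Bij X" "x \<in> X"
  shows "\<sigma> x \<in> X" "inv_into X \<sigma> x \<in> X" "\<sigma> (inv_into X \<sigma> x) = x" "inv_into X \<sigma> (\<sigma> x) = x"
  using assms by (auto simp: Bij_def bij_betw_def f_inv_into_f inv_into_into)

lemma Bij_inv_into_eqI: "\<sigma> \<in> Bij X \<Longrightarrow> y \<in> X \<Longrightarrow> \<sigma> y = x \<Longrightarrow> inv_into X \<sigma> x = y"
  by (auto simp: Bij_permutation)

lemma Bij_inv_into_compose:
  assumes "\<sigma> \<in> Bij X" "\<tau> \<in> Bij X" "x \<in> X"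
  shows "inv_into X (compose X \<sigma> \<tau>) x = inv_into X \<tau> (inv_into X \<sigma> x)"
  using assms by (intro Bij_inv_into_eqI) (auto simp: compose_Bij compose_eq Bij_permutation)

lemma Bij_inv_into_id: "x \<in> X \<Longrightarrow> inv_into X (\<lambda>x\<in>X. x) x = x"
  by (rule Bij_inv_into_eqI[OF id_Bij]) auto

lemma Bij_inv_into_inv: "\<sigma> \<in> Bij X \<Longrightarrow> x \<in> X \<Longrightarrow> inv_into X (\<lambda>x\<in>X. inv_into X \<sigma> x) x = \<sigma> x"
  by (rule Bij_inv_into_eqI[OF restrict_inv_into_Bij]) (auto simp: Bij_permutation)

lemma Bij_eqI: "\<sigma> \<in> Bij X \<Longrightarrow> \<tau> \<in> Bij X \<Longrightarrow> (\<And>x. x \<in> X \<Longrightarrow> \<sigma> x = \<tau> x) \<Longrightarrow> \<sigma> = \<tau>"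
  by (rule extensionalityI[of _ X]) (auto simp: Bij_def)

lemma wreath_simps [simp]:
  "carrier (wreath G X) = (X \<rightarrow>\<^sub>E carrier G) \<times> Bij X"
  "(g, \<sigma>) \<otimes>\<^bsub>wreath G X\<^esub> (g', \<sigma>') = (\<lambda>x\<in>X. g x \<otimes>\<^bsub>G\<^esub> g' (inv_into X \<sigma> x), compose X \<sigma> \<sigma>')"
  "\<one>\<^bsub>wreath G X\<^esub> = (\<lambda>x\<in>X. \<one>\<^bsub>G\<^esub>, \<lambda>x\<in>X. x)"
  by (simp_all add: wreath_def)

definition wreath_inv :: "'g monoid \<Rightarrow> 'x set \<Rightarrow> ('x \<Rightarrow> 'g) \<times> ('x \<Rightarrow> 'x) \<Rightarrow> ('x \<Rightarrow> 'g) \<times> ('x \<Rightarrow> 'x)" where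
  "wreath_inv G X = (\<lambda>(g, \<sigma>). (\<lambda>x\<in>X. inv\<^bsub>G\<^esub> g (\<sigma> x), \<lambda>x\<in>X. inv_into X \<sigma> x))"

context
  fixes G :: "'g monoid" (structure)
  assumes group: "group G"
begin

interpretation group G by (rule group)

lemma wreath_inv_closed: "h \<in> carrier (wreath G X) \<Longrightarrow> wreath_inv G X h \<in> carrier (wreath G X)"
  by (auto simp: wreath_inv_def intro!: restrict_inv_into_Bij inv_closed dest: Bij_permutation(1))

lemma wreath_l_inv:
  assumes "h \<in> carrier (wreath G X)"
  shows "wreath_inv G X h \<otimes>\<^bsub>wreath G X\<^esub> h = \<one>\<^bsub>wreath G X\<^esub>"
proof -
  obtain g \<sigma> where h: "h = (g, \<sigma>)" "g \<in> X \<rightarrow>\<^sub>E carrier G" "\<sigma> \<in> Bij X"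
    using assms by auto
  have "inv (g (\<sigma> x)) \<otimes> g (\<sigma> x) = \<one>" if "x \<in> X" for x
    using h Bij_permutation(1)[OF h(3) that] by (intro l_inv) auto
  then show ?thesis
    using h(3) by (auto simp: h(1) wreath_inv_def Bij_inv_into_inv Bij_permutation compose_def
        intro!: restrict_ext)
qed

lemma group_wreath: "group (wreath G X)"
proof (rule groupI)
  fix h k assume "h \<in> carrier (wreath G X)" "k \<in> carrier (wreath G X)"
  then show "h \<otimes>\<^bsub>wreath G X\<^esub> k \<in> carrier (wreath G X)"
    by (auto simp: compose_Bij Bij_permutation PiE_iff)
next
  show "\<one>\<^bsub>wreath G X\<^esub> \<in> carrier (wreath G X)"
    by (simp add: id_Bij)
next
  fix h k l
  assume "h \<in> carrier (wreath G X)" "k \<in> carrier (wreath G X)" "l \<in> carrier (wreath G X)"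
  then obtain f \<rho> g \<sigma> e \<tau> where hkl: "h = (f, \<rho>)" "k = (g, \<sigma>)" "l = (e, \<tau>)"
    "\<rho> \<in> Bij X" "\<sigma> \<in> Bij X" "\<tau> \<in> Bij X"
    "f \<in> X \<rightarrow>\<^sub>E carrier G" "g \<in> X \<rightarrow>\<^sub>E carrier G" "e \<in> X \<rightarrow>\<^sub>E carrier G"
    by (cases h; cases k; cases l) auto
  have mem: "f x \<in> carrier G" "g x \<in> carrier G" "e x \<in> carrier G" if "x \<in> X" for x
    using hkl that by auto
  show "h \<otimes>\<^bsub>wreath G X\<^esub> k \<otimes>\<^bsub>wreath G X\<^esub> l = h \<otimes>\<^bsub>wreath G X\<^esub> (k \<otimes>\<^bsub>wreath G X\<^esub> l)"
    unfolding hkl(1-3) wreath_simps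
  proof (intro arg_cong2[where f = Pair] restrict_ext)
    fix x assume x: "x \<in> X"
    then have "inv_into X \<rho> x \<in> X" "inv_into X \<sigma> (inv_into X \<rho> x) \<in> X"
      using hkl(4,5) Bij_permutation(2) by metis+
    then show "(\<lambda>x\<in>X. f x \<otimes> g (inv_into X \<rho> x)) x \<otimes> e (inv_into X (compose X \<rho> \<sigma>) x) =
        f x \<otimes> (\<lambda>x\<in>X. g x \<otimes> e (inv_into X \<sigma> x)) (inv_into X \<rho> x)"
      using x mem hkl(4,5) by (simp add: Bij_inv_into_compose m_assoc)
  next
    show "compose X (compose X \<rho> \<sigma>) \<tau> = compose X \<rho> (compose X \<sigma> \<tau>)"
      using compose_assoc[OF Bij_imp_funcset[OF hkl(6)], of \<rho> \<sigma>] by simp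
  qed
next
  fix h assume "h \<in> carrier (wreath G X)"
  then obtain g \<sigma> where h: "h = (g, \<sigma>)" "g \<in> X \<rightarrow>\<^sub>E carrier G" "\<sigma> \<in> Bij X"
    by auto
  have "(\<lambda>x\<in>X. (\<lambda>x\<in>X. \<one>) x \<otimes> g (inv_into X (\<lambda>x\<in>X. x) x)) = g"
  proof (rule extensionalityI[of _ X])
    fix x assume "x \<in> X"
    then show "(\<lambda>x\<in>X. (\<lambda>x\<in>X. \<one>) x \<otimes> g (inv_into X (\<lambda>x\<in>X. x) x)) x = g x"
      using l_one[OF PiE_mem[OF h(2)]] by (simp add: Bij_inv_into_id)
  qed (use h(2) in \<open>auto simp: PiE_def\<close>)
  moreover have "compose X (\<lambda>x\<in>X. x) \<sigma> = \<sigma>"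
    using h(3) by (intro Id_compose Bij_imp_funcset Bij_imp_extensional)
  ultimately show "\<one>\<^bsub>wreath G X\<^esub> \<otimes>\<^bsub>wreath G X\<^esub> h = h"
    by (simp add: h(1))
next
  fix h assume h: "h \<in> carrier (wreath G X)"
  show "\<exists>k\<in>carrier (wreath G X). k \<otimes>\<^bsub>wreath G X\<^esub> h = \<one>\<^bsub>wreath G X\<^esub>"
    using wreath_inv_closed[OF h] wreath_l_inv[OF h] by blast
qed

lemma inv_wreath:
  assumes "h \<in> carrier (wreath G X)"
  shows "inv\<^bsub>wreath G X\<^esub> h = wreath_inv G X h"
  by (rule group.inv_equality[OF group_wreath wreath_l_inv[OF assms] assms wreath_inv_closed[OF assms]])

end

lemma topspace_sym_topology [simp]: "topspace (sym_topology X) = Bij X"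
  by (auto simp: sym_topology_def Bij_def bij_betw_def PiE_def)

lemma continuous_map_permutation_value:
  assumes "x \<in> X"
  shows "continuous_map (sym_topology X) (discrete_topology X) (\<lambda>\<sigma>. \<sigma> x)"
  unfolding sym_topology_def
  by (rule continuous_map_from_subtopology[OF continuous_map_product_coordinates[OF assms]])

lemma openin_permutation_value:
  assumes "x \<in> X"
  shows "openin (sym_topology X) {\<sigma> \<in> Bij X. \<sigma> x = y}"
proof (cases "y \<in> X")
  case True
  then show ?thesis
    using openin_continuous_map_preimage[OF continuous_map_permutation_value[OF assms], of "{y}"] by simp
next
  case False
  then have "{\<sigma> \<in> Bij X. \<sigma> x = y} = {}"
    using Bij_permutation(1)[OF _ assms] by auto
  then show ?thesis by (simp only: openin_empty)
qed

text \<open>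
  The topology of \<open>Sym(X)\<close> is determined by the values at the points of \<open>X\<close>. These lie in a discrete
  space, and locally constant maps into it are continuous.
\<close>

lemma continuous_map_into_sym_topology:
  assumes "f \<in> topspace T \<rightarrow> Bij X"
    and "\<And>x p. x \<in> X \<Longrightarrow> p \<in> topspace T \<Longrightarrow> \<exists>W. openin T W \<and> p \<in> W \<and> (\<forall>q\<in>W. f q x = f p x)"
  shows "continuous_map T (sym_topology X) f"
  unfolding sym_topology_def
proof (rule continuous_map_into_subtopology)
  show "continuous_map T (product_topology (\<lambda>_. discrete_topology X) X) f"
    unfolding continuous_map_componentwise
  proof (intro conjI ballI)
    show "f ` topspace T \<subseteq> extensional X"
      using assms(1) by (auto simp: Bij_def)
    fix x assume x: "x \<in> X"
    show "continuous_map T (discrete_topology X) (\<lambda>p. f p x)"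
    proof (rule continuous_map_local)
      fix p assume p: "p \<in> topspace T"
      from assms(2)[OF x p] obtain W where W: "openin T W" "p \<in> W" "\<forall>q\<in>W. f q x = f p x" by blast
      have "f p x \<in> X"
        using Bij_permutation(1)[OF funcset_mem[OF assms(1) p] x] .
      then have "continuous_map (subtopology T W) (discrete_topology X) (\<lambda>q. f p x)"
        by simp
      then show "\<exists>W g. openin T W \<and> p \<in> W \<and> continuous_map (subtopology T W) (discrete_topology X) g \<and>
          (\<forall>q\<in>W. f q x = g q)"
        using W by (intro exI[of _ W] exI[of _ "\<lambda>q. f p x"] conjI)
    qed
  qed
qed (use assms(1) in auto)

lemma sym_topology_finite:
  assumes "finite X"
  shows "sym_topology X = discrete_topology (Bij X)"
proof -
  have "openin (sym_topology X) {\<sigma>}" if "\<sigma> \<in> Bij X" for \<sigma>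
  proof -
    have "{\<sigma>} = Bij X \<inter> (\<Inter>x\<in>X. {\<tau> \<in> Bij X. \<tau> x = \<sigma> x})"
      using that by (auto intro: Bij_eqI)
    moreover have "openin (sym_topology X) (Bij X \<inter> (\<Inter>x\<in>X. {\<tau> \<in> Bij X. \<tau> x = \<sigma> x}))"
    proof (cases "X = {}")
      case True
      then show ?thesis using openin_topspace[of "sym_topology X"] by simp
    next
      case False
      then show ?thesis
        using assms openin_topspace[of "sym_topology X"]
        by (intro openin_Int openin_INT2 openin_permutation_value) auto
    qed
    ultimately show ?thesis by simp
  qed
  then show ?thesis
    using discrete_topology_unique[of "Bij X" "sym_topology X"] by simp
qed

text \<open>
  For finite \<open>X\<close> the symmetric group is a finite discrete space, hence a \<open>0\<close>-dimensional manifold.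
\<close>

lemma regular_space_sym:
  assumes "s \<Longrightarrow> finite X"
  shows "regular_space s (points_mfd (sym_topology X))"
  unfolding regular_space_def
proof
  assume s
  then have X: "finite X" by (rule assms)
  have "Bij X \<subseteq> X \<rightarrow>\<^sub>E X"
    by (auto simp: Bij_def bij_betw_def PiE_def)
  then have "finite (Bij X)"
    using X finite_PiE finite_subset by metis
  then show "smooth_manifold (points_mfd (sym_topology X))"
    unfolding sym_topology_finite[OF X] by (intro smooth_manifold_points_mfd countable_finite)
qed

lemma mtop_wreath_mfd:
  "mtop (wreath_mfd M X) = prod_topology (product_topology (\<lambda>_. mtop M) X) (sym_topology X)"
  by (simp add: wreath_mfd_def)

locale wreath_group =
  fixes s :: bool and G :: "'g monoid" and M :: "('g, 'i) mfd" and X :: "'x set"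
  assumes regular_group: "regular_group s G M" and index_finite: "s \<Longrightarrow> finite X"
begin

sublocale group G
  using regular_group by (simp add: regular_group_def)

abbreviation "W \<equiv> wreath_mfd M X"

lemma space_M: "regular_space s M" and topspace_M: "topspace (mtop M) = carrier G"
  and mult_M: "regular_map s (prod_mfd M M) M (\<lambda>(g, h). g \<otimes>\<^bsub>G\<^esub> h)"
  and inv_M: "regular_map s M M (\<lambda>g. inv\<^bsub>G\<^esub> g)"
  using regular_group by (simp_all add: regular_group_def)

lemma space_power: "regular_space s (power_mfd X M)"
  by (rule regular_space_power[OF index_finite space_M])

lemma space_sym: "regular_space s (points_mfd (sym_topology X))"
  by (rule regular_space_sym[OF index_finite])

lemma space_W: "regular_space s W"
  unfolding wreath_mfd_def by (rule regular_space_prod[OF space_power space_sym])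

lemma topspace_W: "topspace (mtop W) = carrier (wreath G X)"
  by (simp add: mtop_wreath_mfd topspace_M)

lemma regular_map_value:
  assumes "x \<in> X"
  shows "regular_map s W M (\<lambda>h. fst h x)"
  using regular_map_compose[OF space_W space_power space_M regular_map_fst[OF space_power space_sym, folded wreath_mfd_def]
      regular_map_power_coordinate[OF index_finite space_M assms]] by simp

lemma continuous_map_permutation: "continuous_map (mtop W) (sym_topology X) snd"
  by (simp add: mtop_wreath_mfd continuous_map_snd)

lemma regular_map_into_W:
  assumes "\<And>x. x \<in> X \<Longrightarrow> regular_map s P M (f x)" "continuous_map (mtop P) (sym_topology X) t"
  shows "regular_map s P W (\<lambda>p. (\<lambda>x\<in>X. f x p, t p))"
  unfolding wreath_mfd_def
  by (rule regular_map_pair[OF regular_map_tuple[OF assms(1)] regular_map_into_points[OF assms(2)]])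

lemma permutation_locally_constant:
  assumes t: "continuous_map T (sym_topology X) t" and z: "z \<in> X" and p: "p \<in> topspace T"
  shows "\<exists>V. openin T V \<and> p \<in> V \<and> (\<forall>q\<in>V. q \<in> topspace T \<and> t q z = t p z)"
proof -
  have "openin T {q \<in> topspace T. t q \<in> {\<sigma> \<in> Bij X. \<sigma> z = t p z}}"
    by (rule openin_continuous_map_preimage[OF t openin_permutation_value[OF z]])
  moreover have "t p \<in> Bij X"
    using continuous_map_funspace[OF t] p by auto
  ultimately show ?thesis
    using p by (intro exI[of _ "{q \<in> topspace T. t q \<in> {\<sigma> \<in> Bij X. \<sigma> z = t p z}}"]) auto
qed

text \<open>
  With \<open>z = \<sigma>\<^sup>-\<^sup>1 x\<close>, the permutations \<open>\<tau>\<close> such that \<open>\<tau> z = x\<close> form an open set, and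
  \<open>\<tau>\<^sup>-\<^sup>1 x = z\<close> for all of them.
\<close>

lemma inv_permutation_locally_constant:
  assumes t: "continuous_map T (sym_topology X) t" and x: "x \<in> X" and p: "p \<in> topspace T"
  shows "\<exists>V. openin T V \<and> p \<in> V \<and> (\<forall>q\<in>V. q \<in> topspace T \<and> inv_into X (t q) x = inv_into X (t p) x)"
proof -
  have tB: "t q \<in> Bij X" if "q \<in> topspace T" for q
    using continuous_map_funspace[OF t] that by auto
  let ?z = "inv_into X (t p) x"
  have z: "?z \<in> X" "t p ?z = x"
    using Bij_permutation(2,3)[OF tB[OF p] x] by auto
  obtain V where V: "openin T V" "p \<in> V" "\<forall>q\<in>V. q \<in> topspace T \<and> t q ?z = t p ?z"
    using permutation_locally_constant[OF t z(1) p] by blast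
  have "inv_into X (t q) x = ?z" if "q \<in> V" for q
  proof (rule Bij_inv_into_eqI[OF tB z(1)])
    show "q \<in> topspace T" "t q ?z = x"
      using V(3) that z(2) by auto
  qed
  with V show ?thesis by (intro exI[of _ V] conjI ballI) blast+
qed

lemma wreath_mult_regular: "regular_map s (prod_mfd W W) W (\<lambda>(h, k). h \<otimes>\<^bsub>wreath G X\<^esub> k)"
proof -
  let ?P = "prod_mfd W W"
  have P: "regular_space s ?P" by (rule regular_space_prod[OF space_W space_W])
  have fst: "regular_map s ?P W fst" and snd: "regular_map s ?P W snd"
    by (rule regular_map_fst[OF space_W space_W] regular_map_snd[OF space_W space_W])+
  have t1: "continuous_map (mtop ?P) (sym_topology X) (\<lambda>p. snd (fst p))"
    and t2: "continuous_map (mtop ?P) (sym_topology X) (\<lambda>p. snd (snd p))"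
    using continuous_map_compose[OF regular_map_continuous[OF fst] continuous_map_permutation]
      continuous_map_compose[OF regular_map_continuous[OF snd] continuous_map_permutation]
    by (simp_all only: o_def)
  have B: "snd (fst p) \<in> Bij X" "snd (snd p) \<in> Bij X" if "p \<in> topspace (mtop ?P)" for p
    using continuous_map_funspace[OF t1] continuous_map_funspace[OF t2] that by auto
  have mult: "regular_map s ?P M (\<lambda>p. fst (fst p) x \<otimes>\<^bsub>G\<^esub> fst (snd p) z)" if "x \<in> X" "z \<in> X" for x z
  proof -
    have "regular_map s ?P (prod_mfd M M) (\<lambda>p. (fst (fst p) x, fst (snd p) z))"
      by (rule regular_map_pair[OF regular_map_compose[OF P space_W space_M fst regular_map_value[OF that(1)]]
            regular_map_compose[OF P space_W space_M snd regular_map_value[OF that(2)]]])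
    from regular_map_compose[OF P regular_space_prod[OF space_M space_M] space_M this mult_M]
    show ?thesis by simp
  qed
  have comp: "regular_map s ?P M (\<lambda>p. fst (fst p) x \<otimes>\<^bsub>G\<^esub> fst (snd p) (inv_into X (snd (fst p)) x))"
    if x: "x \<in> X" for x
  proof (rule regular_map_local[OF P space_M])
    fix p assume p: "p \<in> topspace (mtop ?P)"
    obtain V where V: "openin (mtop ?P) V" "p \<in> V"
      "\<forall>q\<in>V. q \<in> topspace (mtop ?P) \<and> inv_into X (snd (fst q)) x = inv_into X (snd (fst p)) x"
      using inv_permutation_locally_constant[OF t1 x p] by blast
    have "inv_into X (snd (fst p)) x \<in> X"
      by (rule Bij_permutation(2)[OF B(1)[OF p] x])
    from mult[OF x this]
    show "\<exists>V g. openin (mtop ?P) V \<and> p \<in> V \<and> regular_map s ?P M g \<and>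
        (\<forall>q\<in>V. fst (fst q) x \<otimes>\<^bsub>G\<^esub> fst (snd q) (inv_into X (snd (fst q)) x) = g q)"
    proof (intro exI conjI ballI)
      fix q assume "q \<in> V"
      with V(3) have eq: "inv_into X (snd (fst q)) x = inv_into X (snd (fst p)) x" by blast
      show "fst (fst q) x \<otimes>\<^bsub>G\<^esub> fst (snd q) (inv_into X (snd (fst q)) x) =
          fst (fst q) x \<otimes>\<^bsub>G\<^esub> fst (snd q) (inv_into X (snd (fst p)) x)"
        unfolding eq ..
    qed (rule V(1) V(2) | assumption)+
  qed
  have perm: "continuous_map (mtop ?P) (sym_topology X) (\<lambda>p. compose X (snd (fst p)) (snd (snd p)))"
  proof (rule continuous_map_into_sym_topology)
    fix x p assume x: "x \<in> X" and p: "p \<in> topspace (mtop ?P)"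
    obtain V where V: "openin (mtop ?P) V" "p \<in> V" "\<forall>q\<in>V. snd (snd q) x = snd (snd p) x"
      using permutation_locally_constant[OF t2 x p] by blast
    have "snd (snd p) x \<in> X" by (rule Bij_permutation(1)[OF B(2)[OF p] x])
    from permutation_locally_constant[OF t1 this p]
    obtain V' where V': "openin (mtop ?P) V'" "p \<in> V'"
      "\<forall>q\<in>V'. snd (fst q) (snd (snd p) x) = snd (fst p) (snd (snd p) x)"
      by blast
    show "\<exists>V. openin (mtop ?P) V \<and> p \<in> V \<and>
        (\<forall>q\<in>V. compose X (snd (fst q)) (snd (snd q)) x = compose X (snd (fst p)) (snd (snd p)) x)"
    proof (intro exI[of _ "V \<inter> V'"] conjI ballI)
      fix q assume "q \<in> V \<inter> V'"
      then have eq: "snd (snd q) x = snd (snd p) x" "snd (fst q) (snd (snd p) x) = snd (fst p) (snd (snd p) x)"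
        using V(3) V'(3) by blast+
      show "compose X (snd (fst q)) (snd (snd q)) x = compose X (snd (fst p)) (snd (snd p)) x"
        unfolding compose_eq[OF x] eq ..
    qed (use V(1,2) V'(1,2) in auto)
  qed (use B in \<open>auto intro!: compose_Bij simp del: prod_mfd_simps\<close>)
  show ?thesis
    by (rule regular_map_cong[OF P space_W regular_map_into_W[OF comp perm]])
       (auto simp: case_prod_unfold wreath_def)
qed

lemma wreath_inv_regular: "regular_map s W W (\<lambda>h. inv\<^bsub>wreath G X\<^esub> h)"
proof -
  note t = continuous_map_permutation
  have B: "snd h \<in> Bij X" if "h \<in> topspace (mtop W)" for h
    using that by (auto simp: topspace_W)
  have comp: "regular_map s W M (\<lambda>h. inv\<^bsub>G\<^esub> (fst h (snd h x)))" if x: "x \<in> X" for x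
  proof (rule regular_map_local[OF space_W space_M])
    fix h assume h: "h \<in> topspace (mtop W)"
    obtain V where V: "openin (mtop W) V" "h \<in> V" "\<forall>k\<in>V. snd k x = snd h x"
      using permutation_locally_constant[OF t x h] by blast
    have "snd h x \<in> X" by (rule Bij_permutation(1)[OF B[OF h] x])
    from regular_map_compose[OF space_W space_M space_M regular_map_value[OF this] inv_M]
    show "\<exists>V g. openin (mtop W) V \<and> h \<in> V \<and> regular_map s W M g \<and>
        (\<forall>k\<in>V. inv\<^bsub>G\<^esub> (fst k (snd k x)) = g k)"
    proof (intro exI conjI ballI)
      fix k assume "k \<in> V"
      with V(3) have eq: "snd k x = snd h x" by blast
      show "inv\<^bsub>G\<^esub> (fst k (snd k x)) = inv\<^bsub>G\<^esub> (fst k (snd h x))"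
        unfolding eq ..
    qed (rule V(1) V(2) | assumption)+
  qed
  have perm: "continuous_map (mtop W) (sym_topology X) (\<lambda>h. \<lambda>x\<in>X. inv_into X (snd h) x)"
  proof (rule continuous_map_into_sym_topology)
    fix x h assume x: "x \<in> X" and h: "h \<in> topspace (mtop W)"
    show "\<exists>V. openin (mtop W) V \<and> h \<in> V \<and>
        (\<forall>k\<in>V. (\<lambda>x\<in>X. inv_into X (snd k) x) x = (\<lambda>x\<in>X. inv_into X (snd h) x) x)"
      using inv_permutation_locally_constant[OF t x h] unfolding restrict_apply'[OF x] by blast
  qed (use B in \<open>auto intro!: restrict_inv_into_Bij\<close>)
  show ?thesis
    by (rule regular_map_cong[OF space_W space_W regular_map_into_W[OF comp perm]])
       (auto simp: topspace_W inv_wreath[OF is_group] wreath_inv_def simp del: wreath_simps(1) split: prod.splits)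
qed

lemma regular_group_wreath: "regular_group s (wreath G X) W"
  unfolding regular_group_def
  using group_wreath[OF is_group] space_W topspace_W wreath_mult_regular wreath_inv_regular by blast

end

section \<open>The torsor of frames\<close>

lemma Fr_simps [simp]:
  "grp (Fr S X) = wreath (grp S) X"
  "gmfd (Fr S X) = wreath_mfd (gmfd S) X"
  "fmfd (Fr S X) = restrict_mfd (power_mfd X (fmfd S)) (frames X S)"
  by (simp_all add: Fr_def)

lemma pts_Fr: "pts (Fr S X) = frames X S"
  by (auto simp: frames_def)

lemma act_Fr:
  "f \<in> frames X S \<Longrightarrow> act (Fr S X) h f = (\<lambda>x\<in>X. act S (fst h x) (f (inv_into X (snd h) x)))"
  by (simp add: Fr_def case_prod_unfold)

lemma act_Fr_extensional: "act (Fr S X) h \<in> extensional (frames X S)"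
  by (simp add: Fr_def case_prod_unfold)

lemma bij_betw_eq_onI:
  assumes "bij_betw g A B" "\<And>a. a \<in> A \<Longrightarrow> f a = g a"
  shows "bij_betw f A B"
  using assms bij_betw_cong[of A f g B] by simp

lemma group_actionI:
  assumes G: "group G"
    and ext: "\<And>g. g \<in> carrier G \<Longrightarrow> a g \<in> extensional E"
    and closed: "\<And>g p. g \<in> carrier G \<Longrightarrow> p \<in> E \<Longrightarrow> a g p \<in> E"
    and one: "\<And>p. p \<in> E \<Longrightarrow> a \<one>\<^bsub>G\<^esub> p = p"
    and mult: "\<And>g h p. g \<in> carrier G \<Longrightarrow> h \<in> carrier G \<Longrightarrow> p \<in> E \<Longrightarrow> a (g \<otimes>\<^bsub>G\<^esub> h) p = a g (a h p)"
  shows "group_action G E a"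
proof -
  interpret group G by (rule G)
  have Bij: "a g \<in> Bij E" if g: "g \<in> carrier G" for g
  proof -
    have "bij_betw (a g) E E"
    proof (rule bij_betw_byWitness[where f' = "a (inv\<^bsub>G\<^esub> g)"])
      show "\<forall>p\<in>E. a (inv\<^bsub>G\<^esub> g) (a g p) = p" "\<forall>p\<in>E. a g (a (inv\<^bsub>G\<^esub> g) p) = p"
        using g by (simp_all add: mult[symmetric] one)
    qed (use g closed in auto)
    then show ?thesis
      using ext[OF g] by (simp add: Bij_def)
  qed
  have "a (g \<otimes>\<^bsub>G\<^esub> h) = compose E (a g) (a h)" if "g \<in> carrier G" "h \<in> carrier G" for g h
    using that mult by (intro extensionalityI[OF ext compose_extensional]) (auto simp: compose_eq)
  then have "a \<in> hom G (BijGroup E)"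
    using Bij by (auto simp: hom_def BijGroup_def)
  then show ?thesis
    by (intro group_action.intro group_hom.intro group_hom_axioms.intro G group_BijGroup)
qed

locale frame_space = free_gspace S + wreath_group s "grp S" "gmfd S" X
  for S :: "('g, 'f, 'i, 'j) gspace" and s and X :: "'x set" +
  assumes regular: "regular_action s S"
    and orbit_space: "discrete_orbit_space S"
    and index: "X \<approx> orbs S"
begin

lemma space_F: "regular_space s (fmfd S)"
  and act_F: "regular_map s (prod_mfd (gmfd S) (fmfd S)) (fmfd S) (\<lambda>(g, f). act S g f)"
  using regular by (simp_all add: regular_action_def)

lemma frame_mem: "f \<in> frames X S \<Longrightarrow> x \<in> X \<Longrightarrow> f x \<in> pts S"
  by (auto simp: frames_iff)

lemma wreath_mem:
  assumes "h \<in> carrier (wreath (grp S) X)"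
  shows "snd h \<in> Bij X" "x \<in> X \<Longrightarrow> fst h x \<in> carrier (grp S)"
  using assms by auto

text \<open>
  On orbits, \<open>(g, \<sigma>)\<close> only permutes the numbering: the orbit of \<open>g(x) f(\<sigma>\<^sup>-\<^sup>1 x)\<close> is that of
  \<open>f(\<sigma>\<^sup>-\<^sup>1 x)\<close>.
\<close>

lemma frame_action_closed:
  assumes h: "h \<in> carrier (wreath (grp S) X)" and f: "f \<in> frames X S"
  shows "act (Fr S X) h f \<in> frames X S"
proof -
  note \<sigma> = wreath_mem(1)[OF h]
  have mem: "f (inv_into X (snd h) x) \<in> pts S" if "x \<in> X" for x
    by (rule frame_mem[OF f Bij_permutation(2)[OF \<sigma> that]])
  have "bij_betw (inv_into X (snd h)) X X"
    using \<sigma> by (intro bij_betw_inv_into) (simp add: Bij_def)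
  moreover have "bij_betw (\<lambda>x. orb S (f x)) X (orbs S)"
    using f by (simp add: frames_iff)
  ultimately have "bij_betw ((\<lambda>x. orb S (f x)) \<circ> inv_into X (snd h)) X (orbs S)"
    by (rule bij_betw_trans)
  moreover have "orb S (act (Fr S X) h f x) = ((\<lambda>x. orb S (f x)) \<circ> inv_into X (snd h)) x" if "x \<in> X" for x
    using that orb_act[OF wreath_mem(2)[OF h that] mem[OF that]] by (simp add: act_Fr[OF f])
  ultimately have "bij_betw (\<lambda>x. orb S (act (Fr S X) h f x)) X (orbs S)"
    by (rule bij_betw_eq_onI)
  moreover have "act (Fr S X) h f \<in> X \<rightarrow>\<^sub>E pts S"
    using act_closed[OF wreath_mem(2)[OF h] mem] by (simp add: act_Fr[OF f])
  ultimately show ?thesis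
    by (simp add: frames_iff)
qed

lemma group_action_Fr: "group_action (wreath (grp S) X) (frames X S) (act (Fr S X))"
proof (rule group_actionI[OF group_wreath[OF is_group] act_Fr_extensional frame_action_closed])
  fix f assume f: "f \<in> frames X S"
  show "act (Fr S X) \<one>\<^bsub>wreath (grp S) X\<^esub> f = f"
  proof (rule extensionalityI[of _ X])
    fix x assume "x \<in> X"
    then show "act (Fr S X) \<one>\<^bsub>wreath (grp S) X\<^esub> f x = f x"
      using act_one[OF frame_mem[OF f]] by (simp add: act_Fr[OF f] Bij_inv_into_id)
  qed (use f in \<open>auto simp: act_Fr[OF f] frames_iff PiE_def\<close>)
next
  fix h k f
  assume h: "h \<in> carrier (wreath (grp S) X)" and k: "k \<in> carrier (wreath (grp S) X)" and f: "f \<in> frames X S"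
  show "act (Fr S X) (h \<otimes>\<^bsub>wreath (grp S) X\<^esub> k) f = act (Fr S X) h (act (Fr S X) k f)"
    unfolding act_Fr[OF frame_action_closed[OF k f]]
    unfolding act_Fr[OF f]
  proof (rule restrict_ext)
    fix x assume x: "x \<in> X"
    let ?y = "inv_into X (snd h) x"
    let ?z = "inv_into X (snd k) ?y"
    have y: "?y \<in> X" by (rule Bij_permutation(2)[OF wreath_mem(1)[OF h] x])
    have z: "?z \<in> X" by (rule Bij_permutation(2)[OF wreath_mem(1)[OF k] y])
    have prod: "fst (h \<otimes>\<^bsub>wreath (grp S) X\<^esub> k) x = fst h x \<otimes>\<^bsub>grp S\<^esub> fst k ?y"
      "inv_into X (snd (h \<otimes>\<^bsub>wreath (grp S) X\<^esub> k)) x = ?z"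
      using x h k by (auto simp: Bij_inv_into_compose)
    show "act S (fst (h \<otimes>\<^bsub>wreath (grp S) X\<^esub> k) x) (f (inv_into X (snd (h \<otimes>\<^bsub>wreath (grp S) X\<^esub> k)) x)) =
        act S (fst h x) ((\<lambda>x\<in>X. act S (fst k x) (f (inv_into X (snd k) x))) ?y)"
      unfolding prod restrict_apply'[OF y]
      by (rule composition_rule[OF frame_mem[OF f z] wreath_mem(2)[OF h x] wreath_mem(2)[OF k y]])
  qed
qed

text \<open>
  Let \<open>(g, \<sigma>)\<close> fix the frame \<open>f\<close>. Then \<open>f (\<sigma>\<^sup>-\<^sup>1 x)\<close> and \<open>f x\<close> lie in one orbit, so \<open>\<sigma>\<close> is the
  identity, and \<open>g x\<close> fixes \<open>f x\<close>.
\<close>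

lemma free_Fr: "free_act (Fr S X)"
  unfolding free_act_def pts_Fr
  unfolding Fr_simps
proof (intro ballI impI)
  fix f h assume f: "f \<in> frames X S" and h: "h \<in> carrier (wreath (grp S) X)" and fix': "act (Fr S X) h f = f"
  note \<sigma> = wreath_mem(1)[OF h]
  have eq: "act S (fst h x) (f (inv_into X (snd h) x)) = f x" if "x \<in> X" for x
    using fun_cong[OF fix', of x] that by (simp add: act_Fr[OF f])
  have inv_id: "inv_into X (snd h) x = x" if x: "x \<in> X" for x
  proof -
    have y: "inv_into X (snd h) x \<in> X" by (rule Bij_permutation(2)[OF \<sigma> x])
    have "orb S (f (inv_into X (snd h) x)) = orb S (f x)"
      using orb_act[OF wreath_mem(2)[OF h x] frame_mem[OF f y]] eq[OF x] by simp
    moreover have "inj_on (\<lambda>x. orb S (f x)) X"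
      using f bij_betw_imp_inj_on by (auto simp: frames_iff)
    ultimately show ?thesis using inj_onD x y by metis
  qed
  have "snd h = (\<lambda>x\<in>X. x)"
  proof (rule Bij_eqI[OF \<sigma> id_Bij])
    fix x assume "x \<in> X"
    then show "snd h x = (\<lambda>x\<in>X. x) x"
      using Bij_permutation(3)[OF \<sigma>] inv_id by force
  qed
  moreover have "fst h = (\<lambda>x\<in>X. \<one>\<^bsub>grp S\<^esub>)"
  proof (rule extensionalityI[of _ X])
    fix x assume x: "x \<in> X"
    then show "fst h x = (\<lambda>x\<in>X. \<one>\<^bsub>grp S\<^esub>) x"
      using free frame_mem[OF f x] wreath_mem(2)[OF h x] eq[OF x] inv_id[OF x] by (simp add: free_act_def)
  qed (use h in \<open>auto simp: PiE_def\<close>)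
  ultimately show "h = \<one>\<^bsub>wreath (grp S) X\<^esub>"
    by (simp add: prod_eq_iff)
qed

text \<open>
  Two frames number the orbits in two ways. This gives the permutation that carries one to the
  other, and after permuting, the two frames differ in each orbit by a unique group element.
\<close>

lemma transitive_Fr: "transitive_act (Fr S X)"
  unfolding transitive_act_def pts_Fr
  unfolding Fr_simps
proof
  show "frames X S \<noteq> {}"
    by (rule frames_nonempty[OF index])
  show "transitive_action (wreath (grp S) X) (frames X S) (act (Fr S X))"
  proof (intro transitive_action.intro transitive_action_axioms.intro group_action_Fr)
    fix f f' assume f: "f \<in> frames X S" and f': "f' \<in> frames X S"
    let ?b = "\<lambda>x. orb S (f x)" and ?b' = "\<lambda>x. orb S (f' x)"
    have b: "bij_betw ?b X (orbs S)" and b': "bij_betw ?b' X (orbs S)"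
      using f f' by (simp_all add: frames_iff)
    (* The permutation turns the number that f gives to an orbit into the one that f' gives to it. *)
    define \<sigma> where "\<sigma> = (\<lambda>x\<in>X. (inv_into X ?b' \<circ> ?b) x)"
    have "bij_betw (inv_into X ?b' \<circ> ?b) X X"
      by (rule bij_betw_trans[OF b bij_betw_inv_into[OF b']])
    then have \<sigma>: "\<sigma> \<in> Bij X"
      unfolding Bij_def \<sigma>_def by (simp cong: bij_betw_cong)
    have orb_eq: "orb S (f (inv_into X \<sigma> x)) = orb S (f' x)" if x: "x \<in> X" for x
    proof -
      let ?y = "inv_into X \<sigma> x"
      have y: "?y \<in> X" "\<sigma> ?y = x"
        using Bij_permutation(2,3)[OF \<sigma> x] by auto
      have "?b' (\<sigma> ?y) = ?b ?y"
        using y(1) f_inv_into_f[of "?b ?y" ?b' X] bij_betwE[OF b] bij_betw_imp_surj_on[OF b']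
        by (simp add: \<sigma>_def)
      then show ?thesis using y(2) by simp
    qed
    have mem: "f (inv_into X \<sigma> x) \<in> pts S" "f' x \<in> pts S" if "x \<in> X" for x
      using frame_mem[OF f Bij_permutation(2)[OF \<sigma> that]] frame_mem[OF f' that] by auto
    have "\<forall>x\<in>X. \<exists>g. g \<in> carrier (grp S) \<and> act S g (f (inv_into X \<sigma> x)) = f' x"
    proof
      fix x assume x: "x \<in> X"
      from orb_eq[OF x] show "\<exists>g. g \<in> carrier (grp S) \<and> act S g (f (inv_into X \<sigma> x)) = f' x"
        unfolding orb_eq_iff[OF mem[OF x]] by blast
    qed
    from bchoice[OF this] obtain g where
      g: "\<forall>x\<in>X. g x \<in> carrier (grp S) \<and> act S (g x) (f (inv_into X \<sigma> x)) = f' x" ..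
    have "act (Fr S X) (restrict g X, \<sigma>) f = f'"
    proof (rule extensionalityI[of _ X])
      fix x assume "x \<in> X"
      then show "act (Fr S X) (restrict g X, \<sigma>) f x = f' x"
        using g by (simp add: act_Fr[OF f])
    qed (use f' in \<open>auto simp: act_Fr[OF f] frames_iff PiE_def\<close>)
    moreover have "(restrict g X, \<sigma>) \<in> carrier (wreath (grp S) X)"
      using g \<sigma> by simp
    ultimately show "\<exists>h\<in>carrier (wreath (grp S) X). act (Fr S X) h f = f'"
      by blast
  qed
qed

lemma space_FX: "regular_space s (power_mfd X (fmfd S))"
  by (rule regular_space_power[OF index_finite space_F])

lemma frames_open': "s \<Longrightarrow> openin (mtop (power_mfd X (fmfd S))) (frames X S)"
  using frames_open[OF orbit_space index_finite] by simp

lemma space_Fr: "regular_space s (fmfd (Fr S X))"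
  unfolding Fr_simps by (rule regular_space_restrict[OF space_FX frames_open'])

lemma regular_map_frame_value:
  assumes "x \<in> X"
  shows "regular_map s (fmfd (Fr S X)) (fmfd S) (\<lambda>f. f x)"
  using regular_map_compose[OF space_Fr space_FX space_F
      regular_map_restrict_inclusion[OF space_FX frames_open', folded Fr_simps(3)]
      regular_map_power_coordinate[OF index_finite space_F assms]] .

text \<open>
  The coordinate at \<open>x\<close> is \<open>((g, \<sigma>), f) \<mapsto> g(x) f(\<sigma>\<^sup>-\<^sup>1 x)\<close>, which for \<open>\<sigma>\<^sup>-\<^sup>1 x = z\<close> is a composite of
  projections and the action on \<open>F\<close>.
\<close>

lemma act_Fr_regular: "regular_map s (prod_mfd W (fmfd (Fr S X))) (fmfd (Fr S X)) (\<lambda>(h, f). act (Fr S X) h f)"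
proof -
  let ?P = "prod_mfd W (fmfd (Fr S X))"
  have P: "regular_space s ?P" by (rule regular_space_prod[OF space_W space_Fr])
  have fst: "regular_map s ?P W fst" and snd: "regular_map s ?P (fmfd (Fr S X)) snd"
    by (rule regular_map_fst[OF space_W space_Fr] regular_map_snd[OF space_W space_Fr])+
  have t: "continuous_map (mtop ?P) (sym_topology X) (\<lambda>p. snd (fst p))"
    using continuous_map_compose[OF regular_map_continuous[OF fst] continuous_map_permutation]
    by (simp only: o_def)
  have top_P: "topspace (mtop ?P) = carrier (wreath (grp S) X) \<times> frames X S"
    unfolding prod_mfd_simps topspace_prod_topology topspace_W pts_Fr ..
  have act: "regular_map s ?P (fmfd S) (\<lambda>p. act S (fst (fst p) x) (snd p z))" if "x \<in> X" "z \<in> X" for x z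
  proof -
    have "regular_map s ?P (prod_mfd (gmfd S) (fmfd S)) (\<lambda>p. (fst (fst p) x, snd p z))"
      by (rule regular_map_pair[OF regular_map_compose[OF P space_W space_M fst regular_map_value[OF that(1)]]
            regular_map_compose[OF P space_Fr space_F snd regular_map_frame_value[OF that(2)]]])
    from regular_map_compose[OF P regular_space_prod[OF space_M space_F] space_F this act_F]
    show ?thesis by simp
  qed
  have comp: "regular_map s ?P (fmfd S) (\<lambda>p. act S (fst (fst p) x) (snd p (inv_into X (snd (fst p)) x)))"
    if x: "x \<in> X" for x
  proof (rule regular_map_local[OF P space_F])
    fix p assume p: "p \<in> topspace (mtop ?P)"
    obtain V where V: "openin (mtop ?P) V" "p \<in> V"
      "\<forall>q\<in>V. q \<in> topspace (mtop ?P) \<and> inv_into X (snd (fst q)) x = inv_into X (snd (fst p)) x"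
      using inv_permutation_locally_constant[OF t x p] by blast
    have "snd (fst p) \<in> Bij X"
      using p unfolding top_P by auto
    then have "inv_into X (snd (fst p)) x \<in> X"
      by (rule Bij_permutation(2)[OF _ x])
    from act[OF x this]
    show "\<exists>V g. openin (mtop ?P) V \<and> p \<in> V \<and> regular_map s ?P (fmfd S) g \<and>
        (\<forall>q\<in>V. act S (fst (fst q) x) (snd q (inv_into X (snd (fst q)) x)) = g q)"
    proof (intro exI conjI ballI)
      fix q assume "q \<in> V"
      with V(3) have eq: "inv_into X (snd (fst q)) x = inv_into X (snd (fst p)) x" by blast
      show "act S (fst (fst q) x) (snd q (inv_into X (snd (fst q)) x)) =
          act S (fst (fst q) x) (snd q (inv_into X (snd (fst p)) x))"
        unfolding eq ..
    qed (rule V(1) V(2) | assumption)+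
  qed
  have "regular_map s ?P (power_mfd X (fmfd S)) (\<lambda>(h, f). act (Fr S X) h f)"
    by (rule regular_map_cong[OF P space_FX regular_map_tuple[OF comp]]) (auto simp: top_P act_Fr)
  moreover have "(\<lambda>(h, f). act (Fr S X) h f) \<in> topspace (mtop ?P) \<rightarrow> frames X S"
    unfolding top_P using frame_action_closed by auto
  ultimately show ?thesis
    using regular_map_into_restrict unfolding Fr_simps(3) by blast
qed

theorem regular_torsor_Fr: "regular_torsor s (Fr S X)"
  unfolding regular_torsor_def regular_action_def
proof (intro conjI free_Fr transitive_Fr space_Fr)
  show "regular_group s (grp (Fr S X)) (gmfd (Fr S X))"
    using regular_group_wreath by simp
  show "group_action (grp (Fr S X)) (pts (Fr S X)) (act (Fr S X))"
    unfolding pts_Fr using group_action_Fr by simp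
  show "regular_map s (prod_mfd (gmfd (Fr S X)) (fmfd (Fr S X))) (fmfd (Fr S X)) (\<lambda>(g, f). act (Fr S X) g f)"
    using act_Fr_regular by simp
qed

end

lemma semi_torsor_free_gspace: "semi_torsor S \<Longrightarrow> free_gspace S"
  by (simp add: semi_torsor_def G_manifold_def free_gspace_def)

lemma semi_torsor_frame_space:
  assumes "semi_torsor S" "X \<approx> orbs S" "s \<Longrightarrow> finite X"
  shows "frame_space S s X"
proof -
  have "regular_action s S"
    using assms(1) by (simp add: semi_torsor_def G_manifold_regular_action)
  then show ?thesis
    using assms semi_torsor_free_gspace[OF assms(1)]
    by (intro frame_space.intro frame_space_axioms.intro wreath_group.intro)
       (auto simp: regular_action_def semi_torsor_def)
qed

section \<open>The induced maps of frames\<close>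

text \<open>
  An equivariant map sends all points of an orbit into one orbit, so the set whose only element
  \<^const>\<open>orbit_map\<close> picks is indeed a singleton.
\<close>

lemma orbit_map_orb:
  assumes S: "free_gspace S" and S': "free_gspace S'"
    and \<xi>: "\<xi> \<in> hom (grp S) (grp S')" "equivariant S S' \<xi> \<alpha>" and \<alpha>: "\<alpha> \<in> pts S \<rightarrow> pts S'" and f: "f \<in> pts S"
  shows "orbit_map S S' \<alpha> (orb S f) = orb S' (\<alpha> f)"
proof -
  interpret S: free_gspace S by (rule S)
  interpret S': free_gspace S' by (rule S')
  have "orb S' (\<alpha> p) = orb S' (\<alpha> f)" if "p \<in> orb S f" for p
  proof -
    obtain g where g: "g \<in> carrier (grp S)" "p = act S g f"
      using \<open>p \<in> orb S f\<close> by (auto simp: orbit_def)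
    then have "\<alpha> p = act S' (\<xi> g) (\<alpha> f)"
      using \<xi>(2) f by (simp add: equivariant_def)
    moreover have "\<xi> g \<in> carrier (grp S')"
      using \<xi>(1) g(1) by (auto simp: hom_def)
    ultimately show ?thesis
      using S'.orb_act \<alpha> f by auto
  qed
  then have "(\<lambda>p. orb S' (\<alpha> p)) ` orb S f = {orb S' (\<alpha> f)}"
    using S.orbit_refl[OF f] by blast
  then show ?thesis
    using f by (auto simp: orbit_map_def orbits_def)
qed

lemma tor_hom_orbit_map:
  assumes "semi_torsor S" "semi_torsor S'" "\<alpha> \<in> tor_hom S S'" "f \<in> pts S"
  shows "orbit_map S S' \<alpha> (orb S f) = orb S' (\<alpha> f)"
proof -
  obtain \<xi> where "\<xi> \<in> hom (grp S) (grp S')" "equivariant S S' \<xi> \<alpha>"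
    using assms(3) by (auto simp: tor_hom_def)
  moreover have "\<alpha> \<in> pts S \<rightarrow> pts S'"
    using regular_hom_funcset[OF tor_hom_regular[OF assms(3)]] .
  ultimately show ?thesis
    using assms by (intro orbit_map_orb semi_torsor_free_gspace)
qed

lemma stor_hom_iff: "\<alpha> \<in> stor_hom S S' \<longleftrightarrow> \<alpha> \<in> tor_hom S S' \<and> bij_betw (orbit_map S S' \<alpha>) (orbs S) (orbs S')"
  by (auto simp: stor_hom_def tor_hom_def)

text \<open>
  The orbits of \<open>\<alpha> \<circ> f\<close> are the images under \<open>\<alpha>/\<close> of those of \<open>f\<close>, and \<open>\<alpha>/\<close> is a bijection.
\<close>

lemma compose_frame:
  assumes S: "semi_torsor S" and S': "semi_torsor S'" and \<alpha>: "\<alpha> \<in> stor_hom S S'" and f: "f \<in> frames X S"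
  shows "compose X \<alpha> f \<in> frames X S'"
proof -
  interpret S: free_gspace S by (rule semi_torsor_free_gspace[OF S])
  interpret S': free_gspace S' by (rule semi_torsor_free_gspace[OF S'])
  have \<alpha>': "\<alpha> \<in> tor_hom S S'" "bij_betw (orbit_map S S' \<alpha>) (orbs S) (orbs S')"
    using \<alpha> by (simp_all add: stor_hom_iff)
  have fX: "f x \<in> pts S" if "x \<in> X" for x
    using f that by (auto simp: S.frames_iff)
  have "bij_betw (orbit_map S S' \<alpha> \<circ> (\<lambda>x. orb S (f x))) X (orbs S')"
    using f by (intro bij_betw_trans[OF _ \<alpha>'(2)]) (simp add: S.frames_iff)
  moreover have "orb S' (compose X \<alpha> f x) = (orbit_map S S' \<alpha> \<circ> (\<lambda>x. orb S (f x))) x" if "x \<in> X" for x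
    using tor_hom_orbit_map[OF S S' \<alpha>'(1) fX[OF that]] that by (simp add: compose_eq)
  ultimately have "bij_betw (\<lambda>x. orb S' (compose X \<alpha> f x)) X (orbs S')"
    by (rule bij_betw_eq_onI)
  moreover have "compose X \<alpha> f \<in> X \<rightarrow>\<^sub>E pts S'"
    using regular_hom_funcset[OF tor_hom_regular[OF \<alpha>'(1)]] fX by (auto simp: compose_def)
  ultimately show ?thesis
    by (simp add: S'.frames_iff)
qed

text \<open>The homomorphism \<open>\<xi>!\<close>.\<close>

definition wreath_map :: "'x set \<Rightarrow> ('g \<Rightarrow> 'h) \<Rightarrow> ('x \<Rightarrow> 'g) \<times> ('x \<Rightarrow> 'x) \<Rightarrow> ('x \<Rightarrow> 'h) \<times> ('x \<Rightarrow> 'x)" where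
  "wreath_map X \<xi> = (\<lambda>h. (\<lambda>x\<in>X. \<xi> (fst h x), snd h))"

lemma wreath_map_hom:
  assumes "\<xi> \<in> hom G H"
  shows "wreath_map X \<xi> \<in> hom (wreath G X) (wreath H X)"
proof (rule homI)
  fix h assume "h \<in> carrier (wreath G X)"
  then show "wreath_map X \<xi> h \<in> carrier (wreath H X)"
    using assms by (auto simp: wreath_map_def hom_def)
next
  fix h k assume "h \<in> carrier (wreath G X)" "k \<in> carrier (wreath G X)"
  then obtain f \<rho> g \<sigma> where hk: "h = (f, \<rho>)" "k = (g, \<sigma>)" "f \<in> X \<rightarrow>\<^sub>E carrier G" "g \<in> X \<rightarrow>\<^sub>E carrier G" "\<rho> \<in> Bij X"
    by auto
  show "wreath_map X \<xi> (h \<otimes>\<^bsub>wreath G X\<^esub> k) = wreath_map X \<xi> h \<otimes>\<^bsub>wreath H X\<^esub> wreath_map X \<xi> k"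
    unfolding hk(1,2) wreath_map_def wreath_simps fst_conv snd_conv
  proof (intro arg_cong2[where f = Pair] restrict_ext refl)
    fix x assume x: "x \<in> X"
    have y: "inv_into X \<rho> x \<in> X" by (rule Bij_permutation(2)[OF hk(5) x])
    show "\<xi> ((\<lambda>x\<in>X. f x \<otimes>\<^bsub>G\<^esub> g (inv_into X \<rho> x)) x) =
        (\<lambda>x\<in>X. \<xi> (f x)) x \<otimes>\<^bsub>H\<^esub> (\<lambda>x\<in>X. \<xi> (g x)) (inv_into X \<rho> x)"
      using x y hom_mult[OF assms PiE_mem[OF hk(3) x] PiE_mem[OF hk(4) y]] by simp
  qed
qed

text \<open>
  The homomorphism is \<open>\<xi>!\<close>: at the index \<open>x\<close> equivariance reads
  \<open>\<alpha>(g(x) f(\<sigma>\<^sup>-\<^sup>1 x)) = \<xi>(g(x)) \<alpha>(f(\<sigma>\<^sup>-\<^sup>1 x))\<close>. The coordinates of \<open>\<alpha>!\<close> and \<open>\<xi>!\<close> are projections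
  followed by \<open>\<alpha>\<close> and \<open>\<xi>\<close>, so regularity is inherited.
\<close>

lemma Fr_map_hom:
  assumes S: "semi_torsor S" and S': "semi_torsor S'" and \<alpha>: "\<alpha> \<in> stor_hom S S'"
    and X: "X \<approx> orbs S" "X \<approx> orbs S'" and fin: "s \<Longrightarrow> finite X"
  shows "Fr_map S X \<alpha> \<in> regular_hom s (Fr S X) (Fr S' X)"
proof -
  interpret S: frame_space S s X by (rule semi_torsor_frame_space[OF S X(1) fin])
  interpret S': frame_space S' s X by (rule semi_torsor_frame_space[OF S' X(2) fin])
  have "\<alpha> \<in> regular_hom s S S'"
    using \<alpha> by (intro tor_hom_regular) (simp add: stor_hom_iff)
  then obtain \<xi> where \<alpha>r: "regular_map s (fmfd S) (fmfd S') \<alpha>" and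
    \<xi>: "\<xi> \<in> hom (grp S) (grp S')" "regular_map s (gmfd S) (gmfd S') \<xi>" "equivariant S S' \<xi> \<alpha>"
    by (auto simp: regular_hom_def)
  have "regular_map s (fmfd (Fr S X)) (fmfd S') (\<lambda>f. \<alpha> (f x))" if "x \<in> X" for x
    by (rule regular_map_compose[OF S.space_Fr S.space_F S'.space_F S.regular_map_frame_value[OF that] \<alpha>r])
  then have "regular_map s (fmfd (Fr S X)) (power_mfd X (fmfd S')) (\<lambda>f. \<lambda>x\<in>X. \<alpha> (f x))"
    by (rule regular_map_tuple)
  then have "regular_map s (fmfd (Fr S X)) (power_mfd X (fmfd S')) (Fr_map S X \<alpha>)"
    by (rule regular_map_cong[OF S.space_Fr S'.space_FX]) (auto simp only: pts_Fr Fr_map_def compose_def restrict_apply')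
  moreover have "Fr_map S X \<alpha> \<in> pts (Fr S X) \<rightarrow> frames X S'"
    unfolding pts_Fr using compose_frame[OF S S' \<alpha>] by (auto simp: Fr_map_def)
  ultimately have 1: "regular_map s (fmfd (Fr S X)) (fmfd (Fr S' X)) (Fr_map S X \<alpha>)"
    unfolding Fr_simps(3)[of S' X] by (rule regular_map_into_restrict)
  have "regular_map s (gmfd (Fr S X)) (gmfd S') (\<lambda>h. \<xi> (fst h x))" if "x \<in> X" for x
    unfolding Fr_simps
    by (rule regular_map_compose[OF S.space_W S.space_M S'.space_M S.regular_map_value[OF that] \<xi>(2)])
  moreover have "continuous_map (mtop (gmfd (Fr S X))) (sym_topology X) snd"
    unfolding Fr_simps by (rule S.continuous_map_permutation)
  ultimately have 2: "regular_map s (gmfd (Fr S X)) (gmfd (Fr S' X)) (wreath_map X \<xi>)"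
    unfolding wreath_map_def Fr_simps(2)[of S' X] by (rule S'.regular_map_into_W)
  have 3: "equivariant (Fr S X) (Fr S' X) (wreath_map X \<xi>) (Fr_map S X \<alpha>)"
    unfolding equivariant_def pts_Fr
  proof (intro ballI)
    fix h f assume "h \<in> carrier (grp (Fr S X))" and f: "f \<in> frames X S"
    then have h: "h \<in> carrier (wreath (grp S) X)" by simp
    show "Fr_map S X \<alpha> (act (Fr S X) h f) = act (Fr S' X) (wreath_map X \<xi> h) (Fr_map S X \<alpha> f)"
      unfolding Fr_map_def restrict_apply'[OF f] restrict_apply'[OF S.frame_action_closed[OF h f]]
        act_Fr[OF compose_frame[OF S S' \<alpha> f]]
      unfolding act_Fr[OF f] compose_def wreath_map_def fst_conv snd_conv
    proof (intro restrict_ext)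
      fix x assume x: "x \<in> X"
      have y: "inv_into X (snd h) x \<in> X"
        by (rule Bij_permutation(2)[OF S.wreath_mem(1)[OF h] x])
      show "\<alpha> ((\<lambda>x\<in>X. act S (fst h x) (f (inv_into X (snd h) x))) x) =
          act S' ((\<lambda>x\<in>X. \<xi> (fst h x)) x) ((\<lambda>x\<in>X. \<alpha> (f x)) (inv_into X (snd h) x))"
        using \<xi>(3) S.wreath_mem(2)[OF h x] S.frame_mem[OF f y] x y by (simp add: equivariant_def)
    qed
  qed
  have "Fr_map S X \<alpha> \<in> extensional (pts (Fr S X))"
    unfolding pts_Fr by (simp add: Fr_map_def)
  moreover have "wreath_map X \<xi> \<in> hom (grp (Fr S X)) (grp (Fr S' X))"
    using wreath_map_hom[OF \<xi>(1)] by simp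
  ultimately show ?thesis
    using 1 2 3 unfolding regular_hom_def by blast
qed

section \<open>Functoriality\<close>

lemma stor_hom_id:
  assumes S: "semi_torsor S"
  shows "(\<lambda>f\<in>pts S. f) \<in> stor_hom S S"
proof -
  interpret S: free_gspace S by (rule semi_torsor_free_gspace[OF S])
  have id: "(\<lambda>f\<in>pts S. f) \<in> tor_hom S S"
    using S regular_hom_id[of True S] by (simp add: semi_torsor_def regular_action_smooth regular_hom_smooth)
  have "orbit_map S S (\<lambda>f\<in>pts S. f) \<Omega> = \<Omega>" if "\<Omega> \<in> orbs S" for \<Omega>
    using that tor_hom_orbit_map[OF S S id] by (auto simp: orbits_def)
  then have "bij_betw (orbit_map S S (\<lambda>f\<in>pts S. f)) (orbs S) (orbs S)"
    by (intro bij_betw_eq_onI[OF bij_betw_id]) simp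
  with id show ?thesis by (simp add: stor_hom_iff)
qed

lemma stor_hom_compose:
  assumes S: "semi_torsor S" and S': "semi_torsor S'" and S'': "semi_torsor S''"
    and \<alpha>: "\<alpha> \<in> stor_hom S S'" and \<beta>: "\<beta> \<in> stor_hom S' S''"
  shows "compose (pts S) \<beta> \<alpha> \<in> stor_hom S S''"
proof -
  have \<alpha>': "\<alpha> \<in> tor_hom S S'" "bij_betw (orbit_map S S' \<alpha>) (orbs S) (orbs S')"
    and \<beta>': "\<beta> \<in> tor_hom S' S''" "bij_betw (orbit_map S' S'' \<beta>) (orbs S') (orbs S'')"
    using \<alpha> \<beta> by (simp_all add: stor_hom_iff)
  have \<alpha>_pts: "\<alpha> f \<in> pts S'" if "f \<in> pts S" for f
    using regular_hom_funcset[OF tor_hom_regular[OF \<alpha>'(1)]] that by auto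
  have comp: "compose (pts S) \<beta> \<alpha> \<in> tor_hom S S''"
    using regular_hom_compose[of True S S' S'' \<alpha> \<beta>] S S' S'' \<alpha>'(1) \<beta>'(1)
    by (simp add: semi_torsor_def regular_action_smooth regular_hom_smooth)
  have "orbit_map S S'' (compose (pts S) \<beta> \<alpha>) \<Omega> = (orbit_map S' S'' \<beta> \<circ> orbit_map S S' \<alpha>) \<Omega>"
    if \<Omega>: "\<Omega> \<in> orbs S" for \<Omega>
  proof -
    obtain f where f: "\<Omega> = orb S f" "f \<in> pts S"
      using \<Omega> by (auto simp: orbits_def)
    show ?thesis
      unfolding f(1) o_def tor_hom_orbit_map[OF S S'' comp f(2)] tor_hom_orbit_map[OF S S' \<alpha>'(1) f(2)]
        tor_hom_orbit_map[OF S' S'' \<beta>'(1) \<alpha>_pts[OF f(2)]] compose_eq[OF f(2)] ..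
  qed
  then have "bij_betw (orbit_map S S'' (compose (pts S) \<beta> \<alpha>)) (orbs S) (orbs S'')"
    by (rule bij_betw_eq_onI[OF bij_betw_trans[OF \<alpha>'(2) \<beta>'(2)]])
  with comp show ?thesis by (simp add: stor_hom_iff)
qed

lemma is_category_STor_full:
  assumes "K \<subseteq> {S. semi_torsor S}"
  shows "is_category (STor\<lparr>Obj := K\<rparr>)"
  unfolding is_category_def STor_def cat.simps
proof (intro conjI ballI)
  fix S T :: "('a, 'b, 'c, 'd) gspace" and \<alpha>
  assume "\<alpha> \<in> stor_hom S T"
  then have "\<alpha> \<in> tor_hom S T" by (simp add: stor_hom_iff)
  then have "\<alpha> \<in> pts S \<rightarrow> pts T" "\<alpha> \<in> extensional (pts S)"
    using regular_hom_funcset[OF tor_hom_regular] by (auto simp: tor_hom_def)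
  then show "compose (pts S) \<alpha> (\<lambda>f\<in>pts S. f) = \<alpha>" "compose (pts S) (\<lambda>f\<in>pts T. f) \<alpha> = \<alpha>"
    by (simp_all add: compose_Id Id_compose)
next
  fix S T U V :: "('a, 'b, 'c, 'd) gspace" and \<alpha> \<beta> \<gamma>
  assume "\<alpha> \<in> stor_hom S T"
  then have "\<alpha> \<in> tor_hom S T" by (simp add: stor_hom_iff)
  then show "compose (pts S) \<gamma> (compose (pts S) \<beta> \<alpha>) = compose (pts S) (compose (pts T) \<gamma> \<beta>) \<alpha>"
    by (intro compose_assoc regular_hom_funcset[OF tor_hom_regular])
qed (use assms in \<open>auto intro: stor_hom_id stor_hom_compose\<close>)

lemma index_choice_eqpoll: "index_choice X \<Longrightarrow> semi_torsor S \<Longrightarrow> X S \<approx> orbs S"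
  unfolding index_choice_def by blast

lemma index_choice_eq:
  "index_choice X \<Longrightarrow> semi_torsor S \<Longrightarrow> semi_torsor S' \<Longrightarrow> orbs S \<approx> orbs S' \<Longrightarrow> X S = X S'"
  unfolding index_choice_def by blast

text \<open>
  A morphism matches up the orbits, so its source and target have the same index set; this is what
  makes \<open>\<alpha> \<circ> f\<close> a frame with the right index set.
\<close>

lemma index_choice_hom:
  assumes "index_choice X" "semi_torsor S" "semi_torsor S'" "\<alpha> \<in> stor_hom S S'"
  shows "X S = X S'"
proof -
  have "orbs S \<approx> orbs S'"
    using assms(4) unfolding stor_hom_iff eqpoll_def by blast
  then show ?thesis by (rule index_choice_eq[OF assms(1-3)])
qed

lemma Fr_functor:
  fixes X :: "('g, 'f, 'i, 'j) gspace \<Rightarrow> 'x set"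
  assumes X: "index_choice X" and K: "\<And>S. S \<in> K \<Longrightarrow> semi_torsor S"
    and fin: "\<And>S. s \<Longrightarrow> S \<in> K \<Longrightarrow> finite (orbs S)"
  shows "is_functor (STor\<lparr>Obj := K\<rparr>) (Regular_Tor s) (\<lambda>S. Fr S (X S)) (\<lambda>S S' \<alpha>. Fr_map S (X S) \<alpha>)"
proof -
  have XS: "X S \<approx> orbs S" if "S \<in> K" for S
    by (rule index_choice_eqpoll[OF X K[OF that]])
  have XK: "finite (X S)" if "S \<in> K" s for S
    using eqpoll_finite_iff[OF XS[OF that(1)]] fin[OF that(2,1)] by simp
  show ?thesis
    unfolding is_functor_def
  proof (intro conjI ballI)
    show "is_category (STor\<lparr>Obj := K\<rparr>)"
      by (rule is_category_STor_full) (use K in auto)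
    show "is_category (Regular_Tor s :: ((('x \<Rightarrow> 'g) \<times> ('x \<Rightarrow> 'x), 'x \<Rightarrow> 'f, ('x \<times> 'i) + unit, 'x \<times> 'j) gspace,
        ('x \<Rightarrow> 'f) \<Rightarrow> 'x \<Rightarrow> 'f) cat)"
      by (rule is_category_Regular_Tor)
  next
    fix S assume "S \<in> Obj (STor\<lparr>Obj := K\<rparr>)"
    then have S: "S \<in> K" by simp
    interpret frame_space S s "X S"
      by (rule semi_torsor_frame_space[OF K[OF S] XS[OF S] XK[OF S]])
    show "Fr S (X S) \<in> Obj (Regular_Tor s)"
      using regular_torsor_Fr by (simp add: Regular_Tor_def)
    have "compose (X S) (\<lambda>f\<in>pts S. f) f = f" if "f \<in> frames (X S) S" for f
      using that by (intro Id_compose) (auto simp: frames_iff PiE_def)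
    then show "Fr_map S (X S) (Idn (STor\<lparr>Obj := K\<rparr>) S) = Idn (Regular_Tor s) (Fr S (X S))"
      unfolding STor_def Regular_Tor_def cat.simps Fr_map_def pts_Fr by (intro restrict_ext)
  next
    fix S S' \<alpha> assume "S \<in> Obj (STor\<lparr>Obj := K\<rparr>)" "S' \<in> Obj (STor\<lparr>Obj := K\<rparr>)" "\<alpha> \<in> Hom (STor\<lparr>Obj := K\<rparr>) S S'"
    then have S: "S \<in> K" "S' \<in> K" and \<alpha>: "\<alpha> \<in> stor_hom S S'" by (simp_all add: STor_def)
    have eq: "X S' = X S"
      using index_choice_hom[OF X K[OF S(1)] K[OF S(2)] \<alpha>] by simp
    show "Fr_map S (X S) \<alpha> \<in> Hom (Regular_Tor s) (Fr S (X S)) (Fr S' (X S'))"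
      using Fr_map_hom[OF K[OF S(1)] K[OF S(2)] \<alpha> XS[OF S(1)] XS[OF S(2), unfolded eq] XK[OF S(1)]] eq
      by (simp add: Regular_Tor_def)
  next
    fix S S' S'' \<alpha> \<beta>
    assume "S \<in> Obj (STor\<lparr>Obj := K\<rparr>)" "S' \<in> Obj (STor\<lparr>Obj := K\<rparr>)" "S'' \<in> Obj (STor\<lparr>Obj := K\<rparr>)"
      "\<alpha> \<in> Hom (STor\<lparr>Obj := K\<rparr>) S S'" "\<beta> \<in> Hom (STor\<lparr>Obj := K\<rparr>) S' S''"
    then have S: "S \<in> K" "S' \<in> K" and \<alpha>: "\<alpha> \<in> stor_hom S S'" by (simp_all add: STor_def)
    have eq: "X S' = X S"
      using index_choice_hom[OF X K[OF S(1)] K[OF S(2)] \<alpha>] by simp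
    interpret frame_space S s "X S"
      by (rule semi_torsor_frame_space[OF K[OF S(1)] XS[OF S(1)] XK[OF S(1)]])
    show "Fr_map S (X S) (Comp (STor\<lparr>Obj := K\<rparr>) S S' S'' \<beta> \<alpha>) =
        Comp (Regular_Tor s) (Fr S (X S)) (Fr S' (X S')) (Fr S'' (X S'')) (Fr_map S' (X S') \<beta>) (Fr_map S (X S) \<alpha>)"
      unfolding STor_def Regular_Tor_def cat.simps pts_Fr eq
    proof (rule extensionalityI[of _ "frames (X S) S"])
      fix f assume f: "f \<in> frames (X S) S"
      have "compose (X S) (compose (pts S) \<beta> \<alpha>) f = compose (X S) \<beta> (compose (X S) \<alpha> f)"
        using f by (intro compose_assoc[symmetric]) (auto simp: frames_iff)
      then show "Fr_map S (X S) (compose (pts S) \<beta> \<alpha>) f =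
          compose (frames (X S) S) (Fr_map S' (X S) \<beta>) (Fr_map S (X S) \<alpha>) f"
        using f compose_frame[OF K[OF S(1)] K[OF S(2)] \<alpha> f] by (simp add: Fr_map_def compose_eq)
    qed (simp_all add: Fr_map_def)
  qed
qed

section \<open>Frames of torsors\<close>

lemma torsor_orbs:
  assumes "torsor S"
  shows "free_gspace S" "pts S \<noteq> {}" "\<And>f. f \<in> pts S \<Longrightarrow> orb S f = pts S" "orbs S = {pts S}"
proof -
  show S: "free_gspace S" and ne: "pts S \<noteq> {}"
    using assms by (simp_all add: torsor_def G_manifold_def free_gspace_def transitive_act_def)
  interpret S: free_gspace S by (rule S)
  interpret transitive_action "grp S" "pts S" "act S"
    using assms by (simp add: torsor_def transitive_act_def)
  show orb: "orb S f = pts S" if f: "f \<in> pts S" for f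
    using unique_orbit[OF f] S.act_closed f by (force simp: orbit_def)
  show "orbs S = {pts S}"
  proof (intro equalityI subsetI)
    fix \<Omega> assume "\<Omega> \<in> {pts S}"
    moreover obtain f where "f \<in> pts S" using ne by blast
    ultimately have "f \<in> pts S" "\<Omega> = orb S f" using orb by auto
    then show "\<Omega> \<in> orbs S" unfolding orbits_def by blast
  qed (use orb in \<open>auto simp: orbits_def\<close>)
qed

lemma torsor_semi_torsor:
  assumes "torsor S"
  shows "semi_torsor S"
proof -
  note o = torsor_orbs[OF assms]
  have "discrete_orbit_space S"
    unfolding discrete_orbit_space_def quotient_map_def
  proof (intro conjI allI impI)
    show "orb S ` pts S = topspace (discrete_topology (orbs S))"
      by (auto simp: orbits_def)
    fix U assume U: "U \<subseteq> topspace (discrete_topology (orbs S))"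
    then consider "U = {}" | "U = {pts S}"
      unfolding o(4) topspace_discrete_topology by blast
    then have "{f \<in> pts S. orb S f \<in> U} = {} \<or> {f \<in> pts S. orb S f \<in> U} = pts S"
      by cases (use o(3) in auto)
    then have "openin (mtop (fmfd S)) {f \<in> pts S. orb S f \<in> U}"
    proof
      assume "{f \<in> pts S. orb S f \<in> U} = {}"
      then show ?thesis by (simp only: openin_empty)
    next
      assume "{f \<in> pts S. orb S f \<in> U} = pts S"
      then show ?thesis by (simp only: openin_topspace)
    qed
    with U show "openin (mtop (fmfd S)) {f \<in> pts S. orb S f \<in> U} \<longleftrightarrow> openin (discrete_topology (orbs S)) U"
      by simp
  qed
  then show ?thesis
    using assms by (simp add: torsor_def semi_torsor_def)
qed

locale torsor_frames =
  fixes S :: "('g, 'f, 'i, 'j) gspace" and X :: "'x set" and x0 :: 'x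
  assumes torsor: "torsor S" and X: "X = {x0}"
begin

sublocale frame_space S True X
  using torsor_orbs(4)[OF torsor] X
  by (intro semi_torsor_frame_space torsor_semi_torsor[OF torsor]) (auto simp: eqpoll_singleton_iff)

lemma frames_torsor: "frames X S = X \<rightarrow>\<^sub>E pts S"
proof -
  have "bij_betw (\<lambda>x. orb S (f x)) X (orbs S)" if "f \<in> X \<rightarrow>\<^sub>E pts S" for f
  proof -
    have "orb S (f x0) = pts S"
      using that X by (intro torsor_orbs(3)[OF torsor]) auto
    then show ?thesis
      unfolding torsor_orbs(4)[OF torsor] X bij_betw_def by simp
  qed
  then show ?thesis
    by (intro equalityI subsetI) (simp_all add: frames_iff)
qed

lemma inv_permutation_x0: "\<sigma> \<in> Bij X \<Longrightarrow> inv_into X \<sigma> x0 = x0"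
  using Bij_permutation(2)[of \<sigma> X x0] X by simp

lemma Fr_eval_value: "f \<in> frames X S \<Longrightarrow> Fr_eval S X f = f x0"
  by (simp add: Fr_eval_def X)

lemma Fr_eval_hom: "Fr_eval S X \<in> tor_hom (Fr S X) S"
  unfolding regular_hom_smooth[symmetric] regular_hom_def
proof (intro CollectI conjI bexI[of _ "\<lambda>h. fst h x0"])
  have x0: "x0 \<in> X" by (simp add: X)
  show "Fr_eval S X \<in> extensional (pts (Fr S X))"
    unfolding pts_Fr by (simp add: Fr_eval_def)
  show "regular_map True (fmfd (Fr S X)) (fmfd S) (Fr_eval S X)"
    by (rule regular_map_cong[OF space_Fr space_F regular_map_frame_value[OF x0]])
       (simp only: pts_Fr Fr_eval_value)
  show "regular_map True (gmfd (Fr S X)) (gmfd S) (\<lambda>h. fst h x0)"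
    using regular_map_value[OF x0] by simp
  show "(\<lambda>h. fst h x0) \<in> hom (grp (Fr S X)) (grp S)"
    unfolding Fr_simps by (rule homI) (use x0 in \<open>auto simp: inv_permutation_x0\<close>)
  show "equivariant (Fr S X) S (\<lambda>h. fst h x0) (Fr_eval S X)"
    unfolding equivariant_def pts_Fr
  unfolding Fr_simps
  proof (intro ballI)
    fix h f assume h: "h \<in> carrier (wreath (grp S) X)" and f: "f \<in> frames X S"
    show "Fr_eval S X (act (Fr S X) h f) = act S (fst h x0) (Fr_eval S X f)"
      unfolding Fr_eval_value[OF f] Fr_eval_value[OF frame_action_closed[OF h f]]
      using x0 inv_permutation_x0[OF wreath_mem(1)[OF h]] by (simp add: act_Fr[OF f])
  qed
qed

text \<open>This is the inverse of the evaluation; it is equivariant along the diagonal \<open>G \<rightarrow> G \<wr> X\<close>.\<close>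

lemma constant_frame_hom: "(\<lambda>f\<in>pts S. \<lambda>x\<in>X. f) \<in> tor_hom S (Fr S X)"
  unfolding regular_hom_smooth[symmetric] regular_hom_def
proof (intro CollectI conjI bexI[of _ "\<lambda>g. (\<lambda>x\<in>X. g, \<lambda>x\<in>X. x)"])
  have const: "(\<lambda>x\<in>X. f) \<in> frames X S" if "f \<in> pts S" for f
    using that by (simp add: frames_torsor)
  have "regular_map True (fmfd S) (power_mfd X (fmfd S)) (\<lambda>f. \<lambda>x\<in>X. f)"
    by (rule regular_map_tuple[OF regular_map_id[OF space_F]])
  then have "regular_map True (fmfd S) (power_mfd X (fmfd S)) (\<lambda>f\<in>pts S. \<lambda>x\<in>X. f)"
    by (rule regular_map_cong[OF space_F space_FX]) simp
  then show "regular_map True (fmfd S) (fmfd (Fr S X)) (\<lambda>f\<in>pts S. \<lambda>x\<in>X. f)"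
    unfolding Fr_simps by (rule regular_map_into_restrict) (use const in auto)
  show "regular_map True (gmfd S) (gmfd (Fr S X)) (\<lambda>g. (\<lambda>x\<in>X. g, \<lambda>x\<in>X. x))"
    unfolding Fr_simps
    by (rule regular_map_into_W[OF regular_map_id[OF space_M]]) (simp add: id_Bij)
  show "(\<lambda>g. (\<lambda>x\<in>X. g, \<lambda>x\<in>X. x)) \<in> hom (grp S) (grp (Fr S X))"
    unfolding Fr_simps by (rule homI) (auto simp: id_Bij Bij_inv_into_id intro!: restrict_ext)
  show "equivariant S (Fr S X) (\<lambda>g. (\<lambda>x\<in>X. g, \<lambda>x\<in>X. x)) (\<lambda>f\<in>pts S. \<lambda>x\<in>X. f)"
    unfolding equivariant_def
  proof (intro ballI)
    fix g f assume g: "g \<in> carrier (grp S)" and f: "f \<in> pts S"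
    show "(\<lambda>f\<in>pts S. \<lambda>x\<in>X. f) (act S g f) =
        act (Fr S X) (\<lambda>x\<in>X. g, \<lambda>x\<in>X. x) ((\<lambda>f\<in>pts S. \<lambda>x\<in>X. f) f)"
      using act_closed[OF g f] f
      by (auto simp: act_Fr[OF const[OF f]] Bij_inv_into_id intro!: restrict_ext)
  qed
qed simp

lemma Fr_eval_iso: "tor_iso (Fr S X) S (Fr_eval S X)"
  unfolding tor_iso_def pts_Fr
proof (intro conjI bexI[of _ "\<lambda>f\<in>pts S. \<lambda>x\<in>X. f"])
  show "compose (frames X S) (\<lambda>f\<in>pts S. \<lambda>x\<in>X. f) (Fr_eval S X) = (\<lambda>f\<in>frames X S. f)"
  proof (rule extensionalityI[of _ "frames X S"])
    fix f assume f: "f \<in> frames X S"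
    have "(\<lambda>x\<in>X. f x0) = f"
    proof (rule extensionalityI[of _ X])
      show "f \<in> extensional X"
        using f by (auto simp: frames_torsor PiE_def)
    qed (use X in auto)
    then show "compose (frames X S) (\<lambda>f\<in>pts S. \<lambda>x\<in>X. f) (Fr_eval S X) f = (\<lambda>f\<in>frames X S. f) f"
      using frame_mem[OF f, of x0] X unfolding compose_eq[OF f] Fr_eval_value[OF f] restrict_apply'[OF f]
      by simp
  qed simp_all
  show "compose (pts S) (Fr_eval S X) (\<lambda>f\<in>pts S. \<lambda>x\<in>X. f) = (\<lambda>f\<in>pts S. f)"
  proof (rule extensionalityI[of _ "pts S"])
    fix f assume f: "f \<in> pts S"
    then have const: "(\<lambda>x\<in>X. f) \<in> frames X S" by (simp add: frames_torsor)
    show "compose (pts S) (Fr_eval S X) (\<lambda>f\<in>pts S. \<lambda>x\<in>X. f) f = (\<lambda>f\<in>pts S. f) f"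
      unfolding compose_eq[OF f] restrict_apply'[OF f] Fr_eval_value[OF const] using X by simp
  qed simp_all
qed (rule Fr_eval_hom constant_frame_hom)+

end

lemma index_choice_torsor:
  assumes "index_choice X" "torsor S"
  shows "is_singleton (X S)"
proof -
  have "X S \<approx> {pts S}"
    using index_choice_eqpoll[OF assms(1) torsor_semi_torsor[OF assms(2)]] torsor_orbs(4)[OF assms(2)] by simp
  then show ?thesis
    by (auto simp: eqpoll_singleton_iff is_singleton_def)
qed

lemma Fr_eval_natural:
  assumes X: "X = {x0}" and S: "torsor S" and S': "torsor S'" and \<alpha>: "\<alpha> \<in> tor_hom S S'"
  shows "compose (frames X S) (Fr_eval S' X) (Fr_map S X \<alpha>) = compose (frames X S) \<alpha> (Fr_eval S X)"
proof (rule extensionalityI[of _ "frames X S"])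
  interpret S: torsor_frames S X x0 using S X by unfold_locales
  interpret S': torsor_frames S' X x0 using S' X by unfold_locales
  fix f assume f: "f \<in> frames X S"
  have "f x0 \<in> pts S"
    using S.frame_mem[OF f] X by simp
  then have "\<alpha> (f x0) \<in> pts S'"
    using regular_hom_funcset[OF tor_hom_regular[OF \<alpha>]] by blast
  then have "compose X \<alpha> f \<in> frames X S'"
    unfolding S'.frames_torsor by (auto simp: compose_def X)
  then show "compose (frames X S) (Fr_eval S' X) (Fr_map S X \<alpha>) f = compose (frames X S) \<alpha> (Fr_eval S X) f"
    unfolding compose_eq[OF f] Fr_map_def restrict_apply'[OF f] S.Fr_eval_value[OF f]
    by (subst S'.Fr_eval_value) (simp_all add: X compose_eq)
qed simp_all

theorem theorem3p13:
  fixes X :: "('g, 'f, 'i, 'j) gspace \<Rightarrow> 'x set"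
  assumes "index_choice X"
  shows "is_functor STor TopTor (\<lambda>S. Fr S (X S)) (\<lambda>S S' \<alpha>. Fr_map S (X S) \<alpha>) \<and>
         is_functor FinSTor Tor (\<lambda>S. Fr S (X S)) (\<lambda>S S' \<alpha>. Fr_map S (X S) \<alpha>) \<and>
         (\<forall>S\<in>Obj Tor. is_singleton (X S) \<and> frames (X S) S = X S \<rightarrow>\<^sub>E pts S \<and>
            tor_iso (Fr S (X S)) S (Fr_eval S (X S))) \<and>
         (\<forall>S\<in>Obj Tor. \<forall>S'\<in>Obj Tor. \<forall>\<alpha>\<in>Hom Tor S S'.
            compose (frames (X S) S) (Fr_eval S' (X S')) (Fr_map S (X S) \<alpha>) =
            compose (frames (X S) S) \<alpha> (Fr_eval S (X S)))"
proof (intro conjI ballI)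
  have "STor\<lparr>Obj := {S :: ('g, 'f, 'i, 'j) gspace. semi_torsor S}\<rparr> = STor"
    by (simp add: STor_def)
  moreover have "is_functor (STor\<lparr>Obj := {S. semi_torsor S}\<rparr>) (Regular_Tor False)
      (\<lambda>S. Fr S (X S)) (\<lambda>S S' \<alpha>. Fr_map S (X S) \<alpha>)"
    by (rule Fr_functor[OF assms]) auto
  ultimately show "is_functor STor TopTor (\<lambda>S. Fr S (X S)) (\<lambda>S S' \<alpha>. Fr_map S (X S) \<alpha>)"
    by (simp add: Regular_Tor_continuous)
  have "is_functor (STor\<lparr>Obj := {S. semi_torsor S \<and> finite (orbs S)}\<rparr>) (Regular_Tor True)
      (\<lambda>S. Fr S (X S)) (\<lambda>S S' \<alpha>. Fr_map S (X S) \<alpha>)"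
    by (rule Fr_functor[OF assms]) auto
  then show "is_functor FinSTor Tor (\<lambda>S. Fr S (X S)) (\<lambda>S S' \<alpha>. Fr_map S (X S) \<alpha>)"
    by (simp add: FinSTor_def Regular_Tor_smooth)
next
  fix S :: "('g, 'f, 'i, 'j) gspace" assume "S \<in> Obj Tor"
  then have S: "torsor S" by (simp add: Tor_def)
  show sing: "is_singleton (X S)" by (rule index_choice_torsor[OF assms S])
  then obtain x0 where "X S = {x0}" by (auto simp: is_singleton_def)
  then interpret torsor_frames S "X S" x0 using S by unfold_locales
  show "frames (X S) S = X S \<rightarrow>\<^sub>E pts S" by (rule frames_torsor)
  show "tor_iso (Fr S (X S)) S (Fr_eval S (X S))" by (rule Fr_eval_iso)
next
  fix S S' :: "('g, 'f, 'i, 'j) gspace" and \<alpha>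
  assume "S \<in> Obj Tor" "S' \<in> Obj Tor" "\<alpha> \<in> Hom Tor S S'"
  then have S: "torsor S" "torsor S'" and \<alpha>: "\<alpha> \<in> tor_hom S S'" by (simp_all add: Tor_def)
  have "orbs S \<approx> orbs S'"
    using torsor_orbs(4)[OF S(1)] torsor_orbs(4)[OF S(2)] by (simp add: eqpoll_singleton_iff)
  then have eq: "X S' = X S"
    using index_choice_eq[OF assms torsor_semi_torsor[OF S(1)] torsor_semi_torsor[OF S(2)]] by simp
  obtain x0 where x0: "X S = {x0}"
    using index_choice_torsor[OF assms S(1)] by (auto simp: is_singleton_def)
  show "compose (frames (X S) S) (Fr_eval S' (X S')) (Fr_map S (X S) \<alpha>) =
      compose (frames (X S) S) \<alpha> (Fr_eval S (X S))"
    unfolding eq by (rule Fr_eval_natural[OF x0 S \<alpha>])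
qed

end
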